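(* Let $M$ be a compact, orientable Riemannian manifold of dimension $n$, let $p$ be an integer with $0\le p\le n$, and let $G:E^p(M)\to (H^p)^{\perp}\subset E^p(M)$ be the operator sending $\alpha$ to the unique solution $G\alpha\in(H^p)^\perp$ of $\Delta G\alpha=\alpha-H(\alpha)$. Then: (i) $G$ is self-adjoint: $(G\alpha,\beta)=(\alpha,G\beta)$ for all $\alpha,\beta\in E^p(M)$. (ii) $G$ is a positive operator: $(G\alpha,\alpha)\ge 0$ for all $\alpha\in E^p(M)$, and equality holds if and only if $\alpha$ is harmonic.
   Context: Manifolds are smooth and without boundary, and an orientation of $M$ is fixed. $E^p(M)$ is the real vector space of smooth $p$-forms on $M$, with inner product $(\alpha,\beta)=\int_M \alpha\wedge *\beta$, where $*$ is the Hodge star operator. $d$ is the exterior derivative and $\delta$ is its adjoint with respect to these inner products, i.e. $(d\alpha,\beta)=(\alpha,\delta\beta)$ for $\alpha$ of degree $p$ and $\beta$ of degree $p+1$. The Laplace-Beltrami operator is $\Delta=d\delta+\delta d: E^p(M)\to E^p(M)$. A form $\omega$ is harmonic if $\Delta\omega=0$, and $H^p=\{\omega\in E^p(M):\Delta\omega=0\}$ is the (finite-dimensional) space of harmonic $p$-forms. $(H^p)^{\perp}$ is the subspace of $E^p(M)$ of all forms orthogonal to $H^p$. $H:E^p(M)\to H^p$ is the orthogonal projection. For every $\alpha\in E^p(M)$ the equation $\Delta\beta=\alpha-H(\alpha)$ has exactly one solution $\beta\in(H^p)^\perp$, so $G$ is well defined. *)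

theory Defs
  imports
    "HOL-Analysis.Analysis"
    "HOL-Combinatorics.Permutations"
    "HOL-Library.Function_Algebras"
    "Jordan_Normal_Form.Determinant"
    "Jordan_Normal_Form.Gauss_Jordan_Elimination"
begin

section \<open>Calculus on open subsets of \<open>\<real>\<^sup>n\<close>\<close>

text \<open>
  \<open>\<real>\<^sup>n\<close> is the library's \<^const>\<open>Euclidean_space\<close> \<open>n\<close>: the sequences of reals that vanish from
  index \<open>n\<close> on. The coordinates are therefore numbered \<open>0, \<dots>, n - 1\<close>, and \<open>n = 0\<close> is allowed.
\<close>

type_synonym rvec = "nat \<Rightarrow> real"

definition partial :: "nat \<Rightarrow> (rvec \<Rightarrow> real) \<Rightarrow> rvec \<Rightarrow> real" where
  "partial i f y = deriv (\<lambda>t. f (y(i := t))) (y i)"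

text \<open>\<open>ck_on k n V f\<close>: \<open>f\<close> is of class \<open>C\<^sup>k\<close> on the open set \<open>V \<subseteq> \<real>\<^sup>n\<close>.\<close>

primrec ck_on :: "nat \<Rightarrow> nat \<Rightarrow> rvec set \<Rightarrow> (rvec \<Rightarrow> real) \<Rightarrow> bool" where
  "ck_on 0 n V f \<longleftrightarrow> continuous_map (subtopology (Euclidean_space n) V) euclideanreal f"
| "ck_on (Suc k) n V f \<longleftrightarrow>
     continuous_map (subtopology (Euclidean_space n) V) euclideanreal f \<and>
     (\<forall>i<n. (\<forall>y\<in>V. (\<lambda>t. f (y(i := t))) differentiable (at (y i))) \<and> ck_on k n V (partial i f))"

definition smooth_on :: "nat \<Rightarrow> rvec set \<Rightarrow> (rvec \<Rightarrow> real) \<Rightarrow> bool" where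
  "smooth_on n V f \<longleftrightarrow> (\<forall>k. ck_on k n V f)"

text \<open>The Lebesgue integral over \<open>V \<subseteq> \<real>\<^sup>n\<close>; the points of the product measure space are
  \<open>undefined\<close> outside \<open>{..<n}\<close> and have to be extended by \<open>0\<close> instead.\<close>

definition zero_extend :: "nat \<Rightarrow> rvec \<Rightarrow> rvec" where
  "zero_extend n y = (\<lambda>i. if i < n then y i else 0)"

definition integral_Rn :: "nat \<Rightarrow> rvec set \<Rightarrow> (rvec \<Rightarrow> real) \<Rightarrow> real" where
  "integral_Rn n V f =
     (LINT y|Pi\<^sub>M {..<n} (\<lambda>_. lborel). indicator V (zero_extend n y) * f (zero_extend n y))"


section \<open>Oriented Riemannian manifolds\<close>

text \<open>A chart is a domain together with a coordinate map (relevant on the domain only).\<close>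

type_synonym 'a chart = "'a set \<times> ('a \<Rightarrow> rvec)"

definition chart_image :: "'a chart \<Rightarrow> rvec set" where
  "chart_image c = snd c ` fst c"

definition in_chart :: "'a chart \<Rightarrow> ('a \<Rightarrow> 'b) \<Rightarrow> rvec \<Rightarrow> 'b" where
  "in_chart c f = f \<circ> inv_into (fst c) (snd c)"

definition chart_partial :: "'a chart \<Rightarrow> nat \<Rightarrow> ('a \<Rightarrow> real) \<Rightarrow> 'a \<Rightarrow> real" where
  "chart_partial c i f x = partial i (in_chart c f) (snd c x)"

text \<open>\<open>jacobian c d x j i\<close> is the derivative at \<open>x\<close> of the \<open>j\<close>-th coordinate of \<open>d\<close> with respect
  to the \<open>i\<close>-th coordinate of \<open>c\<close>.\<close>

definition jacobian :: "'a chart \<Rightarrow> 'a chart \<Rightarrow> 'a \<Rightarrow> nat \<Rightarrow> nat \<Rightarrow> real" where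
  "jacobian c d x j i = chart_partial c i (\<lambda>y. snd d y j) x"

definition is_chart :: "nat \<Rightarrow> 'a topology \<Rightarrow> 'a chart \<Rightarrow> bool" where
  "is_chart n X c \<longleftrightarrow>
     openin X (fst c) \<and> openin (Euclidean_space n) (chart_image c) \<and>
     homeomorphic_map (subtopology X (fst c)) (subtopology (Euclidean_space n) (chart_image c)) (snd c)"

definition smooth_atlas :: "nat \<Rightarrow> 'a topology \<Rightarrow> 'a chart set \<Rightarrow> bool" where
  "smooth_atlas n X A \<longleftrightarrow>
     (\<forall>c\<in>A. is_chart n X c) \<and> (\<Union>c\<in>A. fst c) = topspace X \<and>
     (\<forall>c\<in>A. \<forall>d\<in>A. \<forall>j<n. smooth_on n (snd c ` (fst c \<inter> fst d)) (in_chart c (\<lambda>y. snd d y j)))"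

text \<open>
  Tensor fields are given by their components in the charts of the atlas:
  \<open>metric M c x i j\<close> is the value of the Riemannian metric at \<open>x\<close> on the \<open>i\<close>-th and \<open>j\<close>-th
  coordinate vectors of \<open>c\<close>, and \<open>orient M c x\<close> is \<open>1\<close> or \<open>-1\<close> according to whether the
  coordinate basis of \<open>c\<close> at \<open>x\<close> is positively oriented or not.
\<close>

record 'a riem_mfd =
  dimen :: nat
  mtop :: "'a topology"
  atlas :: "'a chart set"
  metric :: "'a chart \<Rightarrow> 'a \<Rightarrow> nat \<Rightarrow> nat \<Rightarrow> real"
  orient :: "'a chart \<Rightarrow> 'a \<Rightarrow> real"

definition smooth_manifold :: "'a riem_mfd \<Rightarrow> bool" where
  "smooth_manifold M \<longleftrightarrow>
     Hausdorff_space (mtop M) \<and> second_countable (mtop M) \<and>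
     smooth_atlas (dimen M) (mtop M) (atlas M)"

definition riemannian_metric :: "'a riem_mfd \<Rightarrow> bool" where
  "riemannian_metric M \<longleftrightarrow> (let n = dimen M; g = metric M in
     (\<forall>c\<in>atlas M. \<forall>i<n. \<forall>j<n. smooth_on n (chart_image c) (in_chart c (\<lambda>x. g c x i j))) \<and>
     (\<forall>c\<in>atlas M. \<forall>x\<in>fst c.
        (\<forall>i<n. \<forall>j<n. g c x i j = g c x j i) \<and>
        (\<forall>v. (\<exists>i<n. v i \<noteq> 0) \<longrightarrow> (\<Sum>i<n. \<Sum>j<n. g c x i j * v i * v j) > 0)) \<and>
     (\<forall>c\<in>atlas M. \<forall>d\<in>atlas M. \<forall>x\<in>fst c \<inter> fst d. \<forall>i<n. \<forall>j<n.
        g c x i j = (\<Sum>k<n. \<Sum>l<n. g d x k l * jacobian c d x k i * jacobian c d x l j)))"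

definition orientation :: "'a riem_mfd \<Rightarrow> bool" where
  "orientation M \<longleftrightarrow> (let n = dimen M in
     (\<forall>c\<in>atlas M. (\<forall>x\<in>fst c. orient M c x \<in> {-1, 1}) \<and>
        continuous_map (subtopology (mtop M) (fst c)) euclideanreal (orient M c)) \<and>
     (\<forall>c\<in>atlas M. \<forall>d\<in>atlas M. \<forall>x\<in>fst c \<inter> fst d.
        orient M c x =
          sgn (Determinant.det (Matrix.mat n n (\<lambda>(j, i). jacobian c d x j i))) * orient M d x))"

definition compact_oriented_riemannian_manifold :: "'a riem_mfd \<Rightarrow> bool" where
  "compact_oriented_riemannian_manifold M \<longleftrightarrow>
     smooth_manifold M \<and> compact_space (mtop M) \<and> riemannian_metric M \<and> orientation M"

definition gram :: "'a riem_mfd \<Rightarrow> 'a chart \<Rightarrow> 'a \<Rightarrow> real mat" where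
  "gram M c x = Matrix.mat (dimen M) (dimen M) (\<lambda>(i, j). metric M c x i j)"

definition inverse_metric :: "'a riem_mfd \<Rightarrow> 'a chart \<Rightarrow> 'a \<Rightarrow> nat \<Rightarrow> nat \<Rightarrow> real" where
  "inverse_metric M c x i j = the (mat_inverse (gram M c x)) $$ (i, j)"


section \<open>Differential forms\<close>

text \<open>
  A form \<open>\<omega>\<close> of degree \<open>p\<close> is also given by its components: \<open>\<omega> c x [i\<^sub>1, \<dots>, i\<^sub>p]\<close> is the value of
  the alternating multilinear map \<open>\<omega>\<^sub>x\<close> on the coordinate vectors of \<open>c\<close> with indices
  \<open>i\<^sub>1, \<dots>, i\<^sub>p\<close>. All other values of the function \<open>\<omega>\<close> are \<open>0\<close>, so that equality of forms is
  equality of functions and the vector space operations are the pointwise ones.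
\<close>

type_synonym 'a form = "'a chart \<Rightarrow> 'a \<Rightarrow> nat list \<Rightarrow> real"

definition multi_indices :: "nat \<Rightarrow> nat \<Rightarrow> nat list set" where
  "multi_indices n p = {is. length is = p \<and> set is \<subseteq> {..<n}}"

definition forms :: "'a riem_mfd \<Rightarrow> nat \<Rightarrow> 'a form set" where
  "forms M p = {\<omega>. let n = dimen M in
     (\<forall>c x is. \<not> (c \<in> atlas M \<and> x \<in> fst c \<and> is \<in> multi_indices n p) \<longrightarrow> \<omega> c x is = 0) \<and>
     (\<forall>c x is \<sigma>. is \<in> multi_indices n p \<and> \<sigma> permutes {..<p} \<longrightarrow>
        \<omega> c x (permute_list \<sigma> is) = of_int (sign \<sigma>) * \<omega> c x is) \<and>
     (\<forall>c\<in>atlas M. \<forall>d\<in>atlas M. \<forall>x\<in>fst c \<inter> fst d. \<forall>is\<in>multi_indices n p.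
        \<omega> c x is = (\<Sum>js\<in>multi_indices n p. (\<Prod>a<p. jacobian c d x (js ! a) (is ! a)) * \<omega> d x js)) \<and>
     (\<forall>c\<in>atlas M. \<forall>is\<in>multi_indices n p.
        smooth_on n (chart_image c) (in_chart c (\<lambda>x. \<omega> c x is)))}"

text \<open>The exterior derivative: \<open>(d\<omega>)\<^bsub>i\<^sub>0\<dots>i\<^sub>p\<^esub>\<close> is the alternating sum over \<open>a\<close> of the partial
  derivatives in direction \<open>i\<^sub>a\<close> of the components of \<open>\<omega>\<close> with the index \<open>i\<^sub>a\<close> omitted.\<close>

definition ext_d :: "'a riem_mfd \<Rightarrow> 'a form \<Rightarrow> 'a form" where
  "ext_d M \<omega> = (\<lambda>c x is.
     if c \<in> atlas M \<and> x \<in> fst c \<and> set is \<subseteq> {..<dimen M}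
     then \<Sum>a<length is. (-1) ^ a * chart_partial c (is ! a) (\<lambda>y. \<omega> c y (take a is @ drop (Suc a) is)) x
     else 0)"

text \<open>The wedge product of a \<open>p\<close>-form and a \<open>q\<close>-form, normalised so that
  \<open>dx\<^sub>0 \<and> \<dots> \<and> dx\<^bsub>n-1\<^esub>\<close> has the value \<open>1\<close> on the coordinate basis.\<close>

definition wedge :: "nat \<Rightarrow> nat \<Rightarrow> 'a form \<Rightarrow> 'a form \<Rightarrow> 'a form" where
  "wedge p q \<alpha> \<beta> = (\<lambda>c x is.
     if length is = p + q
     then (\<Sum>\<sigma> | \<sigma> permutes {..<p + q}. of_int (sign \<sigma>) *
             \<alpha> c x (take p (permute_list \<sigma> is)) * \<beta> c x (drop p (permute_list \<sigma> is)))
          / (fact p * fact q)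
     else 0)"

definition levi_civita :: "nat \<Rightarrow> nat list \<Rightarrow> real" where
  "levi_civita n is =
     (if length is = n \<and> distinct is \<and> set is \<subseteq> {..<n}
      then of_int (sign (\<lambda>i. if i < n then is ! i else i)) else 0)"

text \<open>
  The Hodge star on \<open>p\<close>-forms, normalised by \<open>\<alpha> \<and> *\<beta> = \<langle>\<alpha>, \<beta>\<rangle> vol\<close>. The components are obtained
  by raising all indices of \<open>\<beta>\<close> with the inverse metric and contracting with the Riemannian
  volume form, whose components are \<open>\<plusminus>\<surd>det g\<close> times the Levi-Civita symbol.
\<close>

definition hodge_star :: "'a riem_mfd \<Rightarrow> nat \<Rightarrow> 'a form \<Rightarrow> 'a form" where
  "hodge_star M p \<beta> = (\<lambda>c x js.
     orient M c x * sqrt (Determinant.det (gram M c x)) / fact p *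
     (\<Sum>is\<in>multi_indices (dimen M) p. \<Sum>ks\<in>multi_indices (dimen M) p.
        (\<Prod>a<p. inverse_metric M c x (is ! a) (ks ! a)) * \<beta> c x ks * levi_civita (dimen M) (is @ js)))"


section \<open>Integration and the inner product of forms\<close>

text \<open>Continuity of the partition functions suffices for integration: the forms are multiplied by
  them but the products are never differentiated.\<close>

definition partition_of_unity :: "'a riem_mfd \<Rightarrow> ('a chart \<times> ('a \<Rightarrow> real)) list \<Rightarrow> bool" where
  "partition_of_unity M P \<longleftrightarrow>
     (\<forall>(c, \<rho>) \<in> set P. c \<in> atlas M \<and> continuous_map (mtop M) euclideanreal \<rho> \<and>
        (\<forall>x\<in>topspace (mtop M). 0 \<le> \<rho> x) \<and>
        mtop M closure_of {x \<in> topspace (mtop M). \<rho> x \<noteq> 0} \<subseteq> fst c) \<and>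
     (\<forall>x\<in>topspace (mtop M). (\<Sum>(c, \<rho>)\<leftarrow>P. \<rho> x) = 1)"

text \<open>The integral of a form of top degree over the compact manifold \<open>M\<close>. By the change of variables
  formula its value does not depend on the choice of the partition of unity.\<close>

definition integral_form :: "'a riem_mfd \<Rightarrow> 'a form \<Rightarrow> real" where
  "integral_form M \<omega> =
     (\<Sum>(c, \<rho>)\<leftarrow>(SOME P. partition_of_unity M P).
        integral_Rn (dimen M) (chart_image c)
          (in_chart c (\<lambda>x. \<rho> x * orient M c x * \<omega> c x [0..<dimen M])))"

definition form_inner :: "'a riem_mfd \<Rightarrow> nat \<Rightarrow> 'a form \<Rightarrow> 'a form \<Rightarrow> real" where
  "form_inner M p \<alpha> \<beta> = integral_form M (wedge p (dimen M - p) \<alpha> (hodge_star M p \<beta>))"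


section \<open>Laplace-Beltrami operator, harmonic forms and Green's operator\<close>

text \<open>\<open>\<delta>\<close> is the adjoint of the exterior derivative, in all degrees at once; it is \<open>0\<close> on
  \<open>0\<close>-forms. This determines \<open>\<delta>\<close> on every \<^term>\<open>forms M p\<close>.\<close>

definition codifferential :: "'a riem_mfd \<Rightarrow> ('a form \<Rightarrow> 'a form) \<Rightarrow> bool" where
  "codifferential M \<delta> \<longleftrightarrow>
     (\<forall>\<beta>\<in>forms M 0. \<delta> \<beta> = 0) \<and>
     (\<forall>p. \<forall>\<beta>\<in>forms M (Suc p). \<delta> \<beta> \<in> forms M p \<and>
        (\<forall>\<alpha>\<in>forms M p. form_inner M (Suc p) (ext_d M \<alpha>) \<beta> = form_inner M p \<alpha> (\<delta> \<beta>)))"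

definition laplacian :: "'a riem_mfd \<Rightarrow> ('a form \<Rightarrow> 'a form) \<Rightarrow> 'a form \<Rightarrow> 'a form" where
  "laplacian M \<delta> \<omega> = ext_d M (\<delta> \<omega>) + \<delta> (ext_d M \<omega>)"

definition harmonic_forms :: "'a riem_mfd \<Rightarrow> ('a form \<Rightarrow> 'a form) \<Rightarrow> nat \<Rightarrow> 'a form set" where
  "harmonic_forms M \<delta> p = {\<omega> \<in> forms M p. laplacian M \<delta> \<omega> = 0}"

definition harmonic_perp :: "'a riem_mfd \<Rightarrow> ('a form \<Rightarrow> 'a form) \<Rightarrow> nat \<Rightarrow> 'a form set" where
  "harmonic_perp M \<delta> p = {\<beta> \<in> forms M p. \<forall>h\<in>harmonic_forms M \<delta> p. form_inner M p \<beta> h = 0}"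

definition harmonic_projection ::
  "'a riem_mfd \<Rightarrow> ('a form \<Rightarrow> 'a form) \<Rightarrow> nat \<Rightarrow> ('a form \<Rightarrow> 'a form) \<Rightarrow> bool" where
  "harmonic_projection M \<delta> p H \<longleftrightarrow>
     (\<forall>\<alpha>\<in>forms M p. H \<alpha> \<in> harmonic_forms M \<delta> p \<and> \<alpha> - H \<alpha> \<in> harmonic_perp M \<delta> p)"

text \<open>The equation has at most one solution in \<^term>\<open>harmonic_perp M \<delta> p\<close>, so \<open>G\<close> is determined
  on \<^term>\<open>forms M p\<close>.\<close>

definition green_operator ::
  "'a riem_mfd \<Rightarrow> ('a form \<Rightarrow> 'a form) \<Rightarrow> nat \<Rightarrow> ('a form \<Rightarrow> 'a form) \<Rightarrow> ('a form \<Rightarrow> 'a form) \<Rightarrow> bool"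
where
  "green_operator M \<delta> p H G \<longleftrightarrow>
     (\<forall>\<alpha>\<in>forms M p. G \<alpha> \<in> harmonic_perp M \<delta> p \<and> laplacian M \<delta> (G \<alpha>) = \<alpha> - H \<alpha>)"

end

theory Submission
  imports Defs
begin

text \<open>
  Since \<open>G\<alpha>\<close> is orthogonal to the harmonic form \<open>H\<beta>\<close> and \<open>\<Delta>G\<beta> = \<beta> - H\<beta>\<close>,
  \<open>(G\<alpha>, \<beta>) = (G\<alpha>, \<Delta>G\<beta>) = (dG\<alpha>, dG\<beta>) + (\<delta>G\<alpha>, \<delta>G\<beta>)\<close>. The right-hand side is symmetric and
  nonnegative for \<open>\<alpha> = \<beta>\<close>; if it vanishes, then \<open>dG\<alpha> = 0\<close> and \<open>\<delta>G\<alpha> = 0\<close>, hence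
  \<open>\<alpha> - H\<alpha> = \<Delta>G\<alpha> = 0\<close>.

  This uses that \<open>(\<cdot>, \<cdot>)\<close> is an inner product: in a chart, \<open>\<alpha> \<and> *\<beta>\<close> is a positive multiple of
  \<open>\<surd>det g\<close> times the form induced on \<open>p\<close>-tensors by the inverse metric, which is positive
  definite because a Cholesky decomposition of the metric turns it into a sum of squares. It also
  uses that \<open>d\<close> maps forms to forms, since the adjointness of \<open>\<delta>\<close> has to be applied to \<open>dG\<alpha>\<close>.
\<close>

section \<open>Functions of class \<open>C\<^sup>k\<close>\<close>

text \<open>That \<open>ext_d\<close> maps forms to forms is the laborious half: the transformation
  rule between two charts has to be differentiated, which takes a chain rule and the symmetry of
  mixed derivatives. Both are built from \<open>partial\<close>, because smoothness is defined
  through iterated partial derivatives. For the inner product, \<open>integral_form\<close> chooses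
  a partition of unity, so one must be shown to exist, and each integrand must be shown integrable
  before a sum can be split. Definiteness is obtained pointwise: a vanishing sum of nonnegative
  chart integrals forces each continuous density to vanish wherever its partition function is
  positive, and at every point some partition function is. The ends of the degree range need care:
  degree \<open>p + 1\<close> can exceed the dimension, where the inner product is 0 and so are all
  forms, and in degree 0 there is no term with \<open>\<delta>\<close>. Finally,
  \<open>codifferential\<close> does not state linearity, so \<open>\<delta> 0 = 0\<close>, which is
  used once dG\<alpha> = 0 is known, is a step of its own.\<close>

lemma openin_Euclidean_space_box:
  assumes "openin (Euclidean_space n) V" "y \<in> V"
  obtains e where "e > 0"
    "\<And>z. z \<in> topspace (Euclidean_space n) \<Longrightarrow> (\<And>i. i < n \<Longrightarrow> \<bar>z i - y i\<bar> < e) \<Longrightarrow> z \<in> V"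
proof -
  obtain T where T: "openin (powertop_real UNIV) T" and V: "V = T \<inter> {x. \<forall>i\<ge>n. x i = 0}"
    using assms(1) by (auto simp: Euclidean_space_def openin_subtopology)
  then obtain X where X: "y \<in> Pi\<^sub>E UNIV X" "\<And>i. open (X i)" "Pi\<^sub>E UNIV X \<subseteq> T"
    using product_topology_open_contains_basis[OF T, of y] assms(2) by auto
  have "\<exists>e>0. ball (y i) e \<subseteq> X i" for i
    using X(1,2) openE[of "X i" "y i"] by (metis PiE_E UNIV_I)
  then obtain e where e: "\<And>i. e i > 0" "\<And>i. ball (y i) (e i) \<subseteq> X i" by metis
  \<comment> \<open>Beyond the first n coordinates z and y are both 0, so n radii suffice; the extra
    1 keeps the set nonempty for n = 0.\<close>
  define d where "d = Min (insert 1 (e ` {..<n}))"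
  have "d > 0" unfolding d_def using e(1) by (subst Min_gr_iff) auto
  moreover have de: "d \<le> e i" if "i < n" for i unfolding d_def using that by (intro Min_le) auto
  have "z \<in> V" if z: "z \<in> topspace (Euclidean_space n)" "\<And>i. i < n \<Longrightarrow> \<bar>z i - y i\<bar> < d" for z
  proof -
    have "z i \<in> X i" for i
    proof (cases "i < n")
      case True
      then have "z i \<in> ball (y i) (e i)" using z(2)[OF True] de[OF True]
        by (simp add: dist_real_def abs_minus_commute)
      then show ?thesis using e(2) by blast
    next
      case False
      then have "z i = y i" using z(1) assms(2) V by (simp add: topspace_Euclidean_space)
      then show ?thesis using X(1) by (auto simp: PiE_iff)
    qed
    then show ?thesis using X(3) z(1) V by (auto simp: topspace_Euclidean_space PiE_iff)
  qed
  ultimately show ?thesis using that by blast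
qed

lemma openin_preimage:
  assumes "openin X V" "continuous_map (subtopology X V) Y f" "openin Y U"
  shows "openin X {x \<in> V. f x \<in> U}"
proof -
  have "openin (subtopology X V) {x \<in> topspace (subtopology X V). f x \<in> U}"
    using assms(2,3) by (rule openin_continuous_map_preimage)
  moreover have "{x \<in> topspace (subtopology X V). f x \<in> U} = {x \<in> V. f x \<in> U}"
    using openin_subset[OF assms(1)] by auto
  ultimately show ?thesis using assms(1) openin_trans_full by metis
qed

lemma continuous_map_Euclidean_space_box:
  assumes "openin (Euclidean_space n) V" "continuous_map (subtopology (Euclidean_space n) V) euclideanreal f"
    "y \<in> V" "0 < (d::real)"
  obtains e where "e > 0"
    "\<And>z. z \<in> topspace (Euclidean_space n) \<Longrightarrow> (\<And>i. i < n \<Longrightarrow> \<bar>z i - y i\<bar> < e) \<Longrightarrow> z \<in> V \<and> \<bar>f z - f y\<bar> < d"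
proof -
  have "openin (Euclidean_space n) {x \<in> V. f x \<in> ball (f y) d}"
    using assms(1,2) by (rule openin_preimage) auto
  moreover have "y \<in> {x \<in> V. f x \<in> ball (f y) d}" using assms by auto
  ultimately obtain e where "e > 0" "\<And>z. z \<in> topspace (Euclidean_space n) \<Longrightarrow> (\<And>i. i < n \<Longrightarrow> \<bar>z i - y i\<bar> < e)
      \<Longrightarrow> z \<in> {x \<in> V. f x \<in> ball (f y) d}"
    by (rule openin_Euclidean_space_box) blast
  then show ?thesis using that[of e]
    by (auto simp: dist_real_def abs_minus_commute)
qed

lemma upd_in_topspace_Euclidean_space:
  assumes "y \<in> topspace (Euclidean_space n)" "i < n"
  shows "y(i := t) \<in> topspace (Euclidean_space n)"
  using assms by (auto simp: topspace_Euclidean_space)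

lemma eventually_upd_in:
  assumes "openin (Euclidean_space n) V" "y \<in> V" "i < n"
  shows "\<forall>\<^sub>F t in nhds (y i). y(i := t) \<in> V"
proof -
  obtain e where e: "e > 0" "\<And>z. z \<in> topspace (Euclidean_space n) \<Longrightarrow> (\<And>i. i < n \<Longrightarrow> \<bar>z i - y i\<bar> < e) \<Longrightarrow> z \<in> V"
    using openin_Euclidean_space_box[OF assms(1,2)] by blast
  have y: "y \<in> topspace (Euclidean_space n)" using assms openin_subset by blast
  have "\<forall>t. dist t (y i) < e \<longrightarrow> y(i := t) \<in> V"
    by (auto intro!: e(2) upd_in_topspace_Euclidean_space y assms simp: dist_real_def \<open>e > 0\<close>)
  then show ?thesis using e(1) by (auto simp: eventually_nhds_metric)
qed

section \<open>Locality and algebra of functions of class C^k\<close>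

lemma partial_cong:
  assumes "openin (Euclidean_space n) V" "y \<in> V" "i < n" "\<And>z. z \<in> V \<Longrightarrow> f z = g z"
  shows "partial i f y = partial i g y"
  unfolding partial_def
  by (intro deriv_cong_ev refl eventually_mono[OF eventually_upd_in[OF assms(1-3)]] assms(4))

text \<open>Openness of V makes each partial derivative depend only on values in V, so agreement on
  V passes through every order. The algebraic rules below rely on it: the partial derivatives of
  sums and multiples are known only at points of V, not as equalities of functions.\<close>

lemma ck_on_cong:
  assumes "openin (Euclidean_space n) V" "\<And>z. z \<in> V \<Longrightarrow> f z = g z" "ck_on k n V f"
  shows "ck_on k n V g"
  using assms(2,3)
proof (induction k arbitrary: f g)
  case 0
  then show ?case by (auto elim!: continuous_map_eq)
next
  case (Suc k)
  have c: "continuous_map (subtopology (Euclidean_space n) V) euclideanreal g"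
    using Suc.prems by (auto elim!: continuous_map_eq)
  have d: "(\<lambda>t. g (y(i := t))) differentiable (at (y i))" if y: "y \<in> V" "i < n" for y i
  proof -
    have "((\<lambda>t. f (y(i := t))) has_real_derivative deriv (\<lambda>t. f (y(i := t))) (y i)) (at (y i))"
      using Suc.prems y by (simp add: DERIV_deriv_iff_real_differentiable)
    then have "((\<lambda>t. g (y(i := t))) has_real_derivative deriv (\<lambda>t. f (y(i := t))) (y i)) (at (y i))"
      by (subst DERIV_cong_ev[OF refl _ refl, where g = "\<lambda>t. f (y(i := t))"])
        (auto intro!: eventually_mono[OF eventually_upd_in[OF assms(1) y]] Suc.prems(1)[symmetric])
    then show ?thesis using real_differentiable_def by blast
  qed
  have "ck_on k n V (partial i g)" if "i < n" for i
  proof (rule Suc.IH[of "partial i f"])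
    show "partial i f z = partial i g z" if "z \<in> V" for z
      using partial_cong[OF assms(1) that \<open>i < n\<close> Suc.prems(1)] .
    show "ck_on k n V (partial i f)" using Suc.prems(2) that by simp
  qed
  then show ?case using c d by simp
qed

text \<open>The base point has the form \<open>y(i := s)\<close> so that the rule applies at every
  point of a coordinate segment with the same y.\<close>

lemma DERIV_partial:
  assumes "ck_on (Suc k) n V f" "y(i := s) \<in> V" "i < n"
  shows "((\<lambda>t. f (y(i := t))) has_real_derivative partial i f (y(i := s))) (at s)"
proof -
  have "\<forall>y\<in>V. (\<lambda>t. f (y(i := t))) differentiable (at (y i))"
    using assms by simp
  from bspec[OF this assms(2)]
  have "(\<lambda>t. f ((y(i := s))(i := t))) differentiable (at ((y(i := s)) i))" .
  then show ?thesis unfolding partial_def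
    by (simp add: DERIV_deriv_iff_real_differentiable)
qed

lemma DERIV_partial':
  assumes "ck_on (Suc k) n V f" "y \<in> V" "i < n"
  shows "((\<lambda>t. f (y(i := t))) has_real_derivative partial i f y) (at (y i))"
  using DERIV_partial[of k n V f y i "y i"] assms by simp

lemma partial_const [simp]: "partial i (\<lambda>_. c) = (\<lambda>_. 0)"
  by (rule ext) (simp add: partial_def)

lemma ck_on_const: "ck_on k n V (\<lambda>_. c)"
  by (induction k arbitrary: c) auto

lemma ck_on_add:
  assumes "openin (Euclidean_space n) V" "ck_on k n V f" "ck_on k n V g"
  shows "ck_on k n V (\<lambda>y. f y + g y)"
  using assms(2,3)
proof (induction k arbitrary: f g)
  case 0
  then show ?case by (auto intro!: continuous_map_add)
next
  case (Suc k)
  have *: "partial i f y + partial i g y = partial i (\<lambda>y. f y + g y) y" if "y \<in> V" "i < n" for i y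
  proof -
    have "((\<lambda>t. f (y(i := t)) + g (y(i := t))) has_real_derivative partial i f y + partial i g y) (at (y i))"
      using DERIV_partial'[OF Suc.prems(1) that] DERIV_partial'[OF Suc.prems(2) that]
      by (rule DERIV_add)
    then show ?thesis unfolding partial_def by (metis (no_types, lifting) DERIV_imp_deriv)
  qed
  have "ck_on k n V (partial i (\<lambda>y. f y + g y))" if "i < n" for i
    by (rule ck_on_cong[OF assms(1) *[OF _ that] Suc.IH[of "partial i f" "partial i g"]])
      (use Suc.prems that in auto)
  moreover have "continuous_map (subtopology (Euclidean_space n) V) euclideanreal (\<lambda>y. f y + g y)"
    using Suc.prems by (intro continuous_map_add) auto
  moreover have "(\<lambda>t. f (y(i := t)) + g (y(i := t))) differentiable (at (y i))" if "y \<in> V" "i < n" for i y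
    using Suc.prems that by (intro differentiable_add) auto
  ultimately show ?case by simp
qed

lemma ck_on_cmult:
  assumes "openin (Euclidean_space n) V" "ck_on k n V f"
  shows "ck_on k n V (\<lambda>y. c * f y)"
  using assms(2)
proof (induction k arbitrary: f)
  case 0
  then show ?case by (auto intro!: continuous_map_real_mult)
next
  case (Suc k)
  have *: "c * partial i f y = partial i (\<lambda>y. c * f y) y" if "y \<in> V" "i < n" for i y
    unfolding partial_def using DERIV_cmult[OF DERIV_partial'[OF Suc.prems(1) that], of c]
    by (metis (no_types, lifting) DERIV_imp_deriv partial_def)
  have "ck_on k n V (partial i (\<lambda>y. c * f y))" if "i < n" for i
    by (rule ck_on_cong[OF assms(1) *[OF _ that] Suc.IH[of "partial i f"]])
      (use Suc.prems that in auto)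
  moreover have "continuous_map (subtopology (Euclidean_space n) V) euclideanreal (\<lambda>y. c * f y)"
    using Suc.prems by (intro continuous_map_real_mult) auto
  moreover have "(\<lambda>t. c * f (y(i := t))) differentiable (at (y i))" if "y \<in> V" "i < n" for i y
    using Suc.prems that by (intro differentiable_mult) auto
  ultimately show ?case by simp
qed

lemma ck_on_sum:
  assumes "openin (Euclidean_space n) V" "\<And>a. a \<in> A \<Longrightarrow> ck_on k n V (f a)"
  shows "ck_on k n V (\<lambda>y. \<Sum>a\<in>A. f a y)"
  using assms(2) by (induction A rule: infinite_finite_induct) (auto intro!: ck_on_add assms(1) ck_on_const)

lemma smooth_on_partial: "smooth_on n V f \<Longrightarrow> i < n \<Longrightarrow> smooth_on n V (partial i f)"
  unfolding smooth_on_def using ck_on.simps(2) by blast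

lemma smooth_on_cong:
  assumes "openin (Euclidean_space n) V" "\<And>z. z \<in> V \<Longrightarrow> f z = g z" "smooth_on n V f"
  shows "smooth_on n V g"
  using assms ck_on_cong unfolding smooth_on_def by metis

lemma smooth_on_const: "smooth_on n V (\<lambda>_. c)"
  by (simp add: smooth_on_def ck_on_const)

lemma smooth_on_sum_cmult:
  assumes "openin (Euclidean_space n) V" "\<And>a. a \<in> A \<Longrightarrow> smooth_on n V (f a)"
  shows "smooth_on n V (\<lambda>y. \<Sum>a\<in>A. c a * f a y)"
  using assms unfolding smooth_on_def by (auto intro!: ck_on_sum ck_on_cmult)

lemma smooth_on_imp_continuous:
  "smooth_on n V f \<Longrightarrow> continuous_map (subtopology (Euclidean_space n) V) euclideanreal f"
  unfolding smooth_on_def using ck_on.simps(1) by blast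

section \<open>Mean values, symmetry of mixed derivatives and the chain rule\<close>

lemma partial_mvt:
  assumes "ck_on (Suc k) n V f" "i < n" "\<And>s. s \<in> closed_segment a b \<Longrightarrow> z(i := s) \<in> V"
  obtains s where "s \<in> closed_segment a b" "f (z(i := b)) - f (z(i := a)) = (b - a) * partial i f (z(i := s))"
proof -
  have d: "((\<lambda>t. f (z(i := t))) has_real_derivative partial i f (z(i := s))) (at s)" if "s \<in> closed_segment a b" for s
    using DERIV_partial[OF assms(1) assms(3)[OF that] assms(2)] .
  \<comment> \<open>In the chain rule a coordinate may move in either direction or stay put, so no
    order of a and b is fixed.\<close>
  consider "a = b" | "a < b" | "b < a" by linarith
  then show ?thesis
  proof cases
    case 1
    then show ?thesis using that[of a] by simp
  next
    case 2
    then obtain s where "a < s" "s < b" "f (z(i := b)) - f (z(i := a)) = (b - a) * partial i f (z(i := s))"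
      using MVT2[of a b "\<lambda>t. f (z(i := t))" "\<lambda>s. partial i f (z(i := s))"] d
      by (auto simp: closed_segment_eq_real_ivl)
    then show ?thesis using that[of s] 2 by (auto simp: closed_segment_eq_real_ivl)
  next
    case 3
    then obtain s where s: "b < s" "s < a" "f (z(i := a)) - f (z(i := b)) = (a - b) * partial i f (z(i := s))"
      using MVT2[of b a "\<lambda>t. f (z(i := t))" "\<lambda>s. partial i f (z(i := s))"] d
      by (auto simp: closed_segment_eq_real_ivl)
    then have "f (z(i := b)) - f (z(i := a)) = (b - a) * partial i f (z(i := s))"
      by (simp add: algebra_simps)
    then show ?thesis using that[of s] s(1,2) 3 by (auto simp: closed_segment_eq_real_ivl)
  qed
qed

text \<open>The mean value theorem twice: in direction i for the difference \<open>g\<close> along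
  two parallel coordinate lines, then in direction j for \<open>partial i f\<close>. The difference
  on the left is symmetric in i and j, the mixed derivative on the right is not visibly so.\<close>

lemma second_difference:
  assumes ck: "ck_on (Suc (Suc k)) n V f" and ij: "i < n" "j < n" "i \<noteq> j" and "0 < h"
    and V: "\<And>s t. s \<in> {0..h} \<Longrightarrow> t \<in> {0..h} \<Longrightarrow> y(i := y i + s, j := y j + t) \<in> V"
  obtains s t where "s \<in> {0..h}" "t \<in> {0..h}"
    "f (y(i := y i + h, j := y j + h)) - f (y(i := y i + h)) - f (y(j := y j + h)) + f y
       = h * h * partial j (partial i f) (y(i := y i + s, j := y j + t))"
proof -
  define g where "g u = f (y(j := y j + h, i := u)) - f (y(i := u))" for u
  define g' where "g' u = partial i f (y(j := y j + h, i := u)) - partial i f (y(i := u))" for u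
  have inV: "y(j := y j + t, i := u) \<in> V" if "u \<in> {y i..y i + h}" "t \<in> {0..h}" for u t
    using V[of "u - y i" t] that ij by (simp add: fun_upd_twist)
  have "(g has_real_derivative g' u) (at u)" if "u \<in> {y i..y i + h}" for u
    unfolding g_def g'_def
    by (intro DERIV_diff DERIV_partial[OF ck] ij)
      (use inV[OF that, of 0] inV[OF that, of h] \<open>0 < h\<close> ij in \<open>auto simp: fun_upd_twist fun_upd_idem\<close>)
  then obtain u where u: "y i < u" "u < y i + h" "g (y i + h) - g (y i) = h * g' u"
    using MVT2[of "y i" "y i + h" g g'] \<open>0 < h\<close> by auto
  have "ck_on (Suc k) n V (partial i f)" using ck ij by simp
  then obtain v where v: "v \<in> closed_segment (y j) (y j + h)"
    "partial i f ((y(i := u))(j := y j + h)) - partial i f ((y(i := u))(j := y j))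
       = (y j + h - y j) * partial j (partial i f) ((y(i := u))(j := v))"
  proof (rule partial_mvt)
    fix v assume "v \<in> closed_segment (y j) (y j + h)"
    then show "(y(i := u))(j := v) \<in> V" using V[of "u - y i" "v - y j"] u \<open>0 < h\<close>
      by (auto simp: closed_segment_eq_real_ivl)
  qed (use ij in auto)
  have "g' u = h * partial j (partial i f) (y(i := u, j := v))"
    using v(2) ij by (simp add: g'_def fun_upd_twist fun_upd_idem)
  moreover have "g (y i + h) - g (y i) =
     f (y(i := y i + h, j := y j + h)) - f (y(i := y i + h)) - f (y(j := y j + h)) + f y"
    using ij by (simp add: g_def fun_upd_twist fun_upd_idem)
  ultimately show ?thesis
    using that[of "u - y i" "v - y j"] u v(1) \<open>0 < h\<close>
    by (auto simp: closed_segment_eq_real_ivl)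
qed

text \<open>Schwarz's theorem: the second difference over a small square is \<open>h * h\<close>
  times either mixed derivative, each taken at some point of the square, and continuity carries the
  equality to the corner y.\<close>

lemma partial_commute:
  assumes V: "openin (Euclidean_space n) V" and ck: "ck_on (Suc (Suc 0)) n V f"
    and "y \<in> V" and ij: "i < n" "j < n"
  shows "partial i (partial j f) y = partial j (partial i f) y"
proof (cases "i = j")
  case False
  have yE: "y \<in> topspace (Euclidean_space n)" using openin_subset[OF V] \<open>y \<in> V\<close> by blast
  show ?thesis
  proof (rule ccontr)
    assume "partial i (partial j f) y \<noteq> partial j (partial i f) y"
    \<comment> \<open>Half the gap: two numbers strictly this close to the two mixed derivatives at
      y cannot coincide.\<close>
    then have d: "0 < \<bar>partial i (partial j f) y - partial j (partial i f) y\<bar> / 2" (is "0 < ?d") by simp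
    have c: "continuous_map (subtopology (Euclidean_space n) V) euclideanreal (partial i (partial j f))"
      "continuous_map (subtopology (Euclidean_space n) V) euclideanreal (partial j (partial i f))"
      using ck ij by auto
    obtain e1 where e1: "e1 > 0" "\<And>z. z \<in> topspace (Euclidean_space n) \<Longrightarrow> (\<And>i. i < n \<Longrightarrow> \<bar>z i - y i\<bar> < e1) \<Longrightarrow>
        z \<in> V \<and> \<bar>partial i (partial j f) z - partial i (partial j f) y\<bar> < ?d"
      using continuous_map_Euclidean_space_box[OF V c(1) \<open>y \<in> V\<close> d] by blast
    obtain e2 where e2: "e2 > 0" "\<And>z. z \<in> topspace (Euclidean_space n) \<Longrightarrow> (\<And>i. i < n \<Longrightarrow> \<bar>z i - y i\<bar> < e2) \<Longrightarrow>
        z \<in> V \<and> \<bar>partial j (partial i f) z - partial j (partial i f) y\<bar> < ?d"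
      using continuous_map_Euclidean_space_box[OF V c(2) \<open>y \<in> V\<close> d] by blast
    define h where "h = min e1 e2 / 2"
    have h: "0 < h" "h < e1" "h < e2" using e1(1) e2(1) by (auto simp: h_def min_def)
    have near: "y(i := y i + s, j := y j + t) \<in> topspace (Euclidean_space n)"
      "\<bar>(y(i := y i + s, j := y j + t)) k - y k\<bar> \<le> h"
      if "s \<in> {0..h}" "t \<in> {0..h}" for s t k
      using that ij yE False by (auto intro!: upd_in_topspace_Euclidean_space)
    have near': "y(j := y j + s, i := y i + t) \<in> topspace (Euclidean_space n)"
      "\<bar>(y(j := y j + s, i := y i + t)) k - y k\<bar> \<le> h"
      if "s \<in> {0..h}" "t \<in> {0..h}" for s t k
      using that ij yE False by (auto intro!: upd_in_topspace_Euclidean_space)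
    obtain s t where st: "s \<in> {0..h}" "t \<in> {0..h}"
      "f (y(i := y i + h, j := y j + h)) - f (y(i := y i + h)) - f (y(j := y j + h)) + f y
       = h * h * partial j (partial i f) (y(i := y i + s, j := y j + t))"
      by (rule second_difference[OF ck ij False h(1), of y])
        (use near e1(2) h in \<open>meson le_less_trans\<close>)+
    obtain s' t' where st': "s' \<in> {0..h}" "t' \<in> {0..h}"
      "f (y(j := y j + h, i := y i + h)) - f (y(j := y j + h)) - f (y(i := y i + h)) + f y
       = h * h * partial i (partial j f) (y(j := y j + s', i := y i + t'))"
      by (rule second_difference[OF ck ij(2,1) False[symmetric] h(1), of y])
        (use near' e1(2) h in \<open>meson le_less_trans\<close>)+
    have "h * h * partial j (partial i f) (y(i := y i + s, j := y j + t)) =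
      h * h * partial i (partial j f) (y(j := y j + s', i := y i + t'))"
      using st(3) st'(3) unfolding fun_upd_twist[OF False, of y "y i + h" "y j + h"] by linarith
    then have "partial j (partial i f) (y(i := y i + s, j := y j + t)) =
       partial i (partial j f) (y(j := y j + s', i := y i + t'))" using h(1) by simp
    moreover have "\<bar>partial j (partial i f) (y(i := y i + s, j := y j + t)) - partial j (partial i f) y\<bar> < ?d"
      using e2(2)[of "y(i := y i + s, j := y j + t)"] near[OF st(1,2)] h(3) by (meson le_less_trans)
    moreover have "\<bar>partial i (partial j f) (y(j := y j + s', i := y i + t')) - partial i (partial j f) y\<bar> < ?d"
      using e1(2)[of "y(j := y j + s', i := y i + t')"] near'[OF st'(1,2)] h(2) by (meson le_less_trans)
    ultimately show False by (smt (verit) field_sum_of_halves)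
  qed
qed simp

text \<open>\<open>ck_on\<close> provides partial derivatives rather than a total derivative, so the
  increment is split into n moves, each changing a single coordinate. Membership in V is assumed at
  \<open>\<phi> u\<close>; for t near u it follows from openness.\<close>

lemma DERIV_chain_partial:
  assumes V: "openin (Euclidean_space n) V" and ck: "ck_on (Suc k) n V f" and "\<phi> u \<in> V"
    and \<phi>: "\<And>t. \<phi> t \<in> topspace (Euclidean_space n)"
    and D: "\<And>j. j < n \<Longrightarrow> ((\<lambda>t. \<phi> t j) has_real_derivative D j) (at u)"
  shows "((\<lambda>t. f (\<phi> t)) has_real_derivative (\<Sum>j<n. partial j f (\<phi> u) * D j)) (at u)"
proof -
  \<comment> \<open>The first m coordinates follow the curve, the others stay at time u:
    \<open>\<psi> 0\<close> is constant and \<open>\<psi> n\<close> is \<phi>.\<close>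
  define \<psi> where "\<psi> m t = (\<lambda>i. if i < m then \<phi> t i else \<phi> u i)" for m t
  have top: "(\<psi> m t)(j := s) \<in> topspace (Euclidean_space n)" if "j < n" for m t j s
    using \<phi>[of t] \<phi>[of u] that by (auto simp: \<psi>_def topspace_Euclidean_space)
  have "m \<le> n \<Longrightarrow> ((\<lambda>t. f (\<psi> m t)) has_real_derivative (\<Sum>j<m. partial j f (\<phi> u) * D j)) (at u)" for m
  proof (induction m)
    case 0
    then show ?case by (simp add: \<psi>_def)
  next
    case (Suc m)
    then have m: "m < n" by simp
    \<comment> \<open>Caratheodory's form of differentiability: the increment of coordinate m is
      factored with g continuous at u, so that nothing is divided by that increment, which may be
      0.\<close>
    obtain g where g: "\<And>t. \<phi> t m - \<phi> u m = g t * (t - u)" "isCont g u" "g u = D m"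
      using D[OF m] by (auto simp: CARAT_DERIV)
    have pc: "continuous_map (subtopology (Euclidean_space n) V) euclideanreal (partial m f)"
      using ck m by (cases k) auto
    have near: "\<forall>\<^sub>F t in at u. \<forall>i<n. \<bar>\<phi> t i - \<phi> u i\<bar> < e" if "e > 0" for e
    proof -
      have "\<forall>\<^sub>F t in at u. \<bar>\<phi> t i - \<phi> u i\<bar> < e" if "i < n" for i
      proof -
        have "((\<lambda>t. \<phi> t i) \<longlongrightarrow> \<phi> u i) (at u)"
          using DERIV_isCont[OF D[OF that]] by (simp add: isCont_def)
        from tendstoD[OF this \<open>e > 0\<close>] show ?thesis by (simp add: dist_real_def)
      qed
      then have "\<forall>\<^sub>F t in at u. \<forall>i\<in>{..<n}. \<bar>\<phi> t i - \<phi> u i\<bar> < e"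
        by (intro eventually_ball_finite) auto
      then show ?thesis by (rule eventually_mono) auto
    qed
    obtain e where e: "e > 0" "\<And>z. z \<in> topspace (Euclidean_space n) \<Longrightarrow> (\<And>i. i < n \<Longrightarrow> \<bar>z i - \<phi> u i\<bar> < e) \<Longrightarrow> z \<in> V"
      using openin_Euclidean_space_box[OF V \<open>\<phi> u \<in> V\<close>] by blast
    have close: "\<bar>((\<psi> m t)(m := s)) i - \<phi> u i\<bar> < d"
      if "\<forall>i<n. \<bar>\<phi> t i - \<phi> u i\<bar> < d" "s \<in> closed_segment (\<phi> u m) (\<phi> t m)" "i < n" "d > 0" for t s i d
    proof (cases "i = m")
      case True
      have "\<bar>\<phi> t m - \<phi> u m\<bar> < d" using that m by blast
      then show ?thesis using that(2) True
        by (auto simp: closed_segment_eq_real_ivl split: if_splits)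
    qed (use that in \<open>auto simp: \<psi>_def\<close>)
    define P where "P t s \<longleftrightarrow> s \<in> closed_segment (\<phi> u m) (\<phi> t m) \<and>
      f (\<psi> (Suc m) t) - f (\<psi> m t) = (\<phi> t m - \<phi> u m) * partial m f ((\<psi> m t)(m := s))" for t s
    have upd: "\<psi> (Suc m) t = (\<psi> m t)(m := \<phi> t m)" "\<psi> m t = (\<psi> m t)(m := \<phi> u m)" for t
      by (auto simp: \<psi>_def)
    have ex: "\<exists>s. P t s" if t: "\<forall>i<n. \<bar>\<phi> t i - \<phi> u i\<bar> < e" for t
    proof -
      obtain s where "s \<in> closed_segment (\<phi> u m) (\<phi> t m)"
        "f ((\<psi> m t)(m := \<phi> t m)) - f ((\<psi> m t)(m := \<phi> u m)) = (\<phi> t m - \<phi> u m) * partial m f ((\<psi> m t)(m := s))"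
        using ck m
      proof (rule partial_mvt)
        fix s assume "s \<in> closed_segment (\<phi> u m) (\<phi> t m)"
        then show "(\<psi> m t)(m := s) \<in> V" by (intro e(2) top[OF m] close[OF t] e(1))
      qed
      then have "P t s" unfolding P_def using upd by metis
      then show ?thesis by blast
    qed
    \<comment> \<open>The intermediate point of the mean value theorem is chosen for each t.
      Wherever it lies on its segment, the argument of \<open>partial m f\<close> tends to
      \<open>\<phi> u\<close>, so continuity gives the limit of q.\<close>
    define q where "q t = partial m f ((\<psi> m t)(m := SOME s. P t s))" for t
    have qlim: "(q \<longlongrightarrow> partial m f (\<phi> u)) (at u)"
    proof (rule tendstoI)
      fix d :: real assume "d > 0"
      obtain e' where e': "e' > 0" "\<And>z. z \<in> topspace (Euclidean_space n) \<Longrightarrow> (\<And>i. i < n \<Longrightarrow> \<bar>z i - \<phi> u i\<bar> < e') \<Longrightarrow>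
          z \<in> V \<and> \<bar>partial m f z - partial m f (\<phi> u)\<bar> < d"
        using continuous_map_Euclidean_space_box[OF V pc \<open>\<phi> u \<in> V\<close> \<open>d > 0\<close>] by blast
      have "\<forall>\<^sub>F t in at u. \<forall>i<n. \<bar>\<phi> t i - \<phi> u i\<bar> < e" "\<forall>\<^sub>F t in at u. \<forall>i<n. \<bar>\<phi> t i - \<phi> u i\<bar> < e'"
        using near e(1) e'(1) by blast+
      then show "\<forall>\<^sub>F t in at u. dist (q t) (partial m f (\<phi> u)) < d"
      proof eventually_elim
        case (elim t)
        have P: "P t (SOME s. P t s)" using ex[OF elim(1)] by (rule someI_ex)
        then have seg: "(SOME s. P t s) \<in> closed_segment (\<phi> u m) (\<phi> t m)"
          unfolding P_def by (rule conjunct1)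
        have "\<bar>q t - partial m f (\<phi> u)\<bar> < d" unfolding q_def
          by (rule e'(2)[THEN conjunct2]) (intro top[OF m], rule close[OF elim(2) seg _ e'(1)])
        then show ?case by (simp add: dist_real_def)
      qed
    qed
    have "((\<lambda>t. f (\<psi> (Suc m) t) - f (\<psi> m t)) has_real_derivative partial m f (\<phi> u) * D m) (at u)"
    proof -
      have "((\<lambda>t. q t * g t) \<longlongrightarrow> partial m f (\<phi> u) * D m) (at u)"
        using qlim g(2,3) by (auto intro!: tendsto_mult simp: isCont_def)
      moreover have "\<forall>\<^sub>F t in at u. q t * g t =
        ((f (\<psi> (Suc m) t) - f (\<psi> m t)) - (f (\<psi> (Suc m) u) - f (\<psi> m u))) / (t - u)"
        using near[OF e(1)] eventually_neq_at_within[of u u]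
      proof eventually_elim
        case (elim t)
        from ex[OF elim(1)] have "P t (SOME s. P t s)" by (rule someI_ex)
        moreover have "\<psi> (Suc m) u = \<psi> m u" by (auto simp: \<psi>_def)
        ultimately show ?case using elim unfolding P_def q_def g(1) by (simp add: field_simps)
      qed
      ultimately show ?thesis unfolding has_field_derivative_iff
        by (rule Lim_transform_eventually)
    qed
    from DERIV_add[OF this Suc.IH] m show ?case by (simp add: add.commute)
  qed
  from this[of n] have "((\<lambda>t. f (\<psi> n t)) has_real_derivative (\<Sum>j<n. partial j f (\<phi> u) * D j)) (at u)" by simp
  moreover have "\<psi> n t = \<phi> t" for t
    using \<phi>[of t] \<phi>[of u] by (auto simp: \<psi>_def topspace_Euclidean_space)
  ultimately show ?thesis by simp
qed

section \<open>The exterior derivative of a form\<close>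

lemma chart_facts:
  assumes "is_chart n X c"
  shows "openin X (fst c)" "openin (Euclidean_space n) (chart_image c)"
    "inj_on (snd c) (fst c)"
    "homeomorphic_map (subtopology X (fst c)) (subtopology (Euclidean_space n) (chart_image c)) (snd c)"
proof -
  show X: "openin X (fst c)" "openin (Euclidean_space n) (chart_image c)"
    and h: "homeomorphic_map (subtopology X (fst c)) (subtopology (Euclidean_space n) (chart_image c)) (snd c)"
    using assms by (auto simp: is_chart_def)
  have "topspace (subtopology X (fst c)) = fst c" using openin_subset[OF X(1)] by auto
  then show "inj_on (snd c) (fst c)" using homeomorphic_imp_injective_map[OF h] by simp
qed

lemma openin_chart_image:
  assumes "is_chart n X c" "openin X U" "U \<subseteq> fst c"
  shows "openin (Euclidean_space n) (snd c ` U)"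
proof -
  note cf = chart_facts[OF assms(1)]
  have "openin (subtopology X (fst c)) U" using assms(2,3) by (simp add: openin_open_subtopology cf(1))
  then have "openin (subtopology (Euclidean_space n) (chart_image c)) (snd c ` U)"
    using homeomorphic_imp_open_map[OF cf(4)] by (simp add: open_map_def)
  then show ?thesis using openin_trans_full cf(2) by blast
qed

lemma in_chart_coord [simp]:
  "inj_on (snd c) (fst c) \<Longrightarrow> x \<in> fst c \<Longrightarrow> in_chart c f (snd c x) = f x"
  by (simp add: in_chart_def)

lemma chart_partial_zero [simp]: "chart_partial c i (\<lambda>_. 0) x = 0"
  by (simp add: chart_partial_def in_chart_def partial_def)

lemma finite_multi_indices [simp]: "finite (multi_indices n p)"
  using finite_lists_length_eq[of "{..<n}" p] by (simp add: multi_indices_def conj_commute)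

lemma multi_indices_nth: "is \<in> multi_indices n p \<Longrightarrow> a \<in> {..<p} \<Longrightarrow> is ! a < n"
  unfolding multi_indices_def using nth_mem by blast

lemma sum_multi_indices_Suc:
  "(\<Sum>ks\<in>multi_indices n (Suc p). f ks) = (\<Sum>ks\<in>multi_indices n p. \<Sum>i<n. f (i # ks))"
proof -
  have "multi_indices n (Suc p) = (\<lambda>(ks, i). i # ks) ` (multi_indices n p \<times> {..<n})"
    by (auto simp: multi_indices_def length_Suc_conv image_iff)
  moreover have "inj_on (\<lambda>(ks, i). i # ks) (multi_indices n p \<times> {..<n})"
    by (auto simp: inj_on_def)
  ultimately have "sum f (multi_indices n (Suc p)) =
      (\<Sum>x\<in>multi_indices n p \<times> {..<n}. f (case x of (ks, i) \<Rightarrow> i # ks))"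
    by (simp add: sum.reindex comp_def)
  also have "\<dots> = (\<Sum>ks\<in>multi_indices n p. \<Sum>i<n. f (i # ks))"
    by (simp add: sum.cartesian_product case_prod_beta)
  finally show ?thesis .
qed

lemma permute_list_multi_indices:
  assumes "\<sigma> permutes {..<p}"
  shows "permute_list \<sigma> is \<in> multi_indices n p \<longleftrightarrow> is \<in> multi_indices n p"
  using assms by (auto simp: multi_indices_def)

lemma bij_betw_permute_list_multi_indices:
  assumes "\<sigma> permutes {..<p}"
  shows "bij_betw (permute_list \<sigma>) (multi_indices n p) (multi_indices n p)"
proof (rule bij_betw_byWitness[where f' = "permute_list (inv_into UNIV \<sigma>)"])
  show "\<forall>is\<in>multi_indices n p. permute_list (inv_into UNIV \<sigma>) (permute_list \<sigma> is) = is"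
    using assms by (auto simp: multi_indices_def permutes_inv permutes_inv_o simp flip: permute_list_compose)
  show "\<forall>is\<in>multi_indices n p. permute_list \<sigma> (permute_list (inv_into UNIV \<sigma>) is) = is"
    using assms by (auto simp: multi_indices_def permutes_inv permutes_inv_o simp flip: permute_list_compose)
qed (use assms permutes_inv permute_list_multi_indices in blast)+

lemma formsI:
  assumes "\<And>c x is. \<not> (c \<in> atlas M \<and> x \<in> fst c \<and> is \<in> multi_indices (dimen M) p) \<Longrightarrow> \<omega> c x is = 0"
    "\<And>c x is \<sigma>. is \<in> multi_indices (dimen M) p \<Longrightarrow> \<sigma> permutes {..<p} \<Longrightarrow>
        \<omega> c x (permute_list \<sigma> is) = of_int (sign \<sigma>) * \<omega> c x is"
    "\<And>c d x is. c \<in> atlas M \<Longrightarrow> d \<in> atlas M \<Longrightarrow> x \<in> fst c \<Longrightarrow> x \<in> fst d \<Longrightarrow> is \<in> multi_indices (dimen M) p \<Longrightarrow>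
        \<omega> c x is = (\<Sum>js\<in>multi_indices (dimen M) p. (\<Prod>a<p. jacobian c d x (js ! a) (is ! a)) * \<omega> d x js)"
    "\<And>c is. c \<in> atlas M \<Longrightarrow> is \<in> multi_indices (dimen M) p \<Longrightarrow>
        smooth_on (dimen M) (chart_image c) (in_chart c (\<lambda>x. \<omega> c x is))"
  shows "\<omega> \<in> forms M p"
  unfolding forms_def Let_def mem_Collect_eq using assms by blast

lemma
  assumes "\<omega> \<in> forms M p"
  shows forms_zero: "\<And>c x is. \<not> (c \<in> atlas M \<and> x \<in> fst c \<and> is \<in> multi_indices (dimen M) p) \<Longrightarrow> \<omega> c x is = 0"
    and forms_alternating: "\<And>c x is \<sigma>. is \<in> multi_indices (dimen M) p \<Longrightarrow> \<sigma> permutes {..<p} \<Longrightarrow>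
        \<omega> c x (permute_list \<sigma> is) = of_int (sign \<sigma>) * \<omega> c x is"
    and forms_transform: "\<And>c d x is. c \<in> atlas M \<Longrightarrow> d \<in> atlas M \<Longrightarrow> x \<in> fst c \<Longrightarrow> x \<in> fst d \<Longrightarrow> is \<in> multi_indices (dimen M) p \<Longrightarrow>
        \<omega> c x is = (\<Sum>js\<in>multi_indices (dimen M) p. (\<Prod>a<p. jacobian c d x (js ! a) (is ! a)) * \<omega> d x js)"
    and forms_smooth: "\<And>c is. c \<in> atlas M \<Longrightarrow> is \<in> multi_indices (dimen M) p \<Longrightarrow>
        smooth_on (dimen M) (chart_image c) (in_chart c (\<lambda>x. \<omega> c x is))"
  using assms unfolding forms_def Let_def mem_Collect_eq by blast+

lemma zero_forms: "0 \<in> forms M p"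
  by (rule formsI) (simp_all add: in_chart_def comp_def smooth_on_const)

section \<open>Sums over permutations\<close>

lemma permute_list_Cons_nth:
  assumes "\<sigma> permutes {..<Suc p}" "length is = Suc p"
  shows "permute_list \<sigma> is = is ! \<sigma> 0 # map (\<lambda>b. is ! \<sigma> (Suc b)) [0..<p]"
proof -
  have "[0..<Suc p] = 0 # map Suc [0..<p]" by (metis map_Suc_upt upt_rec zero_less_Suc)
  then show ?thesis using assms by (simp add: permute_list_def)
qed

text \<open>Expansion along the first entry. The permutations with \<open>\<sigma> 0 = a\<close> are
  \<open>permutation_insert 0 a \<tau>\<close> for \<tau> on p letters, with sign (-1)^a times that
  of \<tau>. Alternation of D in the later entries cancels the sign of \<tau>, so each a collects p!
  equal terms.\<close>

lemma sum_permutations_expand: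
  fixes D :: "nat list \<Rightarrow> real"
  assumes len: "length is = Suc p"
    and alt: "\<And>j ks \<tau>. j \<in> set is \<Longrightarrow> set ks \<subseteq> set is \<Longrightarrow> length ks = p \<Longrightarrow> \<tau> permutes {..<p} \<Longrightarrow>
       D (j # permute_list \<tau> ks) = of_int (sign \<tau>) * D (j # ks)"
  shows "(\<Sum>\<sigma> | \<sigma> permutes {..<Suc p}. of_int (sign \<sigma>) * D (permute_list \<sigma> is)) =
    fact p * (\<Sum>a<Suc p. (-1) ^ a * D (is ! a # take a is @ drop (Suc a) is))"
proof -
  let ?S = "{\<sigma>. \<sigma> permutes {..<Suc p}}" and ?F = "\<lambda>\<sigma>. of_int (sign \<sigma>) * D (permute_list \<sigma> is)"
  have img: "(\<lambda>\<sigma>. \<sigma> 0) ` ?S \<subseteq> {..<Suc p}"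
    using permutes_in_image[of _ "{..<Suc p}" 0] by auto
  have one: "sum ?F {\<sigma> \<in> ?S. \<sigma> 0 = a} = fact p * ((-1) ^ a * D (is ! a # take a is @ drop (Suc a) is))"
    if a: "a < Suc p" for a
  proof -
    have "{\<sigma> \<in> ?S. \<sigma> 0 = a} = permutation_insert 0 a ` {\<tau>. \<tau> permutes {..<p}}"
      using permutation_fix[of 0 p a] a by (simp add: lessThan_atLeast0)
    moreover have "inj_on (permutation_insert 0 a) {\<tau>. \<tau> permutes {..<p}}"
      using permutation_insert_inj_on[of 0 p a] a by (simp add: lessThan_atLeast0)
    ultimately have "sum ?F {\<sigma> \<in> ?S. \<sigma> 0 = a} = (\<Sum>\<tau> | \<tau> permutes {..<p}. ?F (permutation_insert 0 a \<tau>))"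
      by (simp add: sum.reindex)
    also have "\<dots> = (\<Sum>\<tau> | \<tau> permutes {..<p}. (-1) ^ a * D (is ! a # take a is @ drop (Suc a) is))"
    proof (rule sum.cong[OF refl])
      fix \<tau> assume "\<tau> \<in> {\<tau>. \<tau> permutes {..<p}}"
      then have \<tau>: "\<tau> permutes {..<p}" by simp
      let ?ks = "take a is @ drop (Suc a) is"
      have lk: "length ?ks = p" using len a by simp
      have "permutation_insert 0 a \<tau> permutes {..<Suc p}"
        using permutation_insert_permutes[of \<tau> p 0 a] \<tau> a by (simp add: lessThan_atLeast0)
      from permute_list_Cons_nth[OF this len]
      have "permute_list (permutation_insert 0 a \<tau>) is =
          is ! a # map (\<lambda>b. is ! permutation_insert 0 a \<tau> (Suc b)) [0..<p]" by simp
      also have "map (\<lambda>b. is ! permutation_insert 0 a \<tau> (Suc b)) [0..<p] = permute_list \<tau> ?ks"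
      proof (rule nth_equalityI)
        fix b assume "b < length (map (\<lambda>b. is ! permutation_insert 0 a \<tau> (Suc b)) [0..<p])"
        then have b: "b < p" by simp
        then have "\<tau> b < p" using permutes_in_image[OF \<tau>, of b] by simp
        then show "map (\<lambda>b. is ! permutation_insert 0 a \<tau> (Suc b)) [0..<p] ! b = permute_list \<tau> ?ks ! b"
          using b len a lk by (auto simp: permute_list_def permutation_insert_expand nth_append min_def)
      qed (use lk in simp)
      finally have pl: "permute_list (permutation_insert 0 a \<tau>) is = is ! a # permute_list \<tau> ?ks" .
      have "D (is ! a # permute_list \<tau> ?ks) = of_int (sign \<tau>) * D (is ! a # ?ks)"
        using a len lk set_take_subset[of a "is"] set_drop_subset[of "Suc a" "is"]
        by (intro alt \<tau>) auto
      moreover have "of_int (sign (permutation_insert 0 a \<tau>)) = (-1) ^ a * (of_int (sign \<tau>) :: real)"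
        using signof_permutation_insert[of \<tau> p 0 a] \<tau> a by (simp add: lessThan_atLeast0)
      moreover have "of_int (sign \<tau>) * of_int (sign \<tau>) = (1 :: real)"
        by (simp add: sign_def)
      ultimately show "?F (permutation_insert 0 a \<tau>) = (-1) ^ a * D (is ! a # ?ks)"
        unfolding pl by (simp add: mult.assoc flip: mult.assoc[of "of_int (sign \<tau>)"])
    qed
    also have "\<dots> = fact p * ((-1) ^ a * D (is ! a # take a is @ drop (Suc a) is))"
      by (simp add: card_permutations)
    finally show ?thesis .
  qed
  have "sum ?F ?S = (\<Sum>a<Suc p. sum ?F {\<sigma> \<in> ?S. \<sigma> 0 = a})"
    by (rule sum.group[symmetric]) (use img finite_permutations in auto)
  also have "\<dots> = (\<Sum>a<Suc p. fact p * ((-1) ^ a * D (is ! a # take a is @ drop (Suc a) is)))"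
    by (intro sum.cong one) auto
  finally show ?thesis by (simp only: sum_distrib_left)
qed

lemma sum_permutations_alternating:
  fixes D :: "nat list \<Rightarrow> real"
  assumes "\<pi> permutes {..<length is}"
  shows "(\<Sum>\<sigma> | \<sigma> permutes {..<length is}. of_int (sign \<sigma>) * D (permute_list \<sigma> (permute_list \<pi> is))) =
    of_int (sign \<pi>) * (\<Sum>\<sigma> | \<sigma> permutes {..<length is}. of_int (sign \<sigma>) * D (permute_list \<sigma> is))"
proof -
  have pp: "permutation \<sigma>" if "\<sigma> permutes {..<length is}" for \<sigma>
    using that permutation_permutes by blast
  have ss: "of_int (sign \<pi>) * (of_int (sign \<pi>) * r) = (r :: real)" for r
    by (simp add: sign_def)
  have "(\<Sum>\<sigma> | \<sigma> permutes {..<length is}. of_int (sign \<sigma>) * D (permute_list \<sigma> is)) =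
      (\<Sum>\<sigma> | \<sigma> permutes {..<length is}. of_int (sign (\<pi> \<circ> \<sigma>)) * D (permute_list (\<pi> \<circ> \<sigma>) is))"
    by (rule setum_permutations_compose_left[OF assms])
  also have "\<dots> = (\<Sum>\<sigma> | \<sigma> permutes {..<length is}. of_int (sign \<pi>) *
      (of_int (sign \<sigma>) * D (permute_list \<sigma> (permute_list \<pi> is))))"
    by (intro sum.cong) (auto simp: sign_compose pp assms permute_list_compose)
  finally show ?thesis by (simp add: ss flip: sum_distrib_left)
qed

text \<open>Composition with the transposition reverses the sign and fixes T, so the sum equals its
  own negative. This disposes of the second derivatives of a coordinate change.\<close>

lemma sum_sign_symmetric_eq_0:
  fixes T :: "(nat \<Rightarrow> nat) \<Rightarrow> real"
  assumes "a \<in> S" "b \<in> S" "a \<noteq> b" "finite S"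
    and "\<And>\<sigma>. \<sigma> permutes S \<Longrightarrow> T (\<sigma> \<circ> Transposition.transpose a b) = T \<sigma>"
  shows "(\<Sum>\<sigma> | \<sigma> permutes S. of_int (sign \<sigma>) * T \<sigma>) = 0"
proof -
  have t: "Transposition.transpose a b permutes S" using assms by (intro permutes_swap_id)
  have "(\<Sum>\<sigma> | \<sigma> permutes S. of_int (sign \<sigma>) * T \<sigma>) =
      (\<Sum>\<sigma> | \<sigma> permutes S. of_int (sign (\<sigma> \<circ> Transposition.transpose a b)) * T (\<sigma> \<circ> Transposition.transpose a b))"
    by (rule sum_permutations_compose_right[OF t])
  also have "\<dots> = (\<Sum>\<sigma> | \<sigma> permutes S. - (of_int (sign \<sigma>) * T \<sigma>))"
  proof (intro sum.cong refl)
    fix \<sigma> assume "\<sigma> \<in> {\<sigma>. \<sigma> permutes S}"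
    then have "\<sigma> permutes S" "permutation \<sigma>" using assms(4) permutation_permutes by auto
    moreover have "permutation (Transposition.transpose a b)" using t assms(4) permutation_permutes by blast
    ultimately show "of_int (sign (\<sigma> \<circ> Transposition.transpose a b)) * T (\<sigma> \<circ> Transposition.transpose a b) = - (of_int (sign \<sigma>) * T \<sigma>)"
      using assms(3,5) by (simp add: sign_compose sign_swap_id)
  qed
  finally show ?thesis by (simp add: sum_negf)
qed


text \<open>Parametrized by the value of coordinate j, so x sits at t = \<open>snd c x j\<close>.
  Partial derivatives in c become derivatives along a curve in the manifold, along which functions
  expressed in a second chart can be differentiated as well.\<close>

definition coord_line :: "'a chart \<Rightarrow> nat \<Rightarrow> 'a \<Rightarrow> real \<Rightarrow> 'a" where
  "coord_line c j x t = inv_into (fst c) (snd c) ((snd c x)(j := t))"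

lemma chart_partial_coord_line:
  "chart_partial c j f x = deriv (\<lambda>t. f (coord_line c j x t)) (snd c x j)"
  by (simp add: chart_partial_def partial_def in_chart_def coord_line_def)

lemma coord_line_at: "inj_on (snd c) (fst c) \<Longrightarrow> x \<in> fst c \<Longrightarrow> coord_line c j x (snd c x j) = x"
  by (simp add: coord_line_def)

lemma DERIV_coord_line:
  assumes "smooth_on n V (in_chart c f)" "snd c x \<in> V" "j < n"
  shows "((\<lambda>t. f (coord_line c j x t)) has_real_derivative chart_partial c j f x) (at (snd c x j))"
proof -
  have "ck_on (Suc 0) n V (in_chart c f)" using assms(1) unfolding smooth_on_def by blast
  from DERIV_partial'[OF this assms(2,3)] show ?thesis
    by (simp add: in_chart_def coord_line_def chart_partial_def)
qed

text \<open>The line may leave the overlap of two charts; identities that hold on the overlap still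
  hold for t near the base value, which is enough to compare derivatives.\<close>

lemma eventually_coord_line:
  assumes "is_chart n X c" "openin X U" "U \<subseteq> fst c" "x \<in> U" "j < n"
  shows "\<forall>\<^sub>F t in nhds (snd c x j). coord_line c j x t \<in> U"
proof -
  have "\<forall>\<^sub>F t in nhds (snd c x j). (snd c x)(j := t) \<in> snd c ` U"
    using eventually_upd_in[OF openin_chart_image[OF assms(1-3)]] assms(4,5) by blast
  then show ?thesis
  proof eventually_elim
    case (elim t)
    then obtain z where z: "z \<in> U" "(snd c x)(j := t) = snd c z" by blast
    then show ?case unfolding coord_line_def z(2)
      using assms(3) chart_facts(3)[OF assms(1)] by (simp add: inv_into_f_f subset_iff)
  qed
qed

section \<open>Derivatives on the overlap of two charts\<close>

lemma smooth_manifold_charts: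
  assumes "smooth_manifold M"
  shows "\<And>c. c \<in> atlas M \<Longrightarrow> is_chart (dimen M) (mtop M) c"
    and "(\<Union>c\<in>atlas M. fst c) = topspace (mtop M)"
    and "\<And>c d j. c \<in> atlas M \<Longrightarrow> d \<in> atlas M \<Longrightarrow> j < dimen M \<Longrightarrow>
       smooth_on (dimen M) (snd c ` (fst c \<inter> fst d)) (in_chart c (\<lambda>y. snd d y j))"
  using assms by (auto simp: smooth_manifold_def smooth_atlas_def)

context
  fixes M :: "'a riem_mfd" and n :: nat and c d :: "'a chart" and x :: 'a
  assumes M: "smooth_manifold M" and n: "n = dimen M"
    and c: "c \<in> atlas M" and d: "d \<in> atlas M" and x: "x \<in> fst c" "x \<in> fst d"
begin

private lemma chart_c: "is_chart n (mtop M) c" and chart_d: "is_chart n (mtop M) d"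
  using smooth_manifold_charts(1)[OF M] c d n by auto

private lemma overlap: "openin (mtop M) (fst c \<inter> fst d)" "fst c \<inter> fst d \<subseteq> fst c"
    "x \<in> fst c \<inter> fst d" "snd c x \<in> snd c ` (fst c \<inter> fst d)"
    "openin (Euclidean_space n) (snd c ` (fst c \<inter> fst d))"
  using chart_facts(1)[OF chart_c] chart_facts(1)[OF chart_d] x
  by (auto intro!: openin_Int openin_chart_image[OF chart_c])

private lemma jacobian_in_chart:
  assumes "y \<in> snd c ` (fst c \<inter> fst d)"
  shows "partial k (in_chart c (\<lambda>y. snd d y l)) y = in_chart c (\<lambda>y. jacobian c d y l k) y"
  using assms chart_facts(3)[OF chart_c] by (auto simp: jacobian_def chart_partial_def)

private lemma smooth_jacobian:
  assumes "l < n" "k < n"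
  shows "smooth_on n (snd c ` (fst c \<inter> fst d)) (in_chart c (\<lambda>y. jacobian c d y l k))"
proof (rule smooth_on_cong[OF overlap(5) jacobian_in_chart])
  show "smooth_on n (snd c ` (fst c \<inter> fst d)) (partial k (in_chart c (\<lambda>y. snd d y l)))"
    using smooth_manifold_charts(3)[OF M c d] assms n by (intro smooth_on_partial) auto
qed

text \<open>Both sides are mixed second derivatives of the l-th coordinate of d, seen as a function
  of the coordinates of c.\<close>

lemma chart_partial_jacobian_commute:
  assumes "j < n" "k < n" "l < n"
  shows "chart_partial c j (\<lambda>y. jacobian c d y l k) x = chart_partial c k (\<lambda>y. jacobian c d y l j) x"
proof -
  let ?f = "in_chart c (\<lambda>y. snd d y l)"
  have eq: "chart_partial c j (\<lambda>y. jacobian c d y l k) x = partial j (partial k ?f) (snd c x)"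
    if "j < n" for j k unfolding chart_partial_def
    using that by (intro partial_cong[OF overlap(5,4)] jacobian_in_chart[symmetric])
  have "ck_on (Suc (Suc 0)) n (snd c ` (fst c \<inter> fst d)) ?f"
    using smooth_manifold_charts(3)[OF M c d, of l] assms n unfolding smooth_on_def by blast
  from partial_commute[OF overlap(5) this overlap(4) assms(1,2)] show ?thesis
    by (simp add: eq assms)
qed

private lemma DERIV_component_coord_line:
  assumes \<omega>: "\<omega> \<in> forms M p" and j: "j < n" and ls: "ls \<in> multi_indices n p"
  shows "((\<lambda>t. \<omega> d (coord_line c j x t) ls) has_real_derivative
     (\<Sum>m<n. chart_partial d m (\<lambda>y. \<omega> d y ls) x * jacobian c d x m j)) (at (snd c x j))"
proof -
  \<comment> \<open>Where the line is outside the domain of d the value is frozen at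
    \<open>snd d x\<close>: the chain rule asks for a curve defined for all t, and near the base
    value nothing changes.\<close>
  define \<phi> where "\<phi> t = (if coord_line c j x t \<in> fst d then snd d (coord_line c j x t) else snd d x)" for t
  have ev: "\<forall>\<^sub>F t in nhds (snd c x j). coord_line c j x t \<in> fst d"
    by (rule eventually_mono[OF eventually_coord_line[OF chart_c overlap(1-3) j]]) simp
  let ?f = "in_chart d (\<lambda>y. \<omega> d y ls)"
  have \<phi>_at: "\<phi> (snd c x j) = snd d x"
    using coord_line_at[OF chart_facts(3)[OF chart_c] x(1)] x by (simp add: \<phi>_def)
  have \<phi>_in: "\<phi> t \<in> chart_image d" for t using x by (auto simp: \<phi>_def chart_image_def)
  have "((\<lambda>t. \<phi> t m) has_real_derivative jacobian c d x m j) (at (snd c x j))" if "m < n" for m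
  proof -
    have "((\<lambda>t. snd d (coord_line c j x t) m) has_real_derivative jacobian c d x m j) (at (snd c x j))"
      using DERIV_coord_line[of n "snd c ` (fst c \<inter> fst d)" c "\<lambda>y. snd d y m" x j]
        smooth_manifold_charts(3)[OF M c d] overlap(4) n that j by (simp add: jacobian_def)
    then show ?thesis
      by (subst DERIV_cong_ev[OF refl _ refl, where g = "\<lambda>t. snd d (coord_line c j x t) m"])
        (auto intro: eventually_mono[OF ev] simp: \<phi>_def)
  qed
  moreover have "ck_on (Suc 0) n (chart_image d) ?f"
    using forms_smooth[OF \<omega> d] ls n unfolding smooth_on_def by blast
  moreover have "\<phi> t \<in> topspace (Euclidean_space n)" for t
    using \<phi>_in openin_subset[OF chart_facts(2)[OF chart_d]] by blast
  ultimately have "((\<lambda>t. ?f (\<phi> t)) has_real_derivative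
      (\<Sum>m<n. partial m ?f (\<phi> (snd c x j)) * jacobian c d x m j)) (at (snd c x j))"
    by (intro DERIV_chain_partial[OF chart_facts(2)[OF chart_d] _ \<phi>_in])
  then have *: "((\<lambda>t. ?f (\<phi> t)) has_real_derivative
      (\<Sum>m<n. chart_partial d m (\<lambda>y. \<omega> d y ls) x * jacobian c d x m j)) (at (snd c x j))"
    by (simp add: \<phi>_at chart_partial_def)
  have "\<forall>\<^sub>F t in nhds (snd c x j). \<omega> d (coord_line c j x t) ls = ?f (\<phi> t)"
    using ev by (rule eventually_mono) (simp add: \<phi>_def chart_facts(3)[OF chart_d])
  from DERIV_cong_ev[OF refl this refl] * show ?thesis by blast
qed

text \<open>The transformation rule of \<omega>, differentiated by the product rule. The second
  summand is what a tensor of degree p + 1 would give; the first, with the second derivatives of the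
  coordinate change, is the obstruction that antisymmetrization removes.\<close>

lemma chart_partial_component_transform:
  assumes \<omega>: "\<omega> \<in> forms M p" and j: "j < n" and ks: "ks \<in> multi_indices n p"
  shows "chart_partial c j (\<lambda>y. \<omega> c y ks) x = (\<Sum>ls\<in>multi_indices n p.
     (\<Sum>b<p. chart_partial c j (\<lambda>y. jacobian c d y (ls ! b) (ks ! b)) x *
        (\<Prod>b'\<in>{..<p} - {b}. jacobian c d x (ls ! b') (ks ! b'))) * \<omega> d x ls
     + (\<Prod>b<p. jacobian c d x (ls ! b) (ks ! b)) *
        (\<Sum>m<n. chart_partial d m (\<lambda>y. \<omega> d y ls) x * jacobian c d x m j))"
proof -
  let ?u = "snd c x j" and ?l = "coord_line c j x"
  have l: "?l ?u = x" using coord_line_at[OF chart_facts(3)[OF chart_c] x(1)] .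
  have J: "((\<lambda>t. jacobian c d (?l t) l k) has_real_derivative
      chart_partial c j (\<lambda>y. jacobian c d y l k) x) (at ?u)" if "l < n" "k < n" for l k
    using DERIV_coord_line[OF smooth_jacobian[OF that] overlap(4) j] .
  have P: "((\<lambda>t. \<Prod>b<p. jacobian c d (?l t) (ls ! b) (ks ! b)) has_real_derivative
     (\<Sum>b<p. chart_partial c j (\<lambda>y. jacobian c d y (ls ! b) (ks ! b)) x *
        (\<Prod>b'\<in>{..<p} - {b}. jacobian c d x (ls ! b') (ks ! b')))) (at ?u)"
    if "ls \<in> multi_indices n p" for ls
  proof -
    have "ls ! b < n" "ks ! b < n" if "b \<in> {..<p}" for b
      using that ks \<open>ls \<in> multi_indices n p\<close> multi_indices_nth by blast+
    from has_field_derivative_prod[OF J[OF this], of "{..<p}"] show ?thesis by (simp add: l)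
  qed
  have D: "((\<lambda>t. \<Sum>ls\<in>multi_indices n p. (\<Prod>b<p. jacobian c d (?l t) (ls ! b) (ks ! b)) * \<omega> d (?l t) ls)
    has_real_derivative (\<Sum>ls\<in>multi_indices n p.
     (\<Sum>b<p. chart_partial c j (\<lambda>y. jacobian c d y (ls ! b) (ks ! b)) x *
        (\<Prod>b'\<in>{..<p} - {b}. jacobian c d x (ls ! b') (ks ! b'))) * \<omega> d x ls
     + (\<Sum>m<n. chart_partial d m (\<lambda>y. \<omega> d y ls) x * jacobian c d x m j) *
       (\<Prod>b<p. jacobian c d x (ls ! b) (ks ! b)))) (at ?u)"
    using DERIV_mult[OF P DERIV_component_coord_line[OF \<omega> j]]
    by (intro DERIV_sum) (simp add: l)
  have ev: "\<forall>\<^sub>F t in nhds ?u. (\<Sum>ls\<in>multi_indices n p.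
      (\<Prod>b<p. jacobian c d (?l t) (ls ! b) (ks ! b)) * \<omega> d (?l t) ls) = \<omega> c (?l t) ks"
    using eventually_coord_line[OF chart_c overlap(1-3) j]
    by (rule eventually_mono) (use forms_transform[OF \<omega> c d] ks n in auto)
  have "deriv (\<lambda>t. \<omega> c (?l t) ks) ?u = (\<Sum>ls\<in>multi_indices n p.
     (\<Sum>b<p. chart_partial c j (\<lambda>y. jacobian c d y (ls ! b) (ks ! b)) x *
        (\<Prod>b'\<in>{..<p} - {b}. jacobian c d x (ls ! b') (ks ! b'))) * \<omega> d x ls
     + (\<Sum>m<n. chart_partial d m (\<lambda>y. \<omega> d y ls) x * jacobian c d x m j) *
       (\<Prod>b<p. jacobian c d x (ls ! b) (ks ! b)))"
    by (intro DERIV_imp_deriv DERIV_cong_ev[OF refl ev refl, THEN iffD1] D)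
  then show ?thesis unfolding chart_partial_coord_line[of c j "\<lambda>y. \<omega> c y ks"]
    by (simp only: mult.commute)
qed

end


text \<open>Up to the factor \<open>p!\<close>, \<open>d\<omega>\<close> is the antisymmetrization of the partial derivatives of the
  components of \<open>\<omega>\<close>. In this form, the second derivatives of the coordinates in the transformation
  rule cancel because they are symmetric.\<close>

definition comp_deriv :: "'a form \<Rightarrow> 'a chart \<Rightarrow> 'a \<Rightarrow> nat list \<Rightarrow> real" where
  "comp_deriv \<omega> c x is = chart_partial c (hd is) (\<lambda>y. \<omega> c y (tl is)) x"

lemma comp_deriv_alternating:
  assumes \<omega>: "\<omega> \<in> forms M p" and c: "c \<in> atlas M" "x \<in> fst c"
    and "j < dimen M" "ks \<in> multi_indices (dimen M) p" "\<tau> permutes {..<p}"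
  shows "comp_deriv \<omega> c x (j # permute_list \<tau> ks) = of_int (sign \<tau>) * comp_deriv \<omega> c x (j # ks)"
proof -
  let ?s = "of_int (sign \<tau>) :: real"
  have "((\<lambda>t. \<omega> c (coord_line c j x t) ks) has_real_derivative comp_deriv \<omega> c x (j # ks)) (at (snd c x j))"
    using DERIV_coord_line[OF forms_smooth[OF \<omega> c(1) assms(5)] _ assms(4), of x] c(2)
    by (simp add: chart_image_def comp_deriv_def)
  then have "((\<lambda>t. ?s * \<omega> c (coord_line c j x t) ks) has_real_derivative ?s * comp_deriv \<omega> c x (j # ks)) (at (snd c x j))"
    by (rule DERIV_cmult)
  then have "deriv (\<lambda>t. ?s * \<omega> c (coord_line c j x t) ks) (snd c x j) = ?s * comp_deriv \<omega> c x (j # ks)"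
    by (rule DERIV_imp_deriv)
  then show ?thesis
    by (simp add: comp_deriv_def chart_partial_coord_line forms_alternating[OF \<omega> assms(5,6)])
qed

lemma ext_d_antisymmetrization:
  assumes \<omega>: "\<omega> \<in> forms M p" and c: "c \<in> atlas M" "x \<in> fst c"
    and "is": "is \<in> multi_indices (dimen M) (Suc p)"
  shows "fact p * ext_d M \<omega> c x is =
    (\<Sum>\<sigma> | \<sigma> permutes {..<Suc p}. of_int (sign \<sigma>) * comp_deriv \<omega> c x (permute_list \<sigma> is))"
proof -
  have len: "length is = Suc p" and set: "set is \<subseteq> {..<dimen M}"
    using "is" by (auto simp: multi_indices_def)
  have "(\<Sum>\<sigma> | \<sigma> permutes {..<Suc p}. of_int (sign \<sigma>) * comp_deriv \<omega> c x (permute_list \<sigma> is)) =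
    fact p * (\<Sum>a<Suc p. (-1) ^ a * comp_deriv \<omega> c x (is ! a # take a is @ drop (Suc a) is))"
    by (rule sum_permutations_expand[OF len comp_deriv_alternating[OF \<omega> c]])
      (use set in \<open>auto simp: multi_indices_def\<close>)
  then show ?thesis using c set by (simp add: ext_d_def len comp_deriv_def del: sum.lessThan_Suc)
qed

lemma ext_d_transform:
  assumes M: "smooth_manifold M" and \<omega>: "\<omega> \<in> forms M p" and c: "c \<in> atlas M" and d: "d \<in> atlas M"
    and x: "x \<in> fst c" "x \<in> fst d" and "is": "is \<in> multi_indices (dimen M) (Suc p)"
  shows "ext_d M \<omega> c x is = (\<Sum>js\<in>multi_indices (dimen M) (Suc p).
    (\<Prod>a<Suc p. jacobian c d x (js ! a) (is ! a)) * ext_d M \<omega> d x js)"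
proof -
  define n where "n = dimen M"
  let ?J = "jacobian c d x" and ?S = "{\<sigma>. \<sigma> permutes {..<Suc p}}"
  define H where "H l j k = chart_partial c j (\<lambda>y. jacobian c d y l k) x" for l j k
  \<comment> \<open>One second-derivative term for the index list permuted by \<sigma>:
    \<open>is ! \<sigma> 0\<close> is the direction of differentiation and
    \<open>is ! \<sigma> (Suc b)\<close> the lower index of the Jacobian factor that is
    differentiated.\<close>
  define second where "second ls b \<sigma> = H (ls ! b) (is ! \<sigma> 0) (is ! \<sigma> (Suc b)) *
     (\<Prod>b'\<in>{..<p} - {b}. ?J (ls ! b') (is ! \<sigma> (Suc b'))) * \<omega> d x ls" for ls b and \<sigma> :: "nat \<Rightarrow> nat"
  have isn: "is ! a < n" if "a < Suc p" for a using multi_indices_nth "is" that by (simp add: n_def)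
  have \<sigma>p: "\<sigma> a < Suc p" if "\<sigma> permutes {..<Suc p}" "a < Suc p" for \<sigma> a
    using permutes_in_image[OF that(1), of a] that(2) by simp
  have "comp_deriv \<omega> c x (permute_list \<sigma> is) = (\<Sum>ls\<in>multi_indices n p. \<Sum>b<p. second ls b \<sigma>) +
      (\<Sum>js\<in>multi_indices n (Suc p). (\<Prod>a<Suc p. ?J (js ! a) (is ! a)) * comp_deriv \<omega> d x (permute_list \<sigma> js))"
    if \<sigma>: "\<sigma> permutes {..<Suc p}" for \<sigma>
  proof -
    let ?ks = "map (\<lambda>b. is ! \<sigma> (Suc b)) [0..<p]"
    have j: "is ! \<sigma> 0 < n" using isn \<sigma>p[OF \<sigma>] by simp
    have ks: "?ks \<in> multi_indices n p" using isn \<sigma>p[OF \<sigma>] by (auto simp: multi_indices_def)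
    have len: "length is = Suc p" using "is" by (simp add: multi_indices_def)
    have "comp_deriv \<omega> c x (permute_list \<sigma> is) = chart_partial c (is ! \<sigma> 0) (\<lambda>y. \<omega> c y ?ks) x"
      by (simp add: comp_deriv_def permute_list_Cons_nth[OF \<sigma> len])
    also have "\<dots> = (\<Sum>ls\<in>multi_indices n p. \<Sum>b<p. second ls b \<sigma>) +
       (\<Sum>ls\<in>multi_indices n p. \<Sum>m<n. (\<Prod>a<Suc p. ?J ((m # ls) ! a) (is ! \<sigma> a)) * comp_deriv \<omega> d x (m # ls))"
      unfolding chart_partial_component_transform[OF M n_def c d x \<omega> j ks] sum.distrib[symmetric]
      by (intro sum.cong refl arg_cong2[of _ _ _ _ "(+)"])
        (simp_all add: second_def H_def comp_deriv_def sum_distrib_left sum_distrib_right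
          prod.lessThan_Suc_shift mult_ac del: prod.lessThan_Suc)
    also have "(\<Sum>ls\<in>multi_indices n p. \<Sum>m<n. (\<Prod>a<Suc p. ?J ((m # ls) ! a) (is ! \<sigma> a)) * comp_deriv \<omega> d x (m # ls))
       = (\<Sum>js\<in>multi_indices n (Suc p). (\<Prod>a<Suc p. ?J (js ! a) (is ! \<sigma> a)) * comp_deriv \<omega> d x js)"
      by (simp add: sum_multi_indices_Suc)
    \<comment> \<open>Permuting the summation index by \<sigma> too makes the product of Jacobian
      entries independent of \<sigma>, so that the sum over \<sigma> later acts on
      \<open>comp_deriv\<close> alone.\<close>
    also have "\<dots> = (\<Sum>js\<in>multi_indices n (Suc p).
       (\<Prod>a<Suc p. ?J (permute_list \<sigma> js ! a) (is ! \<sigma> a)) * comp_deriv \<omega> d x (permute_list \<sigma> js))"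
      by (rule sum.reindex_bij_betw[OF bij_betw_permute_list_multi_indices[OF \<sigma>], symmetric])
    also have "\<dots> = (\<Sum>js\<in>multi_indices n (Suc p).
       (\<Prod>a<Suc p. ?J (js ! a) (is ! a)) * comp_deriv \<omega> d x (permute_list \<sigma> js))"
    proof (intro sum.cong refl arg_cong2[of _ _ _ _ "(*)"])
      fix js assume "js \<in> multi_indices n (Suc p)"
      then have "length js = Suc p" by (simp add: multi_indices_def)
      then have "(\<Prod>a<Suc p. ?J (permute_list \<sigma> js ! a) (is ! \<sigma> a)) = (\<Prod>a<Suc p. ?J (js ! \<sigma> a) (is ! \<sigma> a))"
        using \<sigma> by (intro prod.cong) (auto simp: permute_list_nth)
      also have "\<dots> = (\<Prod>a<Suc p. ?J (js ! a) (is ! a))"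
        using prod.permute[OF \<sigma>, of "\<lambda>a. ?J (js ! a) (is ! a)"] by (simp add: comp_def)
      finally show "(\<Prod>a<Suc p. ?J (permute_list \<sigma> js ! a) (is ! \<sigma> a)) = (\<Prod>a<Suc p. ?J (js ! a) (is ! a))" .
    qed
    finally show ?thesis .
  qed
  then have "(\<Sum>\<sigma>\<in>?S. of_int (sign \<sigma>) * comp_deriv \<omega> c x (permute_list \<sigma> is)) =
     (\<Sum>\<sigma>\<in>?S. of_int (sign \<sigma>) * (\<Sum>ls\<in>multi_indices n p. \<Sum>b<p. second ls b \<sigma>)) +
     (\<Sum>\<sigma>\<in>?S. of_int (sign \<sigma>) * (\<Sum>js\<in>multi_indices n (Suc p).
        (\<Prod>a<Suc p. ?J (js ! a) (is ! a)) * comp_deriv \<omega> d x (permute_list \<sigma> js)))"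
    by (simp add: distrib_left sum.distrib del: prod.lessThan_Suc)
  also have "(\<Sum>\<sigma>\<in>?S. of_int (sign \<sigma>) * (\<Sum>ls\<in>multi_indices n p. \<Sum>b<p. second ls b \<sigma>)) =
     (\<Sum>ls\<in>multi_indices n p. \<Sum>b<p. \<Sum>\<sigma>\<in>?S. of_int (sign \<sigma>) * second ls b \<sigma>)"
    by (simp add: sum_distrib_left sum.swap[of _ _ ?S])
  also have "\<dots> = 0"
  proof (rule sum.neutral, rule ballI, rule sum.neutral, rule ballI)
    fix ls b assume ls: "ls \<in> multi_indices n p" and b: "b \<in> {..<p}"
    \<comment> \<open>The transposition exchanges the two lower indices of the factor
      \<open>H\<close>, which is symmetric in them, and leaves the other factors alone.\<close>
    have "second ls b (\<sigma> \<circ> Transposition.transpose 0 (Suc b)) = second ls b \<sigma>"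
      if \<sigma>: "\<sigma> permutes {..<Suc p}" for \<sigma>
    proof -
      have "H (ls ! b) (is ! \<sigma> (Suc b)) (is ! \<sigma> 0) = H (ls ! b) (is ! \<sigma> 0) (is ! \<sigma> (Suc b))"
        unfolding H_def using b isn \<sigma>p[OF \<sigma>] multi_indices_nth[OF ls b]
        by (intro chart_partial_jacobian_commute[OF M n_def c d x]) auto
      moreover have "(\<Prod>b'\<in>{..<p} - {b}. ?J (ls ! b') (is ! \<sigma> (Transposition.transpose 0 (Suc b) (Suc b')))) =
         (\<Prod>b'\<in>{..<p} - {b}. ?J (ls ! b') (is ! \<sigma> (Suc b')))"
        by (intro prod.cong) (auto simp: Transposition.transpose_def)
      ultimately show ?thesis by (simp add: second_def)
    qed
    then show "(\<Sum>\<sigma>\<in>?S. of_int (sign \<sigma>) * second ls b \<sigma>) = 0"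
      using b by (intro sum_sign_symmetric_eq_0[of 0 _ "Suc b"]) auto
  qed
  also have "(\<Sum>\<sigma>\<in>?S. of_int (sign \<sigma>) * (\<Sum>js\<in>multi_indices n (Suc p).
        (\<Prod>a<Suc p. ?J (js ! a) (is ! a)) * comp_deriv \<omega> d x (permute_list \<sigma> js))) =
     (\<Sum>js\<in>multi_indices n (Suc p). (\<Prod>a<Suc p. ?J (js ! a) (is ! a)) *
        (\<Sum>\<sigma>\<in>?S. of_int (sign \<sigma>) * comp_deriv \<omega> d x (permute_list \<sigma> js)))"
    by (simp add: sum_distrib_left sum.swap[of _ _ ?S] mult.left_commute del: prod.lessThan_Suc)
  also have "\<dots> = (\<Sum>js\<in>multi_indices n (Suc p). (\<Prod>a<Suc p. ?J (js ! a) (is ! a)) * (fact p * ext_d M \<omega> d x js))"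
    using ext_d_antisymmetrization[OF \<omega> d x(2)] by (simp add: n_def del: prod.lessThan_Suc)
  finally have "fact p * ext_d M \<omega> c x is =
      fact p * (\<Sum>js\<in>multi_indices n (Suc p). (\<Prod>a<Suc p. ?J (js ! a) (is ! a)) * ext_d M \<omega> d x js)"
    unfolding ext_d_antisymmetrization[OF \<omega> c x(1) "is", symmetric]
    by (simp add: sum_distrib_left mult.left_commute del: prod.lessThan_Suc)
  then show ?thesis by (simp add: n_def del: prod.lessThan_Suc)
qed

lemma ext_d_forms:
  assumes M: "smooth_manifold M" and \<omega>: "\<omega> \<in> forms M p"
  shows "ext_d M \<omega> \<in> forms M (Suc p)"
proof (rule formsI)
  fix c x "is"
  assume no: "\<not> (c \<in> atlas M \<and> x \<in> fst c \<and> is \<in> multi_indices (dimen M) (Suc p))"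
  show "ext_d M \<omega> c x is = 0"
  proof (cases "c \<in> atlas M \<and> x \<in> fst c \<and> set is \<subseteq> {..<dimen M}")
    case True
    then have len: "length is \<noteq> Suc p" using no by (simp add: multi_indices_def)
    \<comment> \<open>\<open>ext_d\<close> does not test the length of the list; for a wrong length,
      the list with one entry omitted has a length other than p, where \<omega> is identically
      0.\<close>
    have "(\<lambda>y. \<omega> c y (take a is @ drop (Suc a) is)) = (\<lambda>_. 0)" if "a < length is" for a
      using that len by (intro ext forms_zero[OF \<omega>]) (auto simp: multi_indices_def)
    then show ?thesis by (auto simp: ext_d_def intro!: sum.neutral)
  qed (auto simp: ext_d_def)
next
  fix c x "is" \<pi> assume "is": "is \<in> multi_indices (dimen M) (Suc p)" and \<pi>: "\<pi> permutes {..<Suc p}"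
  show "ext_d M \<omega> c x (permute_list \<pi> is) = of_int (sign \<pi>) * ext_d M \<omega> c x is"
  proof (cases "c \<in> atlas M \<and> x \<in> fst c")
    case True
    then have c: "c \<in> atlas M" "x \<in> fst c" by auto
    have len: "length is = Suc p" using "is" by (simp add: multi_indices_def)
    have pis: "permute_list \<pi> is \<in> multi_indices (dimen M) (Suc p)"
      using permute_list_multi_indices[OF \<pi>] "is" by blast
    have "fact p * ext_d M \<omega> c x (permute_list \<pi> is) = of_int (sign \<pi>) * (fact p * ext_d M \<omega> c x is)"
      unfolding ext_d_antisymmetrization[OF \<omega> c "is"] ext_d_antisymmetrization[OF \<omega> c pis]
      using sum_permutations_alternating[of \<pi> "is"] \<pi> by (simp add: len)
    then show ?thesis by simp
  qed (auto simp: ext_d_def)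
next
  fix c "is" assume c: "c \<in> atlas M" and "is": "is \<in> multi_indices (dimen M) (Suc p)"
  have len: "length is = Suc p" and set: "set is \<subseteq> {..<dimen M}"
    using "is" by (auto simp: multi_indices_def)
  note cf = chart_facts[OF smooth_manifold_charts(1)[OF M c]]
  have "smooth_on (dimen M) (chart_image c) (\<lambda>y. \<Sum>a<length is. (-1) ^ a *
     partial (is ! a) (in_chart c (\<lambda>y. \<omega> c y (take a is @ drop (Suc a) is))) y)"
  proof (intro smooth_on_sum_cmult cf(2) smooth_on_partial forms_smooth[OF \<omega> c])
    fix a assume a: "a \<in> {..<length is}"
    then show "take a is @ drop (Suc a) is \<in> multi_indices (dimen M) p"
      using len set set_take_subset[of a "is"] set_drop_subset[of "Suc a" "is"]
      by (auto simp: multi_indices_def)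
    show "is ! a < dimen M" using multi_indices_nth[OF "is"] a len by simp
  qed
  then show "smooth_on (dimen M) (chart_image c) (in_chart c (\<lambda>x. ext_d M \<omega> c x is))"
    by (rule smooth_on_cong[OF cf(2), rotated])
      (use c set cf(3) in \<open>auto simp: chart_image_def ext_d_def chart_partial_def\<close>)
qed (rule ext_d_transform[OF M \<omega>])

section \<open>The pointwise inner product\<close>

definition pos_def :: "nat \<Rightarrow> (nat \<Rightarrow> nat \<Rightarrow> real) \<Rightarrow> bool" where
  "pos_def n A \<longleftrightarrow> (\<forall>i<n. \<forall>j<n. A i j = A j i) \<and>
     (\<forall>v. (\<exists>i<n. v i \<noteq> 0) \<longrightarrow> (\<Sum>i<n. \<Sum>j<n. A i j * v i * v j) > 0)"

lemma pos_defD: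
  assumes "pos_def n A"
  shows "\<And>i j. i < n \<Longrightarrow> j < n \<Longrightarrow> A i j = A j i"
    and "\<And>v i. i < n \<Longrightarrow> v i \<noteq> 0 \<Longrightarrow> (\<Sum>i<n. \<Sum>j<n. A i j * v i * v j) > 0"
  using assms unfolding pos_def_def by blast+

text \<open>Completing the square in the last variable.\<close>

lemma pos_def_schur_complement:
  assumes "pos_def (Suc n) A"
  shows "A n n > 0" "pos_def n (\<lambda>i j. A i j - A i n * A j n / A n n)"
proof -
  have q: "(\<Sum>i<Suc n. \<Sum>j<Suc n. A i j * w i * w j) =
     (\<Sum>i<n. \<Sum>j<n. A i j * w i * w j) + 2 * w n * (\<Sum>i<n. A i n * w i) + A n n * w n * w n" for w
  proof -
    have "(\<Sum>j<n. A n j * w n * w j) = w n * (\<Sum>i<n. A i n * w i)"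
      using pos_defD(1)[OF assms, of n] by (auto simp: sum_distrib_left intro!: sum.cong)
    moreover have "(\<Sum>i<n. A i n * w i * w n) = w n * (\<Sum>i<n. A i n * w i)"
      by (simp add: sum_distrib_left mult_ac)
    ultimately show ?thesis by (simp add: sum.distrib)
  qed
  show a: "A n n > 0"
    using pos_defD(2)[OF assms, of n "\<lambda>i. if i = n then 1 else 0"] unfolding q by simp
  show "pos_def n (\<lambda>i j. A i j - A i n * A j n / A n n)" unfolding pos_def_def
  proof (intro conjI allI impI)
    fix i j assume "i < n" "j < n"
    then show "A i j - A i n * A j n / A n n = A j i - A j n * A i n / A n n"
      using pos_defD(1)[OF assms, of i j] by simp
  next
    fix v :: "nat \<Rightarrow> real" assume "\<exists>i<n. v i \<noteq> 0"
    then obtain i where i: "i < n" "v i \<noteq> 0" by blast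
    define s where "s = (\<Sum>i<n. A i n * v i)"
    \<comment> \<open>This last coordinate minimizes the quadratic form of A for given v; the
      minimum is the quadratic form of the Schur complement at v.\<close>
    define w where "w = v(n := - s / A n n)"
    have "0 < (\<Sum>i<Suc n. \<Sum>j<Suc n. A i j * w i * w j)"
      using pos_defD(2)[OF assms, of i w] i by (simp add: w_def del: sum.lessThan_Suc)
    also have "\<dots> = (\<Sum>i<n. \<Sum>j<n. A i j * v i * v j) - s * s / A n n"
      unfolding q using a by (simp add: w_def s_def field_simps)
    also have "s * s / A n n = (\<Sum>i<n. \<Sum>j<n. A i n * A j n / A n n * v i * v j)"
      by (simp add: s_def sum_product sum_divide_distrib mult_ac)
    also have "(\<Sum>i<n. \<Sum>j<n. A i j * v i * v j) - \<dots> =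
        (\<Sum>i<n. \<Sum>j<n. (A i j - A i n * A j n / A n n) * v i * v j)"
      by (simp add: left_diff_distrib sum_subtractf)
    finally show "0 < (\<Sum>i<n. \<Sum>j<n. (A i j - A i n * A j n / A n n) * v i * v j)" .
  qed
qed

text \<open>Induction through the Schur complement: A is written as B^T B, which exhibits its
  quadratic form as a sum of n squares.\<close>

lemma pos_def_cholesky:
  assumes "pos_def n A"
  obtains B where "\<And>i j. i < n \<Longrightarrow> j < n \<Longrightarrow> A i j = (\<Sum>r<n. B r i * B r j)"
proof -
  have "\<exists>B. \<forall>i<n. \<forall>j<n. A i j = (\<Sum>r<n. B r i * B r j)"
    using assms
  proof (induction n arbitrary: A)
    case (Suc n)
    note a = pos_def_schur_complement[OF Suc.prems]
    obtain B where B: "\<And>i j. i < n \<Longrightarrow> j < n \<Longrightarrow> A i j - A i n * A j n / A n n = (\<Sum>r<n. B r i * B r j)"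
      using Suc.IH[OF a(2)] by blast
    \<comment> \<open>The new row reproduces the rank-one matrix subtracted in the Schur complement;
      the old rows are 0 in column n.\<close>
    define B' where "B' r i = (if r < n then if i < n then B r i else 0 else A i n / sqrt (A n n))" for r i
    have "A i j = (\<Sum>r<Suc n. B' r i * B' r j)" if "i < Suc n" "j < Suc n" for i j
    proof -
      have "B' n i * B' n j = A i n * A j n / A n n" using a(1) by (simp add: B'_def)
      moreover have "(\<Sum>r<n. B' r i * B' r j) = (if i < n \<and> j < n then \<Sum>r<n. B r i * B r j else 0)"
        by (auto simp: B'_def)
      ultimately show ?thesis
        using that B[of i j] a(1) pos_defD(1)[OF Suc.prems, of i j] by (auto simp: less_Suc_eq)
    qed
    then show ?case by blast
  qed simp
  then show ?thesis using that by blast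
qed

text \<open>By the Cholesky factorization the determinant is a square, and a kernel vector would
  contradict definiteness.\<close>

lemma pos_def_det:
  assumes "pos_def n A"
  shows "Determinant.det (Matrix.mat n n (\<lambda>(i, j). A i j)) > 0"
proof -
  let ?G = "Matrix.mat n n (\<lambda>(i, j). A i j)"
  obtain B where B: "\<And>i j. i < n \<Longrightarrow> j < n \<Longrightarrow> A i j = (\<Sum>r<n. B r i * B r j)"
    using pos_def_cholesky[OF assms] by blast
  define C where "C = Matrix.mat n n (\<lambda>(r, i). B r i)"
  have C: "C \<in> carrier_mat n n" by (simp add: C_def)
  have "?G = transpose_mat C * C"
    by (rule eq_matI) (auto simp: C_def B scalar_prod_def lessThan_atLeast0)
  then have "Determinant.det ?G = Determinant.det C * Determinant.det C"
    using det_mult[of "transpose_mat C" n C] det_transpose[OF C] C by simp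
  then have ge: "Determinant.det ?G \<ge> 0" by simp
  have "Determinant.det ?G \<noteq> 0"
  proof
    assume "Determinant.det ?G = 0"
    then obtain v where v: "v \<in> carrier_vec n" "v \<noteq> 0\<^sub>v n" "?G *\<^sub>v v = 0\<^sub>v n"
      using det_0_iff_vec_prod_zero[of ?G n] by auto
    then obtain i where i: "i < n" "vec_index v i \<noteq> 0" by (metis carrier_vecD eq_vecI index_zero_vec)
    have "(\<Sum>j<n. A k j * vec_index v j) = 0" if "k < n" for k
      using arg_cong[OF v(3), of "\<lambda>u. vec_index u k"] that v(1)
      by (simp add: scalar_prod_def lessThan_atLeast0)
    then have "(\<Sum>k<n. \<Sum>j<n. A k j * vec_index v k * vec_index v j) = 0"
      by (intro sum.neutral) (simp add: mult.commute[of "A _ _"] mult.assoc flip: sum_distrib_left)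
    then show False using pos_defD(2)[OF assms, of i "\<lambda>i. vec_index v i"] i by simp
  qed
  with ge show ?thesis by simp
qed

text \<open>\<open>mat_inverse\<close> is computed by Gauss-Jordan elimination, whose steps branch
  on the entries. Cramer's formula identifies the result as a rational function of them, from which
  continuity of the inverse metric is read off.\<close>

lemma mat_inverse_cofactor:
  fixes G :: "real mat"
  assumes "G \<in> carrier_mat n n" "Determinant.det G \<noteq> 0"
  obtains C where "mat_inverse G = Some C" "C \<in> carrier_mat n n" "G * C = 1\<^sub>m n" "C * G = 1\<^sub>m n"
    "\<And>i j. i < n \<Longrightarrow> j < n \<Longrightarrow> C $$ (i, j) = cofactor G j i / Determinant.det G"
proof -
  obtain C where inv: "mat_inverse G = Some C"
    using mat_inverse(1)[OF assms(1), where b = "()"] det_non_zero_imp_unit[OF assms, where b = "()"]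
    by (cases "mat_inverse G") auto
  then have C: "G * C = 1\<^sub>m n" "C * G = 1\<^sub>m n" "C \<in> carrier_mat n n"
    using mat_inverse(2)[OF assms(1)] by auto
  have "C $$ (i, j) = cofactor G j i / Determinant.det G" if "i < n" "j < n" for i j
  proof -
    have "adj_mat G = 1\<^sub>m n * adj_mat G" using adj_mat(1)[OF assms(1)] by simp
    also have "\<dots> = C * (G * adj_mat G)"
      unfolding C(2)[symmetric] by (rule assoc_mult_mat[OF C(3) assms(1) adj_mat(1)[OF assms(1)]])
    also have "\<dots> = Determinant.det G \<cdot>\<^sub>m C"
      using C(3) adj_mat(2)[OF assms(1)] mult_smult_distrib[OF C(3), of "1\<^sub>m n" n] by simp
    finally have "adj_mat G $$ (i, j) = (Determinant.det G \<cdot>\<^sub>m C) $$ (i, j)" by simp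
    then show ?thesis using that C(3) assms by (simp add: adj_mat_def)
  qed
  with inv C show ?thesis using that by blast
qed

text \<open>With w = C v one has v^T C v = w^T A w, and w is nonzero because A w = v. The transpose
  of C is a left inverse of the symmetric A and therefore equals C.\<close>

lemma pos_def_inverse:
  assumes "pos_def n A" and C: "C \<in> carrier_mat n n"
    and GC: "Matrix.mat n n (\<lambda>(i, j). A i j) * C = 1\<^sub>m n" and CG: "C * Matrix.mat n n (\<lambda>(i, j). A i j) = 1\<^sub>m n"
  shows "pos_def n (\<lambda>i j. C $$ (i, j))"
proof -
  let ?G = "Matrix.mat n n (\<lambda>(i, j). A i j)"
  have G: "?G \<in> carrier_mat n n" by simp
  have "transpose_mat ?G = ?G" using pos_defD(1)[OF assms(1)] by (intro eq_matI) auto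
  then have CtG: "transpose_mat C * ?G = 1\<^sub>m n"
    using transpose_mult[OF G C] GC by simp
  have Ct: "transpose_mat C \<in> carrier_mat n n" using C by simp
  have "transpose_mat C = transpose_mat C * (?G * C)" using GC Ct by simp
  also have "\<dots> = (transpose_mat C * ?G) * C" by (rule assoc_mult_mat[OF Ct G C, symmetric])
  also have "\<dots> = C" using CtG C by simp
  finally have Ct_eq: "transpose_mat C = C" .
  have sym: "C $$ (i, j) = C $$ (j, i)" if "i < n" "j < n" for i j
    using arg_cong[OF Ct_eq, of "\<lambda>X. X $$ (i, j)"] that C by simp
  have GC': "(\<Sum>k<n. A i k * C $$ (k, j)) = (if i = j then 1 else 0)" if "i < n" "j < n" for i j
    using arg_cong[OF GC, of "\<lambda>X. X $$ (i, j)"] that C by (simp add: scalar_prod_def lessThan_atLeast0)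
  show ?thesis unfolding pos_def_def
  proof (intro conjI allI impI sym)
    fix v :: "nat \<Rightarrow> real" assume "\<exists>i<n. v i \<noteq> 0"
    then obtain i where i: "i < n" "v i \<noteq> 0" by blast
    define w where "w k = (\<Sum>j<n. C $$ (k, j) * v j)" for k
    have v: "(\<Sum>k<n. A i k * w k) = v i" if "i < n" for i
    proof -
      have "(\<Sum>k<n. A i k * w k) = (\<Sum>j<n. (\<Sum>k<n. A i k * C $$ (k, j)) * v j)"
        unfolding w_def sum_distrib_left sum_distrib_right by (subst sum.swap) (simp add: mult.assoc)
      also have "\<dots> = (\<Sum>j<n. if i = j then v j else 0)" using that by (intro sum.cong) (auto simp: GC')
      also have "\<dots> = v i" using that by simp
      finally show ?thesis .
    qed
    obtain k where k: "k < n" "w k \<noteq> 0"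
    proof (rule ccontr)
      assume "\<not> thesis"
      then have "\<forall>k<n. w k = 0" using that by blast
      then have "v i = 0" using v[OF i(1)] by simp
      then show False using i by simp
    qed
    have "0 < (\<Sum>i<n. \<Sum>j<n. A i j * w i * w j)" using pos_defD(2)[OF assms(1), of k w] k by blast
    also have "\<dots> = (\<Sum>i<n. w i * (\<Sum>j<n. A i j * w j))"
      by (simp add: sum_distrib_left mult_ac)
    also have "\<dots> = (\<Sum>i<n. w i * v i)" by (simp add: v)
    also have "\<dots> = (\<Sum>i<n. \<Sum>j<n. C $$ (i, j) * v i * v j)"
      by (simp add: w_def sum_distrib_left sum_distrib_right mult_ac)
    finally show "0 < (\<Sum>i<n. \<Sum>j<n. C $$ (i, j) * v i * v j)" .
  qed
qed

section \<open>The bilinear form that a matrix induces on tensors\<close>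

definition tensor_form :: "nat \<Rightarrow> nat \<Rightarrow> (nat \<Rightarrow> nat \<Rightarrow> real) \<Rightarrow> (nat list \<Rightarrow> real) \<Rightarrow> (nat list \<Rightarrow> real) \<Rightarrow> real" where
  "tensor_form n p h \<alpha> \<beta> = (\<Sum>is\<in>multi_indices n p. \<Sum>ks\<in>multi_indices n p.
     (\<Prod>a<p. h (is ! a) (ks ! a)) * \<alpha> is * \<beta> ks)"

lemma tensor_form_commute:
  assumes "pos_def n h"
  shows "tensor_form n p h \<alpha> \<beta> = tensor_form n p h \<beta> \<alpha>"
proof -
  have "(\<Prod>a<p. h (is ! a) (ks ! a)) = (\<Prod>a<p. h (ks ! a) (is ! a))"
    if "is \<in> multi_indices n p" "ks \<in> multi_indices n p" for "is" ks
    using multi_indices_nth[OF that(1)] multi_indices_nth[OF that(2)]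
    by (intro prod.cong refl pos_defD(1)[OF assms]) auto
  then show ?thesis unfolding tensor_form_def
    by (subst sum.swap) (auto intro!: sum.cong)
qed

lemma tensor_form_add_right:
  "tensor_form n p h \<alpha> (\<lambda>ks. \<beta> ks + \<gamma> ks) = tensor_form n p h \<alpha> \<beta> + tensor_form n p h \<alpha> \<gamma>"
  by (simp add: tensor_form_def distrib_left sum.distrib)

lemma sum_swap3: "(\<Sum>i\<in>A. \<Sum>k\<in>B. \<Sum>r\<in>C. f i k r) = (\<Sum>r\<in>C. \<Sum>i\<in>A. \<Sum>k\<in>B. f i k r)"
proof -
  have "(\<Sum>i\<in>A. \<Sum>k\<in>B. \<Sum>r\<in>C. f i k r) = (\<Sum>i\<in>A. \<Sum>r\<in>C. \<Sum>k\<in>B. f i k r)"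
    by (intro sum.cong refl sum.swap)
  also have "\<dots> = (\<Sum>r\<in>C. \<Sum>i\<in>A. \<Sum>k\<in>B. f i k r)" by (rule sum.swap)
  finally show ?thesis .
qed

text \<open>Factoring h as B^T B in the first slot alone writes the form in degree p + 1 as a sum of
  n forms in degree p, evaluated on the contractions of \<alpha> with the rows of B. This is the
  induction step for positivity.\<close>

lemma tensor_form_Suc:
  assumes B: "\<And>i j. i < n \<Longrightarrow> j < n \<Longrightarrow> h i j = (\<Sum>r<n. B r i * B r j)"
  shows "tensor_form n (Suc p) h \<alpha> \<alpha> =
    (\<Sum>r<n. tensor_form n p h (\<lambda>is. \<Sum>i<n. B r i * \<alpha> (i # is)) (\<lambda>is. \<Sum>i<n. B r i * \<alpha> (i # is)))"
proof -
  let ?I = "multi_indices n p"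
  have "tensor_form n (Suc p) h \<alpha> \<alpha> = (\<Sum>is\<in>?I. \<Sum>i<n. \<Sum>ks\<in>?I. \<Sum>k<n.
      (\<Prod>a<p. h (is ! a) (ks ! a)) * (\<Sum>r<n. B r i * \<alpha> (i # is) * (B r k * \<alpha> (k # ks))))"
    unfolding tensor_form_def sum_multi_indices_Suc
    by (intro sum.cong refl)
      (simp add: prod.lessThan_Suc_shift B sum_distrib_left sum_distrib_right mult_ac del: prod.lessThan_Suc)
  also have "\<dots> = (\<Sum>is\<in>?I. \<Sum>ks\<in>?I. \<Sum>i<n. \<Sum>k<n.
      (\<Prod>a<p. h (is ! a) (ks ! a)) * (\<Sum>r<n. B r i * \<alpha> (i # is) * (B r k * \<alpha> (k # ks))))"
    by (intro sum.cong refl sum.swap)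
  also have "\<dots> = (\<Sum>is\<in>?I. \<Sum>ks\<in>?I. \<Sum>r<n. (\<Prod>a<p. h (is ! a) (ks ! a)) *
      ((\<Sum>i<n. B r i * \<alpha> (i # is)) * (\<Sum>k<n. B r k * \<alpha> (k # ks))))"
    unfolding sum_product unfolding sum_distrib_left by (intro sum.cong refl sum_swap3)
  also have "\<dots> = (\<Sum>r<n. \<Sum>is\<in>?I. \<Sum>ks\<in>?I. (\<Prod>a<p. h (is ! a) (ks ! a)) *
      ((\<Sum>i<n. B r i * \<alpha> (i # is)) * (\<Sum>k<n. B r k * \<alpha> (k # ks))))"
    by (rule sum_swap3)
  finally show ?thesis by (simp add: tensor_form_def mult.assoc)
qed

lemma tensor_form_pos:
  assumes "pos_def n h"
  shows "tensor_form n p h \<alpha> \<alpha> \<ge> 0"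
    and "tensor_form n p h \<alpha> \<alpha> = 0 \<Longrightarrow> is \<in> multi_indices n p \<Longrightarrow> \<alpha> is = 0"
proof -
  obtain B where B: "\<And>i j. i < n \<Longrightarrow> j < n \<Longrightarrow> h i j = (\<Sum>r<n. B r i * B r j)"
    using pos_def_cholesky[OF assms] by blast
  \<comment> \<open>Injectivity of B: a tensor all of whose contractions with the rows of B vanish
    is itself 0.\<close>
  have inj: "v i = 0" if v: "\<And>r. r < n \<Longrightarrow> (\<Sum>i<n. B r i * v i) = 0" and "i < n" for v i
  proof (rule ccontr)
    assume "v i \<noteq> 0"
    then have "0 < (\<Sum>i<n. \<Sum>j<n. h i j * v i * v j)" using pos_defD(2)[OF assms \<open>i < n\<close>] by blast
    also have "\<dots> = (\<Sum>i<n. \<Sum>j<n. \<Sum>r<n. (B r i * v i) * (B r j * v j))"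
      by (intro sum.cong refl) (simp add: B sum_distrib_left sum_distrib_right mult_ac)
    also have "\<dots> = (\<Sum>r<n. \<Sum>i<n. \<Sum>j<n. (B r i * v i) * (B r j * v j))"
      by (rule sum_swap3)
    also have "\<dots> = (\<Sum>r<n. (\<Sum>i<n. B r i * v i) * (\<Sum>i<n. B r i * v i))"
      by (simp add: sum_product)
    also have "\<dots> = 0" by (simp add: v)
    finally show False by simp
  qed
  have "tensor_form n p h \<alpha> \<alpha> \<ge> 0 \<and>
    (tensor_form n p h \<alpha> \<alpha> = 0 \<longrightarrow> (\<forall>is\<in>multi_indices n p. \<alpha> is = 0))"
  proof (induction p arbitrary: \<alpha>)
    case 0
    have "multi_indices n 0 = {[]}" by (auto simp: multi_indices_def)
    then show ?case by (simp add: tensor_form_def)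
  next
    case (Suc p)
    let ?b = "\<lambda>r is. \<Sum>i<n. B r i * \<alpha> (i # is)"
    have eq: "tensor_form n (Suc p) h \<alpha> \<alpha> = (\<Sum>r<n. tensor_form n p h (?b r) (?b r))"
      by (rule tensor_form_Suc) (rule B)
    have "tensor_form n (Suc p) h \<alpha> \<alpha> \<ge> 0" unfolding eq using Suc by (intro sum_nonneg) blast
    moreover have "\<alpha> is = 0" if z: "tensor_form n (Suc p) h \<alpha> \<alpha> = 0" and "is": "is \<in> multi_indices n (Suc p)" for "is"
    proof -
      obtain i ls where ls: "is = i # ls" "i < n" "ls \<in> multi_indices n p"
        using "is" by (auto simp: multi_indices_def length_Suc_conv)
      have "tensor_form n p h (?b r) (?b r) = 0" if "r < n" for r
        using z that Suc unfolding eq by (subst (asm) sum_nonneg_eq_0_iff) auto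
      then have "(\<Sum>i<n. B r i * \<alpha> (i # ls)) = 0" if "r < n" for r
        using Suc[of "?b r"] ls(3) that by blast
      from inj[OF this ls(2)] show ?thesis using ls(1) by simp
    qed
    ultimately show ?case by blast
  qed
  then show "tensor_form n p h \<alpha> \<alpha> \<ge> 0"
    "tensor_form n p h \<alpha> \<alpha> = 0 \<Longrightarrow> is \<in> multi_indices n p \<Longrightarrow> \<alpha> is = 0" by blast+
qed


section \<open>The wedge product with the Hodge star\<close>

lemma forms_not_distinct:
  assumes \<omega>: "\<omega> \<in> forms M p" and "is": "is \<in> multi_indices (dimen M) p" "\<not> distinct is"
  shows "\<omega> c x is = 0"
proof -
  have len: "length is = p" using "is" by (simp add: multi_indices_def)
  obtain a b where ab: "a < p" "b < p" "a \<noteq> b" "is ! a = is ! b"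
    using "is"(2) len by (auto simp: distinct_conv_nth)
  let ?\<tau> = "Transposition.transpose a b"
  have \<tau>: "?\<tau> permutes {..<p}" using ab by (intro permutes_swap_id) auto
  have "permute_list ?\<tau> is = is"
    using ab len by (intro nth_equalityI) (auto simp: permute_list_def Transposition.transpose_def)
  then have "\<omega> c x is = - \<omega> c x is"
    using forms_alternating[OF \<omega> "is"(1) \<tau>, of c x] ab by (simp add: sign_swap_id)
  then show ?thesis by simp
qed

lemma permutes_extend_list:
  assumes "distinct is" "set is \<subseteq> {..<n}"
  obtains \<pi> where "\<pi> permutes {..<n}" "\<And>a. a < length is \<Longrightarrow> \<pi> a = is ! a"
proof -
  define L where "L = is @ sorted_list_of_set ({..<n} - set is)"
  have L: "distinct L" "set L = {..<n}" using assms by (auto simp: L_def)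
  have len: "length L = n"
    unfolding distinct_card[OF L(1), symmetric] L(2) by (rule card_lessThan)
  have "bij_betw ((!) L) {..<n} {..<n}"
    by (rule bij_betw_nth[OF L(1)]) (simp_all only: len L(2))
  moreover have "bij_betw (\<lambda>i. if i < n then L ! i else i) {..<n} {..<n} = bij_betw ((!) L) {..<n} {..<n}"
    by (rule bij_betw_cong) simp
  ultimately have "bij_betw (\<lambda>i. if i < n then L ! i else i) {..<n} {..<n}" by simp
  then have "(\<lambda>i. if i < n then L ! i else i) permutes {..<n}" by (rule bij_imp_permutes) auto
  moreover have "length is \<le> n" using len by (simp add: L_def)
  ultimately show ?thesis using that[of "\<lambda>i. if i < n then L ! i else i"] by (simp add: L_def nth_append)
qed

lemma levi_civita_permutes:
  assumes "\<rho> permutes {..<n}"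
  shows "levi_civita n (map \<rho> [0..<n]) = of_int (sign \<rho>)"
proof -
  have "distinct (map \<rho> [0..<n])"
    using permutes_inj_on[OF assms] by (simp add: distinct_map)
  moreover have "set (map \<rho> [0..<n]) \<subseteq> {..<n}" using permutes_image[OF assms] by auto
  moreover have "(\<lambda>i. if i < n then map \<rho> [0..<n] ! i else i) = \<rho>"
    using permutes_not_in[OF assms] by auto
  ultimately show ?thesis by (simp add: levi_civita_def)
qed

text \<open>The permutations of \<open>{..<n}\<close> preserving \<open>{..<p}\<close> give equal nonzero terms in
  \<open>\<alpha> \<and> *\<beta>\<close>, the others contribute nothing. Only the positivity of their number matters.\<close>

definition shuffle_count :: "nat \<Rightarrow> nat \<Rightarrow> real" where
  "shuffle_count n p = real (card {\<sigma>. \<sigma> permutes {..<n} \<and> \<sigma> ` {..<p} \<subseteq> {..<p}})"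

lemma shuffle_count_pos: "shuffle_count n p > 0"
proof -
  have "finite {\<sigma>. \<sigma> permutes {..<n} \<and> \<sigma> ` {..<p} \<subseteq> {..<p}}"
    by (rule finite_subset[OF _ finite_permutations[of "{..<n}"]]) auto
  moreover have "id \<in> {\<sigma>. \<sigma> permutes {..<n} \<and> \<sigma> ` {..<p} \<subseteq> {..<p}}" by (simp add: permutes_id)
  ultimately show ?thesis unfolding shuffle_count_def by (metis card_gt_0_iff empty_iff of_nat_0_less_iff)
qed

text \<open>A permutation that maps the first p indices into themselves does the same with the
  remaining ones. It factors into one acting on the first p indices and one fixing them, which
  separates their contributions to the sign.\<close>

lemma restrict_permutes:
  fixes \<sigma> :: "nat \<Rightarrow> nat"
  assumes \<sigma>: "\<sigma> permutes {..<n}" and "p \<le> n" and im: "\<sigma> ` {..<p} \<subseteq> {..<p}"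
  shows "(\<lambda>i. if i < p then \<sigma> i else i) permutes {..<p}"
    and "(\<lambda>i. if i < p then i else \<sigma> i) permutes {..<n}"
    and "\<sigma> = (\<lambda>i. if i < p then \<sigma> i else i) \<circ> (\<lambda>i. if i < p then i else \<sigma> i)"
proof -
  have inj: "inj_on \<sigma> {..<p}" using permutes_inj_on[OF \<sigma>] .
  have img: "\<sigma> ` {..<p} = {..<p}" by (rule endo_inj_surj[OF finite_lessThan im inj])
  show a: "(\<lambda>i. if i < p then \<sigma> i else i) permutes {..<p}"
  proof (rule bij_imp_permutes)
    show "bij_betw (\<lambda>i. if i < p then \<sigma> i else i) {..<p} {..<p}"
      using inj img by (subst bij_betw_cong[of _ _ \<sigma>]) (auto simp: bij_betw_def)
  qed auto
  have ge: "\<sigma> i \<ge> p" if "i \<ge> p" for i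
  proof (rule ccontr)
    assume "\<not> \<sigma> i \<ge> p"
    then have "\<sigma> i \<in> \<sigma> ` {..<p}" unfolding img by simp
    then obtain k where k: "k < p" "\<sigma> i = \<sigma> k" by blast
    then show False using injD[OF permutes_inj[OF \<sigma>] k(2)] that by simp
  qed
  let ?a = "\<lambda>i. if i < p then \<sigma> i else i" and ?b = "\<lambda>i. if i < p then i else \<sigma> i"
  have ab: "\<sigma> i = ?a (?b i)" for i
    using ge[of i] by (cases "i < p") simp_all
  show "\<sigma> = ?a \<circ> ?b" by (rule ext, unfold comp_apply, rule ab)
  have an: "?a permutes {..<n}" using permutes_subset[OF a] assms(2) by auto
  have "?b = inv_into UNIV ?a \<circ> \<sigma>"
  proof
    fix i
    have "?b i = inv_into UNIV ?a (?a (?b i))" by (rule permutes_inverses(2)[OF a, symmetric])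
    also have "\<dots> = inv_into UNIV ?a (\<sigma> i)" by (rule arg_cong[OF ab[of i, symmetric]])
    finally show "?b i = (inv_into UNIV ?a \<circ> \<sigma>) i" by (simp only: comp_apply)
  qed
  then show "(\<lambda>i. if i < p then i else \<sigma> i) permutes {..<n}"
    using permutes_compose[OF \<sigma> permutes_inv[OF an]] by simp
qed

text \<open>The Levi-Civita symbol lets only those permutations survive that send the first p
  positions onto the entries of \<open>is\<close>; on these, alternation of \<omega> makes all terms
  equal.\<close>

lemma sum_permutations_levi_civita:
  assumes \<omega>: "\<omega> \<in> forms M p" and n: "n = dimen M" and "p \<le> n" and "is": "is \<in> multi_indices n p"
  shows "(\<Sum>\<sigma> | \<sigma> permutes {..<n}. of_int (sign \<sigma>) * \<omega> c x (take p (map \<sigma> [0..<n])) *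
     levi_civita n (is @ drop p (map \<sigma> [0..<n]))) = shuffle_count n p * \<omega> c x is" (is "sum ?F ?S = _")
proof (cases "distinct is")
  case False
  then show ?thesis using forms_not_distinct[OF \<omega>] "is" n by (simp add: levi_civita_def)
next
  case True
  have len: "length is = p" and set: "set is \<subseteq> {..<n}" using "is" by (auto simp: multi_indices_def)
  obtain \<pi> where \<pi>: "\<pi> permutes {..<n}" "\<And>a. a < p \<Longrightarrow> \<pi> a = is ! a"
    using permutes_extend_list[OF True set] len by auto
  have is_map: "is = map \<pi> [0..<p]" using \<pi>(2) len by (intro nth_equalityI) auto
  have perm: "permutation \<sigma>" if "\<sigma> permutes {..<k}" for \<sigma> :: "nat \<Rightarrow> nat" and k
    using that permutation_permutes by blast
  have ss: "of_int (sign \<sigma>) * of_int (sign \<sigma>) = (1 :: real)" for \<sigma> :: "nat \<Rightarrow> nat"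
    by (simp add: sign_def)
  \<comment> \<open>After composition with \<pi>, which begins with \<open>is\<close>, the surviving
    permutations are those that preserve the first p positions.\<close>
  have "sum ?F ?S = (\<Sum>\<sigma>\<in>?S. ?F (\<pi> \<circ> \<sigma>))" by (rule setum_permutations_compose_left[OF \<pi>(1)])
  also have "\<dots> = (\<Sum>\<sigma>\<in>?S. if \<sigma> ` {..<p} \<subseteq> {..<p} then \<omega> c x is else 0)"
  proof (rule sum.cong[OF refl])
    fix \<sigma> assume "\<sigma> \<in> ?S"
    then have \<sigma>: "\<sigma> permutes {..<n}" by simp
    show "?F (\<pi> \<circ> \<sigma>) = (if \<sigma> ` {..<p} \<subseteq> {..<p} then \<omega> c x is else 0)"
    proof (cases "\<sigma> ` {..<p} \<subseteq> {..<p}")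
      case True
      let ?a = "\<lambda>i. if i < p then \<sigma> i else i" and ?b = "\<lambda>i. if i < p then i else \<sigma> i"
      have r: "?a permutes {..<p}" "?b permutes {..<n}" "\<sigma> = ?a \<circ> ?b"
        by (rule restrict_permutes[OF \<sigma> \<open>p \<le> n\<close> True])+
      have "take p (map (\<pi> \<circ> \<sigma>) [0..<n]) = permute_list ?a is"
        using True \<open>p \<le> n\<close> len \<pi>(2) by (intro nth_equalityI) (auto simp: permute_list_def)
      then have 1: "\<omega> c x (take p (map (\<pi> \<circ> \<sigma>) [0..<n])) = of_int (sign ?a) * \<omega> c x is"
        using forms_alternating[OF \<omega> _ r(1)] "is" n by simp
      have "is @ drop p (map (\<pi> \<circ> \<sigma>) [0..<n]) = map (\<pi> \<circ> ?b) [0..<n]"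
        using \<open>p \<le> n\<close> len \<pi>(2) by (intro nth_equalityI) (auto simp: nth_append)
      then have 2: "levi_civita n (is @ drop p (map (\<pi> \<circ> \<sigma>) [0..<n])) = of_int (sign \<pi> * sign ?b)"
        using levi_civita_permutes[OF permutes_compose[OF r(2) \<pi>(1)]] \<pi>(1) r(2) perm
        by (simp add: sign_compose)
      have "sign (?a \<circ> ?b) = sign ?a * sign ?b"
        using perm[OF r(1)] perm[OF r(2)] by (rule sign_compose)
      then have "sign \<sigma> = sign ?a * sign ?b" unfolding r(3)[symmetric] .
      then have 3: "sign (\<pi> \<circ> \<sigma>) = sign \<pi> * (sign ?a * sign ?b)"
        using sign_compose[OF perm[OF \<pi>(1)] perm[OF \<sigma>]] by simp
      \<comment> \<open>Each of the three signs occurs twice: in the sign of the permutation, and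
        again in \<omega> or in the Levi-Civita symbol.\<close>
      have "?F (\<pi> \<circ> \<sigma>) = (of_int (sign \<pi>) * of_int (sign \<pi>)) * (of_int (sign ?a) * of_int (sign ?a)) *
          (of_int (sign ?b) * of_int (sign ?b)) * \<omega> c x is"
        unfolding 1 2 3 by simp
      then show ?thesis using True unfolding ss by simp
    next
      case False
      then obtain k where k: "k < p" "\<sigma> k \<ge> p"
        by (metis image_subsetI lessThan_iff not_le)
      \<comment> \<open>If the later positions stayed among themselves they would fill all later
        positions, leaving none for \<open>\<sigma> k\<close>.\<close>
      have "\<not> (\<forall>i\<ge>p. i < n \<longrightarrow> \<sigma> i \<ge> p)"
      proof
        assume ge: "\<forall>i\<ge>p. i < n \<longrightarrow> \<sigma> i \<ge> p"
        have "\<sigma> ` ({..<n} - {..<p}) \<subseteq> {..<n} - {..<p}"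
          using ge permutes_in_image[OF \<sigma>] by (auto simp: not_less)
        then have "\<sigma> ` ({..<n} - {..<p}) = {..<n} - {..<p}"
          using endo_inj_surj[of "{..<n} - {..<p}" \<sigma>] permutes_inj_on[OF \<sigma>] by blast
        moreover have "\<sigma> k \<in> {..<n} - {..<p}"
          using k \<open>p \<le> n\<close> permutes_in_image[OF \<sigma>, of k] by simp
        ultimately have "\<sigma> k \<in> \<sigma> ` ({..<n} - {..<p})" by simp
        then obtain i where i: "i \<in> {..<n} - {..<p}" "\<sigma> k = \<sigma> i" by blast
        then show False using injD[OF permutes_inj[OF \<sigma>] i(2)] k by simp
      qed
      then obtain i where i: "p \<le> i" "i < n" "\<sigma> i < p" by (auto simp: not_le)
      then have "\<pi> (\<sigma> i) \<in> set is" using \<pi>(2) len by simp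
      moreover have "\<pi> (\<sigma> i) \<in> set (drop p (map (\<pi> \<circ> \<sigma>) [0..<n]))"
        using i by (simp add: drop_map)
      ultimately have "\<not> distinct (is @ drop p (map (\<pi> \<circ> \<sigma>) [0..<n]))" by auto
      then have "levi_civita n (is @ drop p (map (\<pi> \<circ> \<sigma>) [0..<n])) = 0"
        unfolding levi_civita_def by (simp del: distinct_append)
      then show ?thesis using False by simp
    qed
  qed
  also have "\<dots> = (\<Sum>\<sigma> | \<sigma> permutes {..<n} \<and> \<sigma> ` {..<p} \<subseteq> {..<p}. \<omega> c x is)"
    by (subst sum.inter_filter[symmetric]) (auto simp: finite_permutations)
  also have "\<dots> = shuffle_count n p * \<omega> c x is" by (simp add: shuffle_count_def)
  finally show ?thesis .
qed

text \<open>\<open>fact p * fact (n - p)\<close> comes from \<open>wedge\<close>, the other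
  \<open>fact p\<close> from \<open>hodge_star\<close>. Since \<open>shuffle_count n p\<close>
  equals p! (n - p)! for p \<le> n, the value is 1 / p!, which reduces the sum over all
  multi-indices in \<open>tensor_form\<close> to the usual inner product of p-forms.\<close>

definition wedge_const :: "nat \<Rightarrow> nat \<Rightarrow> real" where
  "wedge_const n p = shuffle_count n p / (fact p * fact p * fact (n - p))"

lemma wedge_const_pos: "wedge_const n p > 0"
  using shuffle_count_pos by (simp add: wedge_const_def)

text \<open>The orientation sign enters twice, from the integral and from the volume form inside the
  star, and its square is 1.\<close>

lemma wedge_hodge_star:
  assumes \<alpha>: "\<alpha> \<in> forms M p" and "p \<le> dimen M" and "orient M c x \<in> {-1, 1}"
  shows "orient M c x * wedge p (dimen M - p) \<alpha> (hodge_star M p \<beta>) c x [0..<dimen M] =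
    wedge_const (dimen M) p * sqrt (Determinant.det (gram M c x)) *
      tensor_form (dimen M) p (inverse_metric M c x) (\<alpha> c x) (\<beta> c x)"
proof -
  define n where "n = dimen M"
  define D where "D = sqrt (Determinant.det (gram M c x)) / (fact p :: real)"
  define b where "b is = (\<Sum>ks\<in>multi_indices n p. (\<Prod>a<p. inverse_metric M c x (is ! a) (ks ! a)) * \<beta> c x ks)" for "is"
  let ?o = "orient M c x" and ?S = "{\<sigma>. \<sigma> permutes {..<n}}"
  let ?L = "\<lambda>\<sigma>. map \<sigma> [0..<n]"
  have pn: "p + (n - p) = n" using assms(2) n_def by simp
  have pl: "permute_list \<sigma> [0..<n] = ?L \<sigma>" if "\<sigma> \<in> ?S" for \<sigma>
    using that permutes_in_image[of \<sigma> "{..<n}"] by (intro nth_equalityI) (auto simp: permute_list_def)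
  have star: "hodge_star M p \<beta> c x js = ?o * D * (\<Sum>is\<in>multi_indices n p. b is * levi_civita n (is @ js))" for js
    by (simp add: hodge_star_def D_def b_def n_def sum_distrib_right)
  have "?o * wedge p (n - p) \<alpha> (hodge_star M p \<beta>) c x [0..<n] =
      ?o * (\<Sum>\<sigma>\<in>?S. of_int (sign \<sigma>) * \<alpha> c x (take p (?L \<sigma>)) * hodge_star M p \<beta> c x (drop p (?L \<sigma>)))
        / (fact p * fact (n - p))"
    by (simp add: wedge_def pn pl)
  also have "\<dots> = ?o * (\<Sum>\<sigma>\<in>?S. \<Sum>is\<in>multi_indices n p. ?o * D * b is * (of_int (sign \<sigma>) * \<alpha> c x (take p (?L \<sigma>)) *
       levi_civita n (is @ drop p (?L \<sigma>)))) / (fact p * fact (n - p))"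
    by (simp add: star sum_distrib_left mult_ac)
  also have "\<dots> = ?o * (\<Sum>is\<in>multi_indices n p. ?o * D * b is * (\<Sum>\<sigma>\<in>?S. of_int (sign \<sigma>) * \<alpha> c x (take p (?L \<sigma>)) *
       levi_civita n (is @ drop p (?L \<sigma>)))) / (fact p * fact (n - p))"
    by (subst sum.swap) (simp only: sum_distrib_left)
  also have "\<dots> = ?o * (\<Sum>is\<in>multi_indices n p. ?o * D * b is * (shuffle_count n p * \<alpha> c x is))
       / (fact p * fact (n - p))"
    using sum_permutations_levi_civita[OF \<alpha> n_def] assms(2) by (simp add: n_def)
  also have "\<dots> = (?o * ?o) * (D * shuffle_count n p / (fact p * fact (n - p))) * (\<Sum>is\<in>multi_indices n p. \<alpha> c x is * b is)"
    by (simp add: sum_distrib_left sum_divide_distrib mult_ac)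
  also have "?o * ?o = 1" using assms(3) by auto
  also have "(\<Sum>is\<in>multi_indices n p. \<alpha> c x is * b is) = tensor_form n p (inverse_metric M c x) (\<alpha> c x) (\<beta> c x)"
    by (simp add: tensor_form_def b_def sum_distrib_left mult_ac)
  finally show ?thesis by (simp add: n_def D_def wedge_const_def field_simps)
qed

section \<open>Positivity and continuity of the metric data\<close>

lemma riemannian_metric_pos_def:
  assumes "riemannian_metric M" "c \<in> atlas M" "x \<in> fst c"
  shows "pos_def (dimen M) (metric M c x)"
proof -
  have "\<forall>c\<in>atlas M. \<forall>x\<in>fst c. pos_def (dimen M) (metric M c x)"
    using assms(1) unfolding riemannian_metric_def pos_def_def Let_def by (elim conjE)
  then show ?thesis using assms(2,3) by blast
qed

lemma inverse_metric_pos_def: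
  assumes "pos_def (dimen M) (metric M c x)"
  shows "Determinant.det (gram M c x) > 0"
    "pos_def (dimen M) (inverse_metric M c x)"
    "\<And>i j. i < dimen M \<Longrightarrow> j < dimen M \<Longrightarrow>
       inverse_metric M c x i j = cofactor (gram M c x) j i / Determinant.det (gram M c x)"
proof -
  show d: "Determinant.det (gram M c x) > 0"
    using pos_def_det[OF assms] by (simp add: gram_def)
  have G: "gram M c x \<in> carrier_mat (dimen M) (dimen M)" by (simp add: gram_def)
  obtain C where C: "mat_inverse (gram M c x) = Some C" "C \<in> carrier_mat (dimen M) (dimen M)"
    "gram M c x * C = 1\<^sub>m (dimen M)" "C * gram M c x = 1\<^sub>m (dimen M)"
    "\<And>i j. i < dimen M \<Longrightarrow> j < dimen M \<Longrightarrow> C $$ (i, j) = cofactor (gram M c x) j i / Determinant.det (gram M c x)"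
    using mat_inverse_cofactor[OF G] d by (metis less_irrefl)
  have inv: "inverse_metric M c x = (\<lambda>i j. C $$ (i, j))" by (simp add: inverse_metric_def C(1) fun_eq_iff)
  show "pos_def (dimen M) (inverse_metric M c x)"
    unfolding inv using pos_def_inverse[OF assms C(2)] C(3,4) by (simp add: gram_def)
  show "inverse_metric M c x i j = cofactor (gram M c x) j i / Determinant.det (gram M c x)"
    if "i < dimen M" "j < dimen M" for i j unfolding inv using C(5)[OF that] .
qed

lemma continuous_map_det:
  assumes "\<And>i j. i < n \<Longrightarrow> j < n \<Longrightarrow> continuous_map X euclideanreal (\<lambda>x. f x i j)"
  shows "continuous_map X euclideanreal (\<lambda>x. Determinant.det (Matrix.mat n n (\<lambda>(i, j). f x i j)))"
proof -
  have less: "\<sigma> i < n" if "\<sigma> permutes {0..<n}" "i < n" for \<sigma> i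
    using permutes_in_image[OF that(1), of i] that(2) by simp
  have "Determinant.det (Matrix.mat n n (\<lambda>(i, j). f x i j)) =
      (\<Sum>\<sigma> | \<sigma> permutes {0..<n}. of_int (sign \<sigma>) * (\<Prod>i = 0..<n. f x i (\<sigma> i)))" for x
    by (simp add: Determinant.det_def less)
  moreover have "continuous_map X euclideanreal
      (\<lambda>x. \<Sum>\<sigma> | \<sigma> permutes {0..<n}. of_int (sign \<sigma>) * (\<Prod>i = 0..<n. f x i (\<sigma> i)))"
    by (intro continuous_map_sum continuous_map_real_mult continuous_map_prod assms)
      (auto simp: finite_permutations less)
  ultimately show ?thesis by simp
qed

lemma continuous_map_cofactor:
  assumes "\<And>i j. i < n \<Longrightarrow> j < n \<Longrightarrow> continuous_map X euclideanreal (\<lambda>x. f x i j)"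
    and "k < n" "l < n"
  shows "continuous_map X euclideanreal (\<lambda>x. cofactor (Matrix.mat n n (\<lambda>(i, j). f x i j)) k l)"
proof -
  have "mat_delete (Matrix.mat n n (\<lambda>(i, j). f x i j)) k l =
      Matrix.mat (n - 1) (n - 1) (\<lambda>(i, j). f x (if i < k then i else Suc i) (if j < l then j else Suc j))" for x
    using assms(2,3) by (intro eq_matI) (auto simp: mat_delete_def)
  moreover have "continuous_map X euclideanreal (\<lambda>x. Determinant.det
      (Matrix.mat (n - 1) (n - 1) (\<lambda>(i, j). f x (if i < k then i else Suc i) (if j < l then j else Suc j))))"
    by (intro continuous_map_det assms(1)) auto
  ultimately show ?thesis unfolding cofactor_def
    by (simp add: continuous_map_real_mult)
qed

section \<open>Integration of forms\<close>

text \<open>Complete regularity makes a function vanish off a given open set, but the closure of its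
  support could still leave that set. So the function is built for a smaller open U, with a closed K
  between U and W.\<close>

lemma ex_bump_function:
  assumes X: "compact_space X" "Hausdorff_space X" and W: "openin X W" "x \<in> W"
  obtains \<phi> :: "'a \<Rightarrow> real" where "continuous_map X euclideanreal \<phi>"
    "\<And>z. z \<in> topspace X \<Longrightarrow> 0 \<le> \<phi> z" "\<phi> x = 1" "X closure_of {z \<in> topspace X. \<phi> z \<noteq> 0} \<subseteq> W"
proof -
  have "regular_space X" using X by (rule compact_Hausdorff_imp_regular_space)
  then have "neighbourhood_base_of (closedin X) X" by (simp add: neighbourhood_base_of_closedin)
  from this[unfolded neighbourhood_base_of, rule_format, OF conjI[OF W]]
  obtain U K where U: "openin X U" "closedin X K" "x \<in> U" "U \<subseteq> K" "K \<subseteq> W"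
    by (elim exE conjE)
  have "completely_regular_space X"
    using X by (intro normal_imp_completely_regular_space compact_Hausdorff_or_regular_imp_normal_space) auto
  moreover have "closedin X (topspace X - U)" "x \<in> topspace X - (topspace X - U)"
    using U(1,3) openin_subset[OF U(1)] by auto
  ultimately obtain f :: "'a \<Rightarrow> real" where f: "continuous_map X (top_of_set {0..1}) f" "f x = 0" "f ` (topspace X - U) \<subseteq> {1}"
    unfolding completely_regular_space_def by metis
  have fc: "continuous_map X euclideanreal f" and f01: "\<And>z. z \<in> topspace X \<Longrightarrow> f z \<in> {0..1}"
    using f(1) by (auto simp: continuous_map_in_subtopology)
  show ?thesis
  proof (rule that[of "\<lambda>z. 1 - f z"])
    show "continuous_map X euclideanreal (\<lambda>z. 1 - f z)"
      by (intro continuous_map_diff fc) simp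
    show "0 \<le> 1 - f z" if "z \<in> topspace X" for z using f01[OF that] by simp
    have "{z \<in> topspace X. 1 - f z \<noteq> 0} \<subseteq> K" using f(3) U(4) by fastforce
    then show "X closure_of {z \<in> topspace X. 1 - f z \<noteq> 0} \<subseteq> W"
      using closure_of_minimal[OF _ U(2)] U(5) by blast
  qed (use f(2) in simp)
qed

text \<open>Bumps around all points, finitely many by compactness, divided by their sum. Existence
  turns the \<open>SOME\<close> in \<open>integral_form\<close> into an actual partition of
  unity.\<close>

lemma ex_partition_of_unity:
  assumes M: "smooth_manifold M" and cpt: "compact_space (mtop M)"
  shows "\<exists>P. partition_of_unity M P"
proof -
  let ?X = "mtop M"
  have H: "Hausdorff_space ?X" using M by (simp add: smooth_manifold_def)
  define bump where "bump x c \<phi> \<longleftrightarrow> c \<in> atlas M \<and> continuous_map ?X euclideanreal \<phi> \<and>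
      (\<forall>z\<in>topspace ?X. 0 \<le> \<phi> z) \<and> \<phi> x = (1 :: real) \<and>
      ?X closure_of {z \<in> topspace ?X. \<phi> z \<noteq> 0} \<subseteq> fst c" for x c \<phi>
  have "\<exists>c \<phi>. bump x c \<phi>" if "x \<in> topspace ?X" for x
  proof -
    obtain c where c: "c \<in> atlas M" "x \<in> fst c" using smooth_manifold_charts(2)[OF M] \<open>x \<in> topspace ?X\<close> by blast
    obtain \<phi> :: "'a \<Rightarrow> real" where \<phi>: "continuous_map ?X euclideanreal \<phi>" "\<And>z. z \<in> topspace ?X \<Longrightarrow> 0 \<le> \<phi> z" "\<phi> x = 1"
        "?X closure_of {z \<in> topspace ?X. \<phi> z \<noteq> 0} \<subseteq> fst c"
      using ex_bump_function[OF cpt H chart_facts(1)[OF smooth_manifold_charts(1)[OF M c(1)]] c(2)] by blast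
    show ?thesis unfolding bump_def
      by (intro exI[of _ c] exI[of _ \<phi>] conjI ballI c(1) \<phi>)
  qed
  then obtain C \<phi> where "\<And>x. x \<in> topspace ?X \<Longrightarrow> bump x (C x) (\<phi> x)" by metis
  then have C: "\<And>x. x \<in> topspace ?X \<Longrightarrow> C x \<in> atlas M"
    and cont: "\<And>x. x \<in> topspace ?X \<Longrightarrow> continuous_map ?X euclideanreal (\<phi> x)"
    and nonneg: "\<And>x z. x \<in> topspace ?X \<Longrightarrow> z \<in> topspace ?X \<Longrightarrow> 0 \<le> \<phi> x z"
    and one: "\<And>x. x \<in> topspace ?X \<Longrightarrow> \<phi> x x = (1 :: real)"
    and supp: "\<And>x. x \<in> topspace ?X \<Longrightarrow> ?X closure_of {z \<in> topspace ?X. \<phi> x z \<noteq> 0} \<subseteq> fst (C x)"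
    unfolding bump_def by blast+
  define U where "U x = {z \<in> topspace ?X. \<phi> x z \<in> {0<..}}" for x
  have "openin ?X (U x)" if "x \<in> topspace ?X" for x
    unfolding U_def by (rule openin_continuous_map_preimage[OF cont[OF that]]) simp
  moreover have "x \<in> U x" if "x \<in> topspace ?X" for x using one[OF that] that by (simp add: U_def)
  ultimately obtain \<F> where \<F>: "finite \<F>" "\<F> \<subseteq> U ` topspace ?X" "topspace ?X \<subseteq> \<Union>\<F>"
    using compactinD[of ?X "topspace ?X" "U ` topspace ?X"] cpt unfolding compact_space_def by blast
  obtain F where F: "finite F" "F \<subseteq> topspace ?X" "\<F> = U ` F"
    using finite_subset_image[OF \<F>(1,2)] by blast
  \<comment> \<open>Partitions are lists; an enumeration without repetition turns the list sum into
    the sum over F.\<close>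
  obtain xs where xs: "set xs = F" "distinct xs" using finite_distinct_list[OF F(1)] by blast
  define s where "s z = (\<Sum>w\<in>F. \<phi> w z)" for z
  have s_pos: "s z > 0" if z: "z \<in> topspace ?X" for z
  proof -
    obtain w where w: "w \<in> F" "z \<in> U w" using \<F>(3) F(3) z by blast
    show ?thesis unfolding s_def
      by (rule sum_pos2[OF F(1) w(1)]) (use w(2) nonneg F(2) z in \<open>auto simp: U_def\<close>)
  qed
  have s_cont: "continuous_map ?X euclideanreal s"
    unfolding s_def using F cont by (intro continuous_map_sum) auto
  have "partition_of_unity M (map (\<lambda>w. (C w, \<lambda>z. \<phi> w z / s z)) xs)"
    unfolding partition_of_unity_def
  proof (intro conjI ballI, safe)
    fix c \<rho> assume "(c, \<rho>) \<in> set (map (\<lambda>w. (C w, \<lambda>z. \<phi> w z / s z)) xs)"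
    then obtain w where w: "w \<in> topspace ?X" "c = C w" "\<rho> = (\<lambda>z. \<phi> w z / s z)" using xs F(2) by auto
    show "c \<in> atlas M" using C w by simp
    show "continuous_map ?X euclideanreal \<rho>" unfolding w(3)
      using s_pos by (intro continuous_map_real_divide cont w s_cont) force
    show "0 \<le> \<rho> z" if "z \<in> topspace ?X" for z
      unfolding w(3) using nonneg[OF w(1) that] s_pos[OF that] by simp
    have "{z \<in> topspace ?X. \<rho> z \<noteq> 0} \<subseteq> {z \<in> topspace ?X. \<phi> w z \<noteq> 0}" by (auto simp: w(3))
    then show "z \<in> fst c" if "z \<in> ?X closure_of {x \<in> topspace ?X. \<rho> x \<noteq> 0}" for z
      using closure_of_mono supp[OF w(1)] that w(2) by blast
  next
    fix z assume z: "z \<in> topspace ?X"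
    have "(\<Sum>(c, \<rho>)\<leftarrow>map (\<lambda>w. (C w, \<lambda>z. \<phi> w z / s z)) xs. \<rho> z) = (\<Sum>w\<in>F. \<phi> w z / s z)"
      using sum_list_distinct_conv_sum_set[OF xs(2), of "\<lambda>w. \<phi> w z / s z"] xs(1)
      by (simp add: comp_def)
    also have "\<dots> = 1" using s_pos[OF z] by (simp add: s_def flip: sum_divide_distrib)
    finally show "(\<Sum>(c, \<rho>)\<leftarrow>map (\<lambda>w. (C w, \<lambda>z. \<phi> w z / s z)) xs. \<rho> z) = 1" .
  qed
  then show ?thesis by blast
qed

section \<open>Continuity and Lebesgue integrals in a chart\<close>

lemma continuous_map_in_chart:
  assumes "is_chart n X c"
  shows "continuous_map (subtopology (Euclidean_space n) (chart_image c)) Y (in_chart c f) \<longleftrightarrow>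
    continuous_map (subtopology X (fst c)) Y f"
proof -
  let ?X = "subtopology X (fst c)" and ?E = "subtopology (Euclidean_space n) (chart_image c)"
  note cf = chart_facts[OF assms]
  have tX: "topspace ?X = fst c" and tE: "topspace ?E = chart_image c"
    using openin_subset[OF cf(1)] openin_subset[OF cf(2)] by auto
  obtain g where g: "continuous_map ?X ?E (snd c)" "continuous_map ?E ?X g" "\<And>x. x \<in> fst c \<Longrightarrow> g (snd c x) = x"
    using cf(4) tX by (auto simp: homeomorphic_map_maps homeomorphic_maps_def)
  have eq1: "f (g y) = in_chart c f y" if "y \<in> chart_image c" for y
    using that g(3) cf(3) by (auto simp: chart_image_def)
  have eq2: "in_chart c f (snd c x) = f x" if "x \<in> fst c" for x using cf(3) that by simp
  show ?thesis
  proof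
    assume "continuous_map ?E Y (in_chart c f)"
    from continuous_map_compose[OF g(1) this] show "continuous_map ?X Y f"
      by (rule continuous_map_eq) (use eq2 tX in \<open>simp add: comp_def\<close>)
  next
    assume "continuous_map ?X Y f"
    from continuous_map_compose[OF g(2) this] show "continuous_map ?E Y (in_chart c f)"
      by (rule continuous_map_eq) (use eq1 tE in \<open>simp add: comp_def\<close>)
  qed
qed

text \<open>The Borel sets of \<open>nat \<Rightarrow> real\<close> are those of the countable
  product, so the extension by 0 can be checked coordinate by coordinate.\<close>

lemma measurable_zero_extend [measurable]: "zero_extend n \<in> Pi\<^sub>M {..<n} (\<lambda>_. lborel) \<rightarrow>\<^sub>M borel"
proof -
  have "(\<lambda>y i. if i < n then y i else 0) \<in> Pi\<^sub>M {..<n} (\<lambda>_. lborel) \<rightarrow>\<^sub>M Pi\<^sub>M UNIV (\<lambda>_. borel :: real measure)"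
  proof (rule measurable_PiM_single')
    fix i :: nat
    show "(\<lambda>y. if i < n then y i else 0) \<in> Pi\<^sub>M {..<n} (\<lambda>_. lborel) \<rightarrow>\<^sub>M (borel :: real measure)"
    proof (cases "i < n")
      case True
      then have "(\<lambda>y. y i) \<in> Pi\<^sub>M {..<n} (\<lambda>_. lborel) \<rightarrow>\<^sub>M (lborel :: real measure)"
        by (intro measurable_component_singleton) simp
      then show ?thesis using True by simp
    qed simp
  qed auto
  moreover have "zero_extend n = (\<lambda>y i. if i < n then y i else 0)" by (auto simp: zero_extend_def fun_eq_iff)
  ultimately show ?thesis
    by (simp add: measurable_cong_sets[OF refl sets_PiM_equal_borel])
qed

lemma zero_extend_in_topspace: "zero_extend n y \<in> topspace (Euclidean_space n)"
  by (simp add: zero_extend_def topspace_Euclidean_space)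

lemma emeasure_box:
  "emeasure (Pi\<^sub>M {..<n} (\<lambda>_. lborel)) (Pi\<^sub>E {..<n} A) = (\<Prod>i<n. emeasure lborel (A i))"
  if "\<And>i. i < n \<Longrightarrow> A i \<in> sets lborel" for A :: "nat \<Rightarrow> real set"
proof -
  interpret product_sigma_finite "\<lambda>_ :: nat. lborel :: real measure" by standard
  show ?thesis by (rule emeasure_PiM) (use that in auto)
qed

lemma borel_measurable_Rn:
  assumes "openin (Euclidean_space n) V" "continuous_map (subtopology (Euclidean_space n) V) euclideanreal f"
  shows "(\<lambda>y. indicator V (zero_extend n y) * f (zero_extend n y)) \<in> borel_measurable (Pi\<^sub>M {..<n} (\<lambda>_. lborel))"
proof -
  have E: "Euclidean_space n = top_of_set {x. \<forall>i\<ge>n. x i = 0}"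
    by (simp add: Euclidean_space_def euclidean_product_topology)
  have cl: "closed {x :: nat \<Rightarrow> real. \<forall>i\<ge>n. x i = 0}"
    using closedin_Euclidean_space[of n] by (simp add: topspace_Euclidean_space euclidean_product_topology)
  obtain T where T: "open T" "V = {x. \<forall>i\<ge>n. x i = 0} \<inter> T"
    using assms(1) unfolding E openin_open by blast
  \<comment> \<open>V is open relative to the closed subspace of sequences vanishing from n on,
    hence Borel among all sequences.\<close>
  have V: "V \<in> sets borel" unfolding T(2) by (intro sets.Int borel_closed borel_open cl T(1))
  have "{x. \<forall>i\<ge>n. x i = 0} \<inter> V = V" using T(2) by blast
  then have "subtopology (Euclidean_space n) V = top_of_set V"
    by (simp only: E subtopology_subtopology)
  then have "continuous_on V f" using assms(2) by simp
  from borel_measurable_continuous_on_indicator[OF V this]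
  have [measurable]: "(\<lambda>y. indicator V y * f y) \<in> borel_measurable borel" by simp
  show ?thesis by measurable
qed

context
  fixes n :: nat and X :: "'a topology" and c :: "'a chart" and \<rho> f :: "'a \<Rightarrow> real"
  assumes c: "is_chart n X c" and f: "continuous_map (subtopology X (fst c)) euclideanreal f"
    and \<rho>: "continuous_map X euclideanreal \<rho>"
begin

private lemma cont_product:
  "continuous_map (subtopology (Euclidean_space n) (chart_image c)) euclideanreal (in_chart c (\<lambda>x. \<rho> x * f x))"
  unfolding continuous_map_in_chart[OF c]
  by (intro continuous_map_real_mult f continuous_map_from_subtopology \<rho>)

text \<open>f is continuous on the chart domain and may be unbounded near its edge. The support of
  \<rho> is compact inside the domain, so the product is bounded and vanishes off a box of finite
  measure.\<close>

lemma integrable_chart: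
  assumes cpt: "compact_space X" and supp: "X closure_of {x \<in> topspace X. \<rho> x \<noteq> 0} \<subseteq> fst c"
  shows "integrable (Pi\<^sub>M {..<n} (\<lambda>_. lborel)) (\<lambda>y. indicator (chart_image c) (zero_extend n y) *
     in_chart c (\<lambda>x. \<rho> x * f x) (zero_extend n y))"
proof -
  let ?K = "X closure_of {x \<in> topspace X. \<rho> x \<noteq> 0}" and ?u = "in_chart c (\<lambda>x. \<rho> x * f x)"
  let ?E = "subtopology (Euclidean_space n) (chart_image c)"
  note cf = chart_facts[OF c]
  have fX: "fst c \<subseteq> topspace X" using openin_subset[OF cf(1)] .
  have "compactin X ?K" using cpt by (rule closedin_compact_space) simp
  then have K: "compactin (subtopology X (fst c)) ?K" using supp by (simp add: compactin_subtopology)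
  have "compactin ?E (snd c ` ?K)"
    using image_compactin[OF K homeomorphic_imp_continuous_map[OF cf(4)]] .
  then have cK: "compactin ?E (snd c ` ?K)" "compactin (Euclidean_space n) (snd c ` ?K)"
    by (auto simp: compactin_subtopology)
  have outside: "?u y = 0" if "y \<in> chart_image c" "y \<notin> snd c ` ?K" for y
  proof -
    obtain x where x: "x \<in> fst c" "y = snd c x" using \<open>y \<in> chart_image c\<close> by (auto simp: chart_image_def)
    have "x \<notin> ?K" using that(2) x(2) by blast
    then have "\<rho> x = 0" using closure_of_subset[of "{x \<in> topspace X. \<rho> x \<noteq> 0}" X] x(1) fX by blast
    then show ?thesis using x cf(3) by simp
  qed
  have "bounded (?u ` snd c ` ?K)"
    using image_compactin[OF cK(1) cont_product] by (simp add: compact_imp_bounded)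
  then obtain B where B: "\<And>y. y \<in> snd c ` ?K \<Longrightarrow> \<bar>?u y\<bar> \<le> B"
    unfolding bounded_real by blast
  have "\<exists>r. \<forall>y\<in>snd c ` ?K. \<bar>y i\<bar> \<le> r" for i
  proof -
    have "continuous_map (Euclidean_space n) euclideanreal (\<lambda>y. y i)"
      unfolding Euclidean_space_def by (intro continuous_map_from_subtopology continuous_map_product_projection) simp
    from image_compactin[OF cK(2) this] have "bounded ((\<lambda>y. y i) ` snd c ` ?K)"
      by (simp add: compact_imp_bounded)
    then show ?thesis unfolding bounded_real by blast
  qed
  then obtain r where r: "\<And>i y. y \<in> snd c ` ?K \<Longrightarrow> \<bar>y i\<bar> \<le> r i" by metis
  let ?A = "Pi\<^sub>E {..<n} (\<lambda>i. {- r i..r i})" and ?N = "Pi\<^sub>M {..<n} (\<lambda>_ :: nat. lborel :: real measure)"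
  let ?F = "\<lambda>y. indicator (chart_image c) (zero_extend n y) * ?u (zero_extend n y)"
  have bound: "norm (?F y) \<le> max B 0" for y
    using B[of "zero_extend n y"] outside[of "zero_extend n y"]
    by (cases "zero_extend n y \<in> chart_image c"; cases "zero_extend n y \<in> snd c ` ?K") auto
  have "?F y = 0" if "y \<in> space ?N" "y \<notin> ?A" for y
  proof -
    have "zero_extend n y \<notin> snd c ` ?K"
    proof
      assume "zero_extend n y \<in> snd c ` ?K"
      then have le: "\<bar>zero_extend n y i\<bar> \<le> r i" for i using r by blast
      have "y i \<in> {- r i..r i}" if "i < n" for i
        using le[of i] that by (simp add: zero_extend_def abs_le_iff)
      then show False using \<open>y \<notin> ?A\<close> \<open>y \<in> space ?N\<close> by (auto simp: space_PiM PiE_iff)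
    qed
    then show ?thesis using outside by (cases "zero_extend n y \<in> chart_image c") auto
  qed
  moreover have "emeasure ?N ?A < \<infinity>"
  proof -
    have "emeasure ?N ?A = (\<Prod>i<n. emeasure lborel {- r i..r i})" by (rule emeasure_box) simp
    also have "\<dots> < \<infinity>" by (simp add: emeasure_lborel_Icc_eq prod_ennreal)
    finally show ?thesis .
  qed
  moreover have "?A \<in> sets ?N" by (intro sets_PiM_I_finite) auto
  moreover have "?F \<in> borel_measurable ?N" by (rule borel_measurable_Rn[OF cf(2) cont_product])
  ultimately show ?thesis
    by (intro integrableI_bounded_set[where A = ?A and B = "max B 0"] AE_I2) (use bound in auto)
qed

text \<open>A positive value of a continuous function persists on a small open box, and such boxes
  have positive measure; in dimension 0 the box is a single point of measure 1, the empty
  product.\<close>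

lemma integral_chart_eq_0_imp:
  assumes int: "integrable (Pi\<^sub>M {..<n} (\<lambda>_. lborel)) (\<lambda>y. indicator (chart_image c) (zero_extend n y) *
     in_chart c (\<lambda>x. \<rho> x * f x) (zero_extend n y))"
    and nonneg: "\<And>x. x \<in> fst c \<Longrightarrow> 0 \<le> \<rho> x * f x"
    and zero: "integral_Rn n (chart_image c) (in_chart c (\<lambda>x. \<rho> x * f x)) = 0"
    and x: "x \<in> fst c"
  shows "\<rho> x * f x = 0"
proof (rule ccontr)
  assume "\<rho> x * f x \<noteq> 0"
  then have pos: "0 < \<rho> x * f x" using nonneg[OF x] by (metis less_eq_real_def)
  let ?u = "in_chart c (\<lambda>x. \<rho> x * f x)" and ?N = "Pi\<^sub>M {..<n} (\<lambda>_ :: nat. lborel :: real measure)"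
  let ?F = "\<lambda>y. indicator (chart_image c) (zero_extend n y) * ?u (zero_extend n y)"
  note cf = chart_facts[OF c]
  have ux: "?u (snd c x) = \<rho> x * f x" using cf(3) x by simp
  have xV: "snd c x \<in> chart_image c" using x by (simp add: chart_image_def)
  \<comment> \<open>The tolerance is the value at x itself, so the function stays positive on the
    box.\<close>
  obtain e where e: "e > 0" "\<And>z. z \<in> topspace (Euclidean_space n) \<Longrightarrow> (\<And>i. i < n \<Longrightarrow> \<bar>z i - snd c x i\<bar> < e) \<Longrightarrow>
      z \<in> chart_image c \<and> \<bar>?u z - ?u (snd c x)\<bar> < \<rho> x * f x"
    using continuous_map_Euclidean_space_box[OF cf(2) cont_product xV pos] by blast
  let ?A = "Pi\<^sub>E {..<n} (\<lambda>i. {snd c x i - e<..<snd c x i + e})"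
  have "0 \<le> ?F y" for y
    using nonneg cf(3) by (auto simp: indicator_def chart_image_def)
  then have "AE y in ?N. ?F y = 0"
    using zero int unfolding integral_Rn_def by (subst (asm) integral_nonneg_eq_0_iff_AE) auto
  then obtain Z where Z: "{y \<in> space ?N. \<not> ?F y = 0} \<subseteq> Z" "emeasure ?N Z = 0" "Z \<in> sets ?N"
    by (rule AE_E)
  have "?A \<subseteq> {y \<in> space ?N. \<not> ?F y = 0}"
  proof
    fix y assume y: "y \<in> ?A"
    have "\<bar>zero_extend n y i - snd c x i\<bar> < e" if "i < n" for i
      using PiE_mem[OF y, of i] that by (auto simp: zero_extend_def abs_less_iff)
    then have "zero_extend n y \<in> chart_image c" "?u (zero_extend n y) \<noteq> 0"
      using e(2)[OF zero_extend_in_topspace] ux by force+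
    moreover have "y \<in> space ?N" using y by (auto simp: space_PiM PiE_iff)
    ultimately show "y \<in> {y \<in> space ?N. \<not> ?F y = 0}" by simp
  qed
  then have "emeasure ?N ?A \<le> emeasure ?N Z" using Z by (intro emeasure_mono) auto
  moreover have "emeasure ?N ?A = (\<Prod>i<n. emeasure lborel {snd c x i - e<..<snd c x i + e})"
    by (rule emeasure_box) simp
  moreover have "(\<Prod>i<n. emeasure lborel {snd c x i - e<..<snd c x i + e}) \<noteq> 0"
    using e(1) by (simp add: prod_zero_iff)
  ultimately show False using Z(2) by simp
qed

end

section \<open>The inner product of forms as a sum of chart integrals\<close>

lemma integral_Rn_cong:
  assumes "\<And>y. y \<in> V \<Longrightarrow> f y = g y"
  shows "integral_Rn n V f = integral_Rn n V g"
  unfolding integral_Rn_def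
  by (intro Bochner_Integration.integral_cong refl) (simp add: indicator_def assms)

text \<open>By \<open>wedge_hodge_star\<close> this is the integrand of \<open>form_inner\<close> in
  the coordinates of c before multiplication by a partition function; the orientation sign is
  already absorbed.\<close>

definition form_density :: "'a riem_mfd \<Rightarrow> nat \<Rightarrow> 'a form \<Rightarrow> 'a form \<Rightarrow> 'a chart \<Rightarrow> 'a \<Rightarrow> real" where
  "form_density M p \<alpha> \<beta> c x = wedge_const (dimen M) p * sqrt (Determinant.det (gram M c x)) *
      tensor_form (dimen M) p (inverse_metric M c x) (\<alpha> c x) (\<beta> c x)"

definition chart_integral :: "'a riem_mfd \<Rightarrow> 'a chart \<Rightarrow> ('a \<Rightarrow> real) \<Rightarrow> real" where
  "chart_integral M c f = integral_Rn (dimen M) (chart_image c) (in_chart c f)"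

context
  fixes M :: "'a riem_mfd"
  assumes M: "compact_oriented_riemannian_manifold M"
begin

private lemma smooth: "smooth_manifold M" and cpt: "compact_space (mtop M)"
  and riem: "riemannian_metric M" and orient: "orientation M"
  using M by (auto simp: compact_oriented_riemannian_manifold_def)

text \<open>The very term chosen in \<open>integral_form\<close>; naming it lets all inner products
  be expanded over the same list of charts and functions.\<close>

private definition pou :: "('a chart \<times> ('a \<Rightarrow> real)) list" where
  "pou = (SOME P. partition_of_unity M P)"

private lemma pou: "partition_of_unity M pou"
  unfolding pou_def by (rule someI_ex[OF ex_partition_of_unity[OF smooth cpt]])

private lemma pou_member:
  assumes "(c, \<rho>) \<in> set pou"
  shows "c \<in> atlas M" "continuous_map (mtop M) euclideanreal \<rho>"
    "\<And>x. x \<in> topspace (mtop M) \<Longrightarrow> 0 \<le> \<rho> x"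
    "mtop M closure_of {x \<in> topspace (mtop M). \<rho> x \<noteq> 0} \<subseteq> fst c"
proof -
  have "\<forall>(c, \<rho>) \<in> set pou. c \<in> atlas M \<and> continuous_map (mtop M) euclideanreal \<rho> \<and>
        (\<forall>x\<in>topspace (mtop M). 0 \<le> \<rho> x) \<and>
        mtop M closure_of {x \<in> topspace (mtop M). \<rho> x \<noteq> 0} \<subseteq> fst c"
    using pou unfolding partition_of_unity_def by (rule conjunct1)
  from bspec[OF this assms, simplified]
  show "c \<in> atlas M" "continuous_map (mtop M) euclideanreal \<rho>"
    "\<And>x. x \<in> topspace (mtop M) \<Longrightarrow> 0 \<le> \<rho> x"
    "mtop M closure_of {x \<in> topspace (mtop M). \<rho> x \<noteq> 0} \<subseteq> fst c" by simp_all
qed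

private lemma chart: "c \<in> atlas M \<Longrightarrow> is_chart (dimen M) (mtop M) c"
  by (rule smooth_manifold_charts(1)[OF smooth])

private lemma chart_subset: "c \<in> atlas M \<Longrightarrow> x \<in> fst c \<Longrightarrow> x \<in> topspace (mtop M)"
  using openin_subset[OF chart_facts(1)[OF chart]] by blast

private lemma pos_def_metric: "c \<in> atlas M \<Longrightarrow> x \<in> fst c \<Longrightarrow> pos_def (dimen M) (metric M c x)"
  by (rule riemannian_metric_pos_def[OF riem])

private lemma chart_integral_cong:
  assumes "c \<in> atlas M" "\<And>x. x \<in> fst c \<Longrightarrow> f x = g x"
  shows "chart_integral M c f = chart_integral M c g"
  unfolding chart_integral_def
  by (rule integral_Rn_cong)
    (use assms chart_facts(3)[OF chart] in \<open>auto simp: chart_image_def\<close>)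

private lemma form_inner_eq:
  assumes \<alpha>: "\<alpha> \<in> forms M p" and "p \<le> dimen M"
  shows "form_inner M p \<alpha> \<beta> = (\<Sum>(c, \<rho>)\<leftarrow>pou. chart_integral M c (\<lambda>x. \<rho> x * form_density M p \<alpha> \<beta> c x))"
  unfolding form_inner_def integral_form_def pou_def[symmetric] chart_integral_def[symmetric]
proof (intro arg_cong[of _ _ sum_list] map_cong refl, clarify)
  fix c \<rho> assume "(c, \<rho>) \<in> set pou"
  then have c: "c \<in> atlas M" by (rule pou_member)
  have o: "orient M c x \<in> {-1, 1}" if "x \<in> fst c" for x
    using orient c that unfolding orientation_def Let_def by blast
  show "chart_integral M c (\<lambda>x. \<rho> x * orient M c x * wedge p (dimen M - p) \<alpha> (hodge_star M p \<beta>) c x [0..<dimen M]) =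
      chart_integral M c (\<lambda>x. \<rho> x * form_density M p \<alpha> \<beta> c x)"
    by (rule chart_integral_cong[OF c])
      (simp only: mult.assoc wedge_hodge_star[OF \<alpha> assms(2) o] form_density_def)
qed

text \<open>Truncated subtraction makes the complementary degree 0, so \<open>wedge\<close> expects
  lists of length p and returns 0 on one of length \<open>dimen M\<close>. This covers degree p + 1
  when p is the dimension.\<close>

private lemma form_inner_eq_0:
  assumes "dimen M < p"
  shows "form_inner M p \<alpha> \<beta> = 0"
proof -
  have "wedge p (dimen M - p) \<alpha> (hodge_star M p \<beta>) c x [0..<dimen M] = 0" for c x
    using assms by (simp add: wedge_def)
  then show ?thesis
    by (simp add: form_inner_def integral_form_def in_chart_def comp_def integral_Rn_def case_prod_unfold)
qed

private lemma continuous_component: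
  assumes "\<omega> \<in> forms M p" "c \<in> atlas M" "is \<in> multi_indices (dimen M) p"
  shows "continuous_map (subtopology (mtop M) (fst c)) euclideanreal (\<lambda>x. \<omega> c x is)"
  using smooth_on_imp_continuous[OF forms_smooth[OF assms]] continuous_map_in_chart[OF chart[OF assms(2)]] by blast

private lemma continuous_metric:
  assumes "c \<in> atlas M" "i < dimen M" "j < dimen M"
  shows "continuous_map (subtopology (mtop M) (fst c)) euclideanreal (\<lambda>x. metric M c x i j)"
proof -
  have "\<forall>c\<in>atlas M. \<forall>i<dimen M. \<forall>j<dimen M. smooth_on (dimen M) (chart_image c) (in_chart c (\<lambda>x. metric M c x i j))"
    using riem unfolding riemannian_metric_def Let_def by (rule conjunct1)
  then show ?thesis
    using assms smooth_on_imp_continuous continuous_map_in_chart[OF chart[OF assms(1)]] by blast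
qed

private lemma continuous_gram_det:
  assumes "c \<in> atlas M"
  shows "continuous_map (subtopology (mtop M) (fst c)) euclideanreal (\<lambda>x. Determinant.det (gram M c x))"
  unfolding gram_def by (intro continuous_map_det continuous_metric assms)

private lemma continuous_inverse_metric:
  assumes c: "c \<in> atlas M" and ij: "i < dimen M" "j < dimen M"
  shows "continuous_map (subtopology (mtop M) (fst c)) euclideanreal (\<lambda>x. inverse_metric M c x i j)"
proof -
  have "continuous_map (subtopology (mtop M) (fst c)) euclideanreal
      (\<lambda>x. cofactor (gram M c x) j i / Determinant.det (gram M c x))"
  proof (intro continuous_map_real_divide continuous_gram_det c)
    show "continuous_map (subtopology (mtop M) (fst c)) euclideanreal (\<lambda>x. cofactor (gram M c x) j i)"
      unfolding gram_def by (intro continuous_map_cofactor continuous_metric c ij)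
    show "Determinant.det (gram M c x) \<noteq> 0" if "x \<in> topspace (subtopology (mtop M) (fst c))" for x
      using inverse_metric_pos_def(1)[OF pos_def_metric[OF c, of x]] that by simp
  qed
  then show ?thesis
    by (rule continuous_map_eq) (simp add: inverse_metric_pos_def(3)[OF pos_def_metric[OF c]] ij)
qed

private lemma continuous_form_density:
  assumes \<alpha>: "\<alpha> \<in> forms M p" and \<beta>: "\<beta> \<in> forms M p" and c: "c \<in> atlas M"
  shows "continuous_map (subtopology (mtop M) (fst c)) euclideanreal (form_density M p \<alpha> \<beta> c)"
proof -
  have "continuous_map (subtopology (mtop M) (fst c)) euclideanreal
     (\<lambda>x. wedge_const (dimen M) p * sqrt (Determinant.det (gram M c x)) *
      (\<Sum>is\<in>multi_indices (dimen M) p. \<Sum>ks\<in>multi_indices (dimen M) p.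
         (\<Prod>a<p. inverse_metric M c x (is ! a) (ks ! a)) * \<alpha> c x is * \<beta> c x ks))"
    by (intro continuous_map_real_mult continuous_map_sum continuous_map_prod continuous_map_sqrt
        continuous_gram_det continuous_inverse_metric continuous_component[OF \<alpha>] continuous_component[OF \<beta>] c)
      (auto intro: multi_indices_nth)
  then show ?thesis by (simp add: form_density_def[abs_def] tensor_form_def)
qed

private lemma integrable_density:
  assumes "\<alpha> \<in> forms M p" "\<beta> \<in> forms M p" "(c, \<rho>) \<in> set pou"
  shows "integrable (Pi\<^sub>M {..<dimen M} (\<lambda>_. lborel)) (\<lambda>y. indicator (chart_image c) (zero_extend (dimen M) y) *
     in_chart c (\<lambda>x. \<rho> x * form_density M p \<alpha> \<beta> c x) (zero_extend (dimen M) y))"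
  by (intro integrable_chart[where X = "mtop M"] chart cpt continuous_form_density assms pou_member[OF assms(3)])

private lemma form_density_nonneg:
  assumes "c \<in> atlas M" "x \<in> fst c"
  shows "form_density M p \<alpha> \<alpha> c x \<ge> 0"
  using inverse_metric_pos_def(1,2)[OF pos_def_metric[OF assms]] wedge_const_pos[of "dimen M" p]
  by (simp add: form_density_def tensor_form_pos(1))

private lemma chart_integral_nonneg:
  assumes "(c, \<rho>) \<in> set pou"
  shows "chart_integral M c (\<lambda>x. \<rho> x * form_density M p \<alpha> \<alpha> c x) \<ge> 0"
proof -
  note c = pou_member(1)[OF assms]
  have "0 \<le> indicator (chart_image c) y * in_chart c (\<lambda>x. \<rho> x * form_density M p \<alpha> \<alpha> c x) y" for y
    using chart_facts(3)[OF chart[OF c]] pou_member(3)[OF assms chart_subset[OF c]] form_density_nonneg[OF c]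
    by (auto simp: indicator_def chart_image_def)
  then show ?thesis unfolding chart_integral_def integral_Rn_def
    by (intro Bochner_Integration.integral_nonneg)
qed

lemma form_inner_commute:
  assumes "\<alpha> \<in> forms M p" "\<beta> \<in> forms M p"
  shows "form_inner M p \<alpha> \<beta> = form_inner M p \<beta> \<alpha>"
proof (cases "p \<le> dimen M")
  case True
  have "form_density M p \<alpha> \<beta> c x = form_density M p \<beta> \<alpha> c x" if "c \<in> atlas M" "x \<in> fst c" for c x
    unfolding form_density_def
    using tensor_form_commute[OF inverse_metric_pos_def(2)[OF pos_def_metric[OF that]]] by simp
  then show ?thesis unfolding form_inner_eq[OF assms(1) True] form_inner_eq[OF assms(2) True]
    by (intro arg_cong[of _ _ sum_list] map_cong refl) (auto intro!: chart_integral_cong dest: pou_member(1))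
qed (simp add: form_inner_eq_0)

text \<open>Splitting the Bochner integral requires both integrands to be integrable, which is where
  the compact supports of the partition functions enter.\<close>

lemma form_inner_add_right:
  assumes \<alpha>: "\<alpha> \<in> forms M p" and \<beta>: "\<beta> \<in> forms M p" and \<gamma>: "\<gamma> \<in> forms M p"
  shows "form_inner M p \<alpha> (\<beta> + \<gamma>) = form_inner M p \<alpha> \<beta> + form_inner M p \<alpha> \<gamma>"
proof (cases "p \<le> dimen M")
  case True
  have "chart_integral M c (\<lambda>x. \<rho> x * form_density M p \<alpha> (\<beta> + \<gamma>) c x) =
      chart_integral M c (\<lambda>x. \<rho> x * form_density M p \<alpha> \<beta> c x) +
      chart_integral M c (\<lambda>x. \<rho> x * form_density M p \<alpha> \<gamma> c x)" if "(c, \<rho>) \<in> set pou" for c \<rho>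
    unfolding chart_integral_def integral_Rn_def
      Bochner_Integration.integral_add[OF integrable_density[OF \<alpha> \<beta> that] integrable_density[OF \<alpha> \<gamma> that], symmetric]
    by (simp add: form_density_def in_chart_def plus_fun_def tensor_form_add_right algebra_simps)
  then have "form_inner M p \<alpha> (\<beta> + \<gamma>) = (\<Sum>(c, \<rho>)\<leftarrow>pou.
      chart_integral M c (\<lambda>x. \<rho> x * form_density M p \<alpha> \<beta> c x) +
      chart_integral M c (\<lambda>x. \<rho> x * form_density M p \<alpha> \<gamma> c x))"
    unfolding form_inner_eq[OF \<alpha> True] by (intro arg_cong[of _ _ sum_list] map_cong refl) auto
  then show ?thesis unfolding form_inner_eq[OF \<alpha> True]
    by (simp add: case_prod_unfold sum_list_addf)
qed (simp add: form_inner_eq_0)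

lemma form_inner_nonneg:
  assumes "\<alpha> \<in> forms M p"
  shows "form_inner M p \<alpha> \<alpha> \<ge> 0"
proof (cases "p \<le> dimen M")
  case True
  then show ?thesis unfolding form_inner_eq[OF assms True]
    by (intro sum_list_nonneg) (auto intro: chart_integral_nonneg)
qed (simp add: form_inner_eq_0)

text \<open>A zero sum of nonnegative chart integrals has all terms 0, and each continuous integrand
  is then 0 on its chart. At a given x this is applied to a member of the partition that is nonzero
  there.\<close>

lemma form_inner_definite:
  assumes \<alpha>: "\<alpha> \<in> forms M p" and zero: "form_inner M p \<alpha> \<alpha> = 0"
  shows "\<alpha> = 0"
proof -
  have "\<alpha> d x is = 0" if d: "d \<in> atlas M" "x \<in> fst d" and "is": "is \<in> multi_indices (dimen M) p" for d x "is"
  proof (cases "p \<le> dimen M")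
    case True
    have "(\<Sum>(c, \<rho>)\<leftarrow>pou. \<rho> x) = 1"
      using pou chart_subset[OF d] unfolding partition_of_unity_def by blast
    then obtain c \<rho> where c\<rho>: "(c, \<rho>) \<in> set pou" "\<rho> x \<noteq> 0"
      using sum_list_nonneg_eq_0_iff[of "map (\<lambda>(c, \<rho>). \<rho> x) pou"] pou_member(3)[OF _ chart_subset[OF d]]
      by fastforce
    note c = pou_member(1)[OF c\<rho>(1)]
    have x: "x \<in> fst c"
      using closure_of_subset[of "{x \<in> topspace (mtop M). \<rho> x \<noteq> 0}" "mtop M"] pou_member(4)[OF c\<rho>(1)]
        c\<rho>(2) chart_subset[OF d] by blast
    have "chart_integral M c (\<lambda>x. \<rho> x * form_density M p \<alpha> \<alpha> c x) = 0"
      using zero c\<rho>(1) chart_integral_nonneg unfolding form_inner_eq[OF \<alpha> True]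
      by (subst (asm) sum_list_nonneg_eq_0_iff) fastforce+
    then have "\<rho> x * form_density M p \<alpha> \<alpha> c x = 0"
      unfolding chart_integral_def
      by (intro integral_chart_eq_0_imp[OF chart[OF c] continuous_form_density[OF \<alpha> \<alpha> c] pou_member(2)[OF c\<rho>(1)]
            integrable_density[OF \<alpha> \<alpha> c\<rho>(1)] _ _ x] mult_nonneg_nonneg pou_member(3)[OF c\<rho>(1) chart_subset[OF c]]
            form_density_nonneg[OF c])
    then have "tensor_form (dimen M) p (inverse_metric M c x) (\<alpha> c x) (\<alpha> c x) = 0"
      using c\<rho>(2) inverse_metric_pos_def(1)[OF pos_def_metric[OF c x]] wedge_const_pos[of "dimen M" p]
      by (simp add: form_density_def)
    then have "\<alpha> c x js = 0" if "js \<in> multi_indices (dimen M) p" for js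
      using tensor_form_pos(2)[OF inverse_metric_pos_def(2)[OF pos_def_metric[OF c x]]] that by blast
    \<comment> \<open>The partition supplies its own chart c around x; the components in d are
      linear combinations of those in c.\<close>
    then show ?thesis using forms_transform[OF \<alpha> d(1) c d(2) x "is"] by simp
  next
    case False
    \<comment> \<open>In degree above the dimension every index list repeats an entry.\<close>
    then have "\<not> distinct is"
      using "is" distinct_card[of "is"] card_mono[of "{..<dimen M}" "set is"] by (auto simp: multi_indices_def)
    then show ?thesis by (rule forms_not_distinct[OF \<alpha> "is"])
  qed
  then have "\<alpha> d x is = 0" for d x "is" using forms_zero[OF \<alpha>] by blast
  then show ?thesis by (simp add: fun_eq_iff)
qed

end

section \<open>The Laplacian and Green's operator\<close>

lemma ext_d_zero: "ext_d M 0 = 0"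
  by (auto simp: ext_d_def fun_eq_iff intro!: sum.neutral)

text \<open>The bilinear form of the Laplacian after one derivative has been moved across. On
  0-forms there is no degree -1 in which to pair \<delta>\<alpha> and \<delta>\<beta>, which are
  0.\<close>

definition dirichlet_form :: "'a riem_mfd \<Rightarrow> ('a form \<Rightarrow> 'a form) \<Rightarrow> nat \<Rightarrow> 'a form \<Rightarrow> 'a form \<Rightarrow> real" where
  "dirichlet_form M \<delta> p \<alpha> \<beta> = form_inner M (Suc p) (ext_d M \<alpha>) (ext_d M \<beta>) +
     (case p of 0 \<Rightarrow> 0 | Suc q \<Rightarrow> form_inner M q (\<delta> \<alpha>) (\<delta> \<beta>))"

lemma codifferentialD:
  assumes "codifferential M \<delta>"
  shows "\<beta> \<in> forms M 0 \<Longrightarrow> \<delta> \<beta> = 0"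
    and "\<beta> \<in> forms M (Suc p) \<Longrightarrow> \<delta> \<beta> \<in> forms M p"
    and "\<beta> \<in> forms M (Suc p) \<Longrightarrow> \<alpha> \<in> forms M p \<Longrightarrow>
      form_inner M (Suc p) (ext_d M \<alpha>) \<beta> = form_inner M p \<alpha> (\<delta> \<beta>)"
  using assms unfolding codifferential_def by blast+

context
  fixes M :: "'a riem_mfd" and \<delta> :: "'a form \<Rightarrow> 'a form"
  assumes M: "compact_oriented_riemannian_manifold M" and \<delta>: "codifferential M \<delta>"
begin

private lemma d_forms: "\<omega> \<in> forms M p \<Longrightarrow> ext_d M \<omega> \<in> forms M (Suc p)"
  using M by (intro ext_d_forms) (auto simp: compact_oriented_riemannian_manifold_def)

text \<open>Adjointness is stated with d in the left argument, so it applies directly to the term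
  \<delta>d\<beta>, and to d\<delta>\<beta> between two uses of symmetry.\<close>

lemma form_inner_laplacian:
  assumes \<alpha>: "\<alpha> \<in> forms M p" and \<beta>: "\<beta> \<in> forms M p"
  shows "form_inner M p \<alpha> (laplacian M \<delta> \<beta>) = dirichlet_form M \<delta> p \<alpha> \<beta>"
proof -
  have dd: "form_inner M p \<alpha> (\<delta> (ext_d M \<beta>)) = form_inner M (Suc p) (ext_d M \<alpha>) (ext_d M \<beta>)"
    using codifferentialD(3)[OF \<delta> d_forms[OF \<beta>] \<alpha>] by simp
  show ?thesis
  proof (cases p)
    case 0
    then have "\<delta> \<beta> = 0" using codifferentialD(1)[OF \<delta>] \<beta> by simp
    then show ?thesis using 0 dd by (simp add: laplacian_def dirichlet_form_def ext_d_zero)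
  next
    case (Suc q)
    have \<delta>\<beta>: "\<delta> \<beta> \<in> forms M q" and \<delta>\<alpha>: "\<delta> \<alpha> \<in> forms M q"
      using codifferentialD(2)[OF \<delta>] \<alpha> \<beta> Suc by auto
    have d\<delta>\<beta>: "ext_d M (\<delta> \<beta>) \<in> forms M p" using d_forms[OF \<delta>\<beta>] Suc by simp
    have "form_inner M p \<alpha> (ext_d M (\<delta> \<beta>)) = form_inner M p (ext_d M (\<delta> \<beta>)) \<alpha>"
      by (rule form_inner_commute[OF M \<alpha> d\<delta>\<beta>])
    also have "\<dots> = form_inner M q (\<delta> \<beta>) (\<delta> \<alpha>)"
      using codifferentialD(3)[OF \<delta> _ \<delta>\<beta>] \<alpha> Suc by simp
    also have "\<dots> = form_inner M q (\<delta> \<alpha>) (\<delta> \<beta>)" by (rule form_inner_commute[OF M \<delta>\<beta> \<delta>\<alpha>])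
    finally show ?thesis
      using form_inner_add_right[OF M \<alpha> d\<delta>\<beta> codifferentialD(2)[OF \<delta> d_forms[OF \<beta>]]] dd Suc
      by (simp add: laplacian_def dirichlet_form_def)
  qed
qed

lemma dirichlet_form_commute:
  assumes \<alpha>: "\<alpha> \<in> forms M p" and \<beta>: "\<beta> \<in> forms M p"
  shows "dirichlet_form M \<delta> p \<alpha> \<beta> = dirichlet_form M \<delta> p \<beta> \<alpha>"
  unfolding dirichlet_form_def form_inner_commute[OF M d_forms[OF \<alpha>] d_forms[OF \<beta>]]
  using form_inner_commute[OF M codifferentialD(2)[OF \<delta>] codifferentialD(2)[OF \<delta>]] \<alpha> \<beta>
  by (auto split: nat.split)

lemma dirichlet_form_nonneg:
  assumes \<alpha>: "\<alpha> \<in> forms M p"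
  shows "dirichlet_form M \<delta> p \<alpha> \<alpha> \<ge> 0"
  unfolding dirichlet_form_def
  using form_inner_nonneg[OF M d_forms[OF \<alpha>]] form_inner_nonneg[OF M codifferentialD(2)[OF \<delta>]] \<alpha>
  by (auto split: nat.split)

text \<open>By adjointness, \<delta> 0 paired with itself is d(\<delta> 0) paired with 0, and any
  pairing with 0 vanishes by additivity applied to 0 + 0. Hence d\<alpha> = 0 implies
  \<delta>d\<alpha> = 0.\<close>

lemma codifferential_zero: "\<delta> 0 = 0"
proof -
  have z: "form_inner M p \<alpha> 0 = 0" if "\<alpha> \<in> forms M p" for p \<alpha>
    using form_inner_add_right[OF M that zero_forms zero_forms] by simp
  have \<delta>0: "\<delta> 0 \<in> forms M 0" by (rule codifferentialD(2)[OF \<delta> zero_forms])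
  have "form_inner M 0 (\<delta> 0) (\<delta> 0) = 0"
    using codifferentialD(3)[OF \<delta> zero_forms \<delta>0] z[OF d_forms[OF \<delta>0]] by simp
  then show ?thesis by (rule form_inner_definite[OF M \<delta>0])
qed

lemma dirichlet_form_eq_0:
  assumes \<alpha>: "\<alpha> \<in> forms M p" and zero: "dirichlet_form M \<delta> p \<alpha> \<alpha> = 0"
  shows "laplacian M \<delta> \<alpha> = 0"
proof -
  have nn: "form_inner M (Suc p) (ext_d M \<alpha>) (ext_d M \<alpha>) \<ge> 0" by (rule form_inner_nonneg[OF M d_forms[OF \<alpha>]])
  show ?thesis
  proof (cases p)
    case 0
    then have "ext_d M \<alpha> = 0" "\<delta> \<alpha> = 0"
      using zero form_inner_definite[OF M d_forms[OF \<alpha>]] codifferentialD(1)[OF \<delta>] \<alpha>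
      by (auto simp: dirichlet_form_def)
    then show ?thesis by (simp add: laplacian_def ext_d_zero codifferential_zero)
  next
    case (Suc q)
    then have \<delta>\<alpha>: "\<delta> \<alpha> \<in> forms M q" using codifferentialD(2)[OF \<delta>] \<alpha> by simp
    have "form_inner M (Suc p) (ext_d M \<alpha>) (ext_d M \<alpha>) = 0" "form_inner M q (\<delta> \<alpha>) (\<delta> \<alpha>) = 0"
      using zero nn form_inner_nonneg[OF M \<delta>\<alpha>] Suc by (auto simp: dirichlet_form_def)
    then have "ext_d M \<alpha> = 0" "\<delta> \<alpha> = 0"
      using form_inner_definite[OF M d_forms[OF \<alpha>]] form_inner_definite[OF M \<delta>\<alpha>] by auto
    then show ?thesis by (simp add: laplacian_def ext_d_zero codifferential_zero)
  qed
qed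

end

theorem theorem4:
  fixes M :: "'a riem_mfd" and n p :: nat
    and \<delta> H G :: "'a form \<Rightarrow> 'a form"
  assumes "compact_oriented_riemannian_manifold M" and "dimen M = n" and "p \<le> n"
    and "codifferential M \<delta>"
    and "harmonic_projection M \<delta> p H"
    and "green_operator M \<delta> p H G"
  shows "(\<forall>\<alpha>\<in>forms M p. \<forall>\<beta>\<in>forms M p. form_inner M p (G \<alpha>) \<beta> = form_inner M p \<alpha> (G \<beta>)) \<and>
         (\<forall>\<alpha>\<in>forms M p. form_inner M p (G \<alpha>) \<alpha> \<ge> 0 \<and>
            (form_inner M p (G \<alpha>) \<alpha> = 0 \<longleftrightarrow> \<alpha> \<in> harmonic_forms M \<delta> p))"
proof -
  note M = assms(1) and \<delta> = assms(4)
  have H: "H \<alpha> \<in> harmonic_forms M \<delta> p" "\<alpha> - H \<alpha> \<in> forms M p" if "\<alpha> \<in> forms M p" for \<alpha>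
    using assms(5) that by (auto simp: harmonic_projection_def harmonic_perp_def)
  have G: "G \<alpha> \<in> forms M p" "laplacian M \<delta> (G \<alpha>) = \<alpha> - H \<alpha>"
    and perp: "h \<in> harmonic_forms M \<delta> p \<Longrightarrow> form_inner M p (G \<alpha>) h = 0"
    if "\<alpha> \<in> forms M p" for \<alpha> h
    using assms(6) that by (auto simp: green_operator_def harmonic_perp_def)
  have key: "form_inner M p (G \<alpha>) \<beta> = dirichlet_form M \<delta> p (G \<alpha>) (G \<beta>)"
    if \<alpha>: "\<alpha> \<in> forms M p" and \<beta>: "\<beta> \<in> forms M p" for \<alpha> \<beta>
  proof -
    have "H \<beta> \<in> forms M p" using H(1)[OF \<beta>] by (simp add: harmonic_forms_def)
    then have "form_inner M p (G \<alpha>) ((\<beta> - H \<beta>) + H \<beta>) =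
        form_inner M p (G \<alpha>) (\<beta> - H \<beta>) + form_inner M p (G \<alpha>) (H \<beta>)"
      by (rule form_inner_add_right[OF M G(1)[OF \<alpha>] H(2)[OF \<beta>]])
    also have "\<dots> = form_inner M p (G \<alpha>) (laplacian M \<delta> (G \<beta>))"
      by (simp add: perp[OF \<alpha> H(1)[OF \<beta>]] G(2)[OF \<beta>])
    also have "\<dots> = dirichlet_form M \<delta> p (G \<alpha>) (G \<beta>)"
      by (rule form_inner_laplacian[OF M \<delta> G(1)[OF \<alpha>] G(1)[OF \<beta>]])
    finally show ?thesis by simp
  qed
  show ?thesis
  proof (intro conjI ballI iffI)
    fix \<alpha> \<beta> assume \<alpha>: "\<alpha> \<in> forms M p" and \<beta>: "\<beta> \<in> forms M p"
    \<comment> \<open>Symmetry turns the right-hand side into the product of G\<beta> with \<alpha>,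
      so that both sides become Dirichlet forms of G\<alpha> and G\<beta>.\<close>
    show "form_inner M p (G \<alpha>) \<beta> = form_inner M p \<alpha> (G \<beta>)"
      unfolding form_inner_commute[OF M \<alpha> G(1)[OF \<beta>]] key[OF \<alpha> \<beta>] key[OF \<beta> \<alpha>]
      by (rule dirichlet_form_commute[OF M \<delta> G(1)[OF \<alpha>] G(1)[OF \<beta>]])
  next
    fix \<alpha> assume \<alpha>: "\<alpha> \<in> forms M p"
    show "form_inner M p (G \<alpha>) \<alpha> \<ge> 0"
      unfolding key[OF \<alpha> \<alpha>] by (rule dirichlet_form_nonneg[OF M \<delta> G(1)[OF \<alpha>]])
    \<comment> \<open>For harmonic \<alpha> this is just the orthogonality of G\<alpha> to harmonic
      forms.\<close>
    show "form_inner M p (G \<alpha>) \<alpha> = 0" if "\<alpha> \<in> harmonic_forms M \<delta> p"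
      using perp[OF \<alpha> that] .
    assume "form_inner M p (G \<alpha>) \<alpha> = 0"
    then have "laplacian M \<delta> (G \<alpha>) = 0"
      unfolding key[OF \<alpha> \<alpha>] by (rule dirichlet_form_eq_0[OF M \<delta> G(1)[OF \<alpha>]])
    then have "\<alpha> = H \<alpha>" using G(2)[OF \<alpha>] by simp
    then show "\<alpha> \<in> harmonic_forms M \<delta> p" using H(1)[OF \<alpha>] by simp
  qed
qed


end
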